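(* Let $\alpha,s\in\mathbb{N}$ and let $\boldsymbol{\gamma}=(\gamma_u)_{u\subseteq 1:s}$ be weights with $\gamma_u\ge 0$. Then the weighted half-period cosine space $\mathcal{H}(K_{\alpha,\boldsymbol{\gamma},s}^{\mathrm{cos}})$ and the space $\mathcal{H}(K_{\alpha,\boldsymbol{\gamma},s}^{\mathrm{sob(odd-bdry0)}})$ are norm equivalent.
   Context: $\mathbb{N}$ is the set of positive integers and $1:s=\{1,\ldots,s\}$. For a reproducing kernel $K:[0,1]^s\times[0,1]^s\to\mathbb{R}$, $\mathcal{H}(K)$ is the reproducing kernel Hilbert space (RKHS) of real-valued functions on $[0,1]^s$ with kernel $K$, and $\|\cdot\|_K$ is its norm. $\mathcal{H}(K_1)$ is continuously embedded in $\mathcal{H}(K_2)$ if $\mathcal{H}(K_1)\subseteq\mathcal{H}(K_2)$ as sets and there is a constant $C>0$ with $\|f\|_{K_2}\le C\|f\|_{K_1}$ for all $f\in\mathcal{H}(K_1)$; they are norm equivalent if each is continuously embedded in the other. Cosine space: $$K_{\alpha,\boldsymbol{\gamma},s}^{\mathrm{cos}}(\boldsymbol{x},\boldsymbol{y})=1+\sum_{\emptyset\ne u\subseteq 1:s}\gamma_u\prod_{j\in u}\sum_{k_j=1}^{\infty}\frac{2\cos(\pi k_jx_j)\cos(\pi k_jy_j)}{k_j^{2\alpha}}.$$ Univariate Sobolev space: with $B_\tau$ the Bernoulli polynomial of degree $\tau$, $$K_{\alpha,1,1}^{\mathrm{sob}}(x,y)=1+\sum_{\tau=1}^{\alpha}\frac{B_\tau(x)B_\tau(y)}{(\tau!)^2}+(-1)^{\alpha+1}\frac{B_{2\alpha}(|x-y|)}{(2\alpha)!}.$$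 As a set, $\mathcal{H}(K_{\alpha,1,1}^{\mathrm{sob}})$ consists of all $f:[0,1]\to\mathbb{R}$ such that $f^{(\tau)}$ is absolutely continuous for $\tau=0,\ldots,\alpha-1$ and $f^{(\alpha)}\in L^2[0,1]$, and its squared norm is $\left(\int_0^1 f\right)^2+\sum_{\tau=1}^{\alpha-1}\left(\int_0^1 f^{(\tau)}\right)^2+\int_0^1 (f^{(\alpha)})^2$. Let $\mathcal{H}(K_{\alpha,1,1}^{\mathrm{sob(odd-bdry0)}})$ be the closed subspace $\{f\in\mathcal{H}(K_{\alpha,1,1}^{\mathrm{sob}}) : f^{(\tau)}(0)=f^{(\tau)}(1)=0\text{ for all odd }\tau\le\alpha-1\}$ with the inherited inner product, and let $K_{\alpha,1,1}^{\mathrm{sob(odd-bdry0)}}$ be its reproducing kernel. For general $s$ and weights, $$K_{\alpha,\boldsymbol{\gamma},s}^{\mathrm{sob(odd-bdry0)}}(\boldsymbol{x},\boldsymbol{y})=1+\sum_{\emptyset\ne u\subseteq 1:s}\gamma_u\prod_{j\in u}\left[-1+K_{\alpha,1,1}^{\mathrm{sob(odd-bdry0)}}(x_j,y_j)\right].$$ *)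

theory Defs
  imports "HOL-Analysis.Analysis"
begin

text \<open>A Hilbert space of real functions on \<open>X\<close> is a pair of its carrier and its inner product.
  Functions are extensional on \<open>X\<close> and the inner product is zero off the carrier, so that such a
  pair is determined by its values on \<open>X\<close> and on the carrier.\<close>

type_synonym 'a fspace = "('a \<Rightarrow> real) set \<times> (('a \<Rightarrow> real) \<Rightarrow> ('a \<Rightarrow> real) \<Rightarrow> real)"

definition fspace_norm :: "'a fspace \<Rightarrow> ('a \<Rightarrow> real) \<Rightarrow> real" where
  "fspace_norm S f = sqrt (snd S f f)"

locale hilbert_function_space =
  fixes X :: "'a set" and S :: "'a fspace"
  assumes extensional: "fst S \<subseteq> extensional X"
    and zero_mem: "(\<lambda>x\<in>X. 0) \<in> fst S"
    and add_mem: "f \<in> fst S \<Longrightarrow> g \<in> fst S \<Longrightarrow> (\<lambda>x\<in>X. f x + g x) \<in> fst S"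
    and scale_mem: "f \<in> fst S \<Longrightarrow> (\<lambda>x\<in>X. c * f x) \<in> fst S"
    and inner_commute: "snd S f g = snd S g f"
    and inner_add: "f \<in> fst S \<Longrightarrow> g \<in> fst S \<Longrightarrow> h \<in> fst S \<Longrightarrow>
      snd S (\<lambda>x\<in>X. f x + g x) h = snd S f h + snd S g h"
    and inner_scale: "f \<in> fst S \<Longrightarrow> h \<in> fst S \<Longrightarrow> snd S (\<lambda>x\<in>X. c * f x) h = c * snd S f h"
    and inner_nonneg: "f \<in> fst S \<Longrightarrow> snd S f f \<ge> 0"
    and inner_definite: "f \<in> fst S \<Longrightarrow> snd S f f = 0 \<Longrightarrow> f = (\<lambda>x\<in>X. 0)"
    and inner_outside: "f \<notin> fst S \<Longrightarrow> snd S f g = 0"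
    and complete:
      "Metric_space.mcomplete (fst S) (\<lambda>f g. fspace_norm S (\<lambda>x\<in>X. f x - g x))"

locale rkhs = hilbert_function_space X S
  for X :: "'a set" and S :: "'a fspace" +
  fixes K :: "'a \<Rightarrow> 'a \<Rightarrow> real"
  assumes section_mem: "y \<in> X \<Longrightarrow> (\<lambda>x\<in>X. K x y) \<in> fst S"
    and reproducing: "f \<in> fst S \<Longrightarrow> y \<in> X \<Longrightarrow> snd S f (\<lambda>x\<in>X. K x y) = f y"

text \<open>The space \<open>H(K)\<close> of a reproducing kernel \<open>K\<close> on \<open>X\<close>; it exists uniquely by the
  Moore--Aronszajn theorem.\<close>

definition rkhs_of :: "'a set \<Rightarrow> ('a \<Rightarrow> 'a \<Rightarrow> real) \<Rightarrow> 'a fspace" where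
  "rkhs_of X K = (THE S. rkhs X S K)"

definition reproducing_kernel :: "'a set \<Rightarrow> 'a fspace \<Rightarrow> 'a \<Rightarrow> 'a \<Rightarrow> real" where
  "reproducing_kernel X S =
    (THE K. rkhs X S K \<and> (\<forall>x y. x \<notin> X \<or> y \<notin> X \<longrightarrow> K x y = 0))"

definition sub_fspace :: "'a fspace \<Rightarrow> ('a \<Rightarrow> real) set \<Rightarrow> 'a fspace" where
  "sub_fspace S V = (V, \<lambda>f g. if f \<in> V \<and> g \<in> V then snd S f g else 0)"

definition continuously_embedded :: "'a fspace \<Rightarrow> 'a fspace \<Rightarrow> bool" where
  "continuously_embedded S T \<longleftrightarrow> fst S \<subseteq> fst T \<and>
    (\<exists>C>0. \<forall>f\<in>fst S. fspace_norm T f \<le> C * fspace_norm S f)"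

definition norm_equivalent :: "'a fspace \<Rightarrow> 'a fspace \<Rightarrow> bool" where
  "norm_equivalent S T \<longleftrightarrow> continuously_embedded S T \<and> continuously_embedded T S"

text \<open>The cube \<open>[0,1]\<^sup>s\<close>, with coordinates indexed by \<open>{1..s}\<close>.\<close>

definition unit_cube :: "nat \<Rightarrow> (nat \<Rightarrow> real) set" where
  "unit_cube s = PiE {1..s} (\<lambda>_. {0..1})"

definition cos_kernel ::
    "nat \<Rightarrow> (nat set \<Rightarrow> real) \<Rightarrow> nat \<Rightarrow> (nat \<Rightarrow> real) \<Rightarrow> (nat \<Rightarrow> real) \<Rightarrow> real" where
  "cos_kernel \<alpha> \<gamma> s x y = 1 + (\<Sum>u\<in>Pow {1..s} - {{}}. \<gamma> u * (\<Prod>j\<in>u.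
    (\<Sum>k. 2 * cos (pi * real (Suc k) * x j) * cos (pi * real (Suc k) * y j)
          / real (Suc k) ^ (2 * \<alpha>))))"

fun bernoulli_number :: "nat \<Rightarrow> real" where
  "bernoulli_number 0 = 1"
| "bernoulli_number (Suc n) =
    - (\<Sum>k\<le>n. real (Suc (Suc n) choose k) * bernoulli_number k) / real (Suc (Suc n))"

definition bernoulli_poly :: "nat \<Rightarrow> real \<Rightarrow> real" where
  "bernoulli_poly n x = (\<Sum>k\<le>n. real (n choose k) * bernoulli_number k * x ^ (n - k))"

definition sob_kernel :: "nat \<Rightarrow> real \<Rightarrow> real \<Rightarrow> real" where
  "sob_kernel \<alpha> x y =
    1 + (\<Sum>\<tau>=1..\<alpha>. bernoulli_poly \<tau> x * bernoulli_poly \<tau> y / (fact \<tau>)\<^sup>2)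
      + (-1) ^ (\<alpha> + 1) * bernoulli_poly (2 * \<alpha>) \<bar>x - y\<bar> / fact (2 * \<alpha>)"

text \<open>Derivatives of functions on \<open>[0,1]\<close>, one-sided at the endpoints.\<close>

definition unit_deriv :: "nat \<Rightarrow> (real \<Rightarrow> real) \<Rightarrow> real \<Rightarrow> real" where
  "unit_deriv n f = ((\<lambda>g x. vector_derivative g (at x within {0..1})) ^^ n) f"

definition sob_odd_bdry0_space :: "nat \<Rightarrow> real fspace" where
  "sob_odd_bdry0_space \<alpha> = sub_fspace (rkhs_of {0..1} (sob_kernel \<alpha>))
    {f \<in> fst (rkhs_of {0..1} (sob_kernel \<alpha>)).
      \<forall>\<tau>\<le>\<alpha> - 1. odd \<tau> \<longrightarrow> unit_deriv \<tau> f 0 = 0 \<and> unit_deriv \<tau> f 1 = 0}"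

definition sob_odd_bdry0_kernel1 :: "nat \<Rightarrow> real \<Rightarrow> real \<Rightarrow> real" where
  "sob_odd_bdry0_kernel1 \<alpha> = reproducing_kernel {0..1} (sob_odd_bdry0_space \<alpha>)"

definition sob_odd_bdry0_kernel ::
    "nat \<Rightarrow> (nat set \<Rightarrow> real) \<Rightarrow> nat \<Rightarrow> (nat \<Rightarrow> real) \<Rightarrow> (nat \<Rightarrow> real) \<Rightarrow> real" where
  "sob_odd_bdry0_kernel \<alpha> \<gamma> s x y = 1 + (\<Sum>u\<in>Pow {1..s} - {{}}. \<gamma> u * (\<Prod>j\<in>u.
    - 1 + sob_odd_bdry0_kernel1 \<alpha> (x j) (y j)))"

end

theory Submission
  imports Defs
begin

text \<open>Both kernels are positive semidefinite, and a space \<open>H(K)\<close> is continuously embedded in \<open>H(L)\<close>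
  as soon as \<open>C * L - K\<close> is positive semidefinite for some \<open>C\<close> (Aronszajn), because \<open>H(K)\<close>
  consists of the functions \<open>f\<close> whose evaluations satisfy
  \<open>(\<Sum>x. c x * f x)\<^sup>2 \<le> M * (\<Sum>x. \<Sum>y. c x * c y * K x y)\<close>, and the least \<open>M\<close> is the squared norm.
  By the Schur product theorem such kernel inequalities pass to products and weighted sums, so the
  univariate case of mean-free functions suffices.

  There, a cosine series with coefficients weighted by \<open>k\<^sup>\<alpha>\<close> lies in the Sobolev space since a
  smooth function is its Bernoulli part plus an absolutely convergent trigonometric series whose
  coefficients are controlled by Bessel's inequality for the \<open>\<alpha>\<close>-th derivative. Conversely, repeated
  integration by parts against half-period cosines has no boundary terms when the odd derivatives
  vanish at \<open>0\<close> and \<open>1\<close>, and Bessel's inequality bounds the weighted cosine coefficients.\<close>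

section \<open>Hilbert spaces of functions\<close>

text \<open>Members of the univariate spaces have an \<alpha>-th derivative only in the
  square-integrable sense, so that derivative is never formed. The full Sobolev kernel and the
  cosine kernel are written as sums of products \<open>\<phi> n x * \<phi> n y\<close> of explicit
  smooth features, and all calculus is done on finite sums of features: partial sums of a cosine
  series in one direction, partial sums of the Sobolev expansion in the other. Estimates uniform in
  the number of terms then pass to the limit, because a bound on evaluations survives pointwise
  convergence. The Sobolev partial sums need not satisfy the boundary conditions; their boundary
  terms vanish only in the limit.

  The constants are explicit. Bounding a Sobolev norm by cosine coefficients costs
  \<open>(\<alpha> + 1) * pi ^ (2 * \<alpha>)\<close>: the power of \<open>pi\<close> comes from
  differentiating frequency \<open>pi * k\<close> at most \<alpha> times, and
  \<open>\<alpha> + 1\<close> counts the terms of the norm. The converse costs one, since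
  \<open>(pi * k) ^ \<alpha>\<close> is at least \<open>k ^ \<alpha>\<close>. A univariate constant
  \<open>C\<close> that is at least one becomes \<open>C ^ s\<close> for the weighted
  products.\<close>

lemma mult_self_le_cancel:
  fixes q m :: real
  assumes "q * q \<le> q * m" "0 \<le> q" "0 \<le> m"
  shows "q \<le> m"
  using assms by (cases "q = 0") simp_all

lemma power2_diff_le: "(a - b)\<^sup>2 \<le> 2 * a\<^sup>2 + 2 * (b\<^sup>2 :: real)"
  using zero_le_power2[of "a + b"] by (simp add: power2_eq_square algebra_simps)

lemma quadratic_nonneg_imp_discriminant:
  fixes q r e :: real
  assumes nn: "\<And>t. 0 \<le> t\<^sup>2 * q + 2 * t * r + e" and q: "q \<ge> 0"
  shows "r\<^sup>2 \<le> e * q"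
proof (cases "q = 0")
  case True
  have "r = 0"
  proof (rule ccontr)
    assume "r \<noteq> 0"
    \<comment> \<open>For \<open>q = 0\<close> the form is affine in \<open>t\<close>, and this
      \<open>t\<close> gives it the value -1.\<close>
    with nn[of "- (e + 1) / (2 * r)"] True show False by (simp add: field_simps)
  qed
  then show ?thesis using True by simp
next
  case False
  with q have q: "q > 0" by simp
  \<comment> \<open>The minimiser of the quadratic in \<open>t\<close>.\<close>
  have "0 \<le> (- r / q)\<^sup>2 * q + 2 * (- r / q) * r + e" by (rule nn)
  also have "\<dots> = e - r\<^sup>2 / q" using q by (simp add: field_simps power2_eq_square)
  finally show ?thesis using q by (simp add: field_simps)
qed

text \<open>The \<open>c n\<close> are near-minimisers of \<open>B c c - 2 * L c\<close>.\<close>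

lemma approximate_riesz:
  fixes B :: "'b \<Rightarrow> 'b \<Rightarrow> real" and L :: "'b \<Rightarrow> real" and axpy :: "'b \<Rightarrow> real \<Rightarrow> 'b \<Rightarrow> 'b"
  assumes ne: "P \<noteq> {}"
    and mem: "\<And>c d t. c \<in> P \<Longrightarrow> d \<in> P \<Longrightarrow> axpy c t d \<in> P"
    and B_axpy: "\<And>c d e t. c \<in> P \<Longrightarrow> d \<in> P \<Longrightarrow> e \<in> P \<Longrightarrow> B (axpy c t d) e = B c e + t * B d e"
    and L_axpy: "\<And>c d t. c \<in> P \<Longrightarrow> d \<in> P \<Longrightarrow> L (axpy c t d) = L c + t * L d"
    and sym: "\<And>c d. c \<in> P \<Longrightarrow> d \<in> P \<Longrightarrow> B c d = B d c"
    and pos: "\<And>c. c \<in> P \<Longrightarrow> 0 \<le> B c c"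
    and bound: "\<And>c. c \<in> P \<Longrightarrow> (L c)\<^sup>2 \<le> M * B c c"
  obtains c where "\<And>n. c n \<in> P"
    "\<And>n d. d \<in> P \<Longrightarrow> (B (c n) d - L d)\<^sup>2 \<le> B d d / real (Suc n)"
proof -
  define J where "J c = B c c - 2 * L c" for c
  \<comment> \<open>The arithmetic-geometric mean inequality turns the bound on \<open>L\<close>
    into \<open>2 * \<bar>L c\<bar> \<le> \<bar>M\<bar> + B c c\<close>, which keeps
    \<open>J\<close> above \<open>- \<bar>M\<bar>\<close>.\<close>
  have lower: "- \<bar>M\<bar> \<le> J c" if c: "c \<in> P" for c
  proof -
    have "(2 * L c)\<^sup>2 \<le> 4 * (\<bar>M\<bar> * B c c)"
      using bound[OF c] mult_right_mono[OF abs_ge_self[of M] pos[OF c]] by (simp add: power_mult_distrib)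
    also have "\<dots> \<le> (\<bar>M\<bar> + B c c)\<^sup>2"
      using zero_le_power2[of "\<bar>M\<bar> - B c c"] by (simp add: power2_eq_square algebra_simps)
    finally have "\<bar>2 * L c\<bar> \<le> \<bar>\<bar>M\<bar> + B c c\<bar>" by (simp only: abs_le_square_iff)
    then show ?thesis unfolding J_def using pos[OF c] by linarith
  qed
  have bdd: "bdd_below (J ` P)" by (rule bdd_belowI[of _ "- \<bar>M\<bar>"]) (use lower in auto)
  have "\<exists>c\<in>P. J c < Inf (J ` P) + 1 / real (Suc n)" for n
  proof -
    have "\<exists>y\<in>J ` P. y < Inf (J ` P) + 1 / real (Suc n)"
      by (rule cInf_lessD) (use ne in auto)
    then show ?thesis by auto
  qed
  then obtain c where c: "\<And>n. c n \<in> P" and cJ: "\<And>n. J (c n) < Inf (J ` P) + 1 / real (Suc n)"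
    by metis
  have "(B (c n) d - L d)\<^sup>2 \<le> B d d / real (Suc n)" if d: "d \<in> P" for n d
  proof -
    \<comment> \<open>Moving a near-minimiser along \<open>d\<close> lowers \<open>J\<close> by at
      most \<open>1 / (n + 1)\<close>. As this holds for every step length \<open>t\<close>, the
      discriminant bounds the linear coefficient.\<close>
    have "(B (c n) d - L d)\<^sup>2 \<le> 1 / real (Suc n) * B d d"
    proof (rule quadratic_nonneg_imp_discriminant)
      fix t
      have m: "axpy (c n) t d \<in> P" using c d mem by blast
      have "B (axpy (c n) t d) (axpy (c n) t d)
          = B (axpy (c n) t d) (c n) + t * B (axpy (c n) t d) d"
        using B_axpy[OF c d m, of n t] sym[OF m c, of n] sym[OF m d] by simp
      also have "\<dots> = B (c n) (c n) + 2 * t * B (c n) d + t\<^sup>2 * B d d"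
        using B_axpy[OF c d c] B_axpy[OF c d d] sym[OF d c] by (simp add: algebra_simps power2_eq_square)
      finally have "J (axpy (c n) t d) = J (c n) + 2 * t * (B (c n) d - L d) + t\<^sup>2 * B d d"
        unfolding J_def using L_axpy[OF c d] by (simp add: algebra_simps)
      moreover have "Inf (J ` P) \<le> J (axpy (c n) t d)" by (rule cInf_lower) (use m bdd in auto)
      ultimately show "0 \<le> t\<^sup>2 * B d d + 2 * t * (B (c n) d - L d) + 1 / real (Suc n)"
        using cJ[of n] by linarith
    qed (rule pos[OF d])
    then show ?thesis by simp
  qed
  with c show ?thesis by (rule that)
qed

text \<open>Everything but completeness. A candidate space is first shown to satisfy these axioms;
  Cauchy-Schwarz and the metric are then available while its completeness is being proved.\<close>

locale pre_hilbert_function_space =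
  fixes X :: "'a set" and S :: "'a fspace"
  assumes extensional: "fst S \<subseteq> extensional X"
    and zero_mem: "(\<lambda>x\<in>X. 0) \<in> fst S"
    and add_mem: "f \<in> fst S \<Longrightarrow> g \<in> fst S \<Longrightarrow> (\<lambda>x\<in>X. f x + g x) \<in> fst S"
    and scale_mem: "f \<in> fst S \<Longrightarrow> (\<lambda>x\<in>X. c * f x) \<in> fst S"
    and inner_commute: "snd S f g = snd S g f"
    and inner_add: "f \<in> fst S \<Longrightarrow> g \<in> fst S \<Longrightarrow> h \<in> fst S \<Longrightarrow>
      snd S (\<lambda>x\<in>X. f x + g x) h = snd S f h + snd S g h"
    and inner_scale: "f \<in> fst S \<Longrightarrow> h \<in> fst S \<Longrightarrow> snd S (\<lambda>x\<in>X. c * f x) h = c * snd S f h"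
    and inner_nonneg: "f \<in> fst S \<Longrightarrow> snd S f f \<ge> 0"
    and inner_definite: "f \<in> fst S \<Longrightarrow> snd S f f = 0 \<Longrightarrow> f = (\<lambda>x\<in>X. 0)"
    and inner_outside: "f \<notin> fst S \<Longrightarrow> snd S f g = 0"
begin

lemma axpy_mem:
  assumes "f \<in> fst S" "g \<in> fst S"
  shows "(\<lambda>x\<in>X. f x + t * g x) \<in> fst S"
proof -
  have "(\<lambda>x\<in>X. f x + t * g x) = (\<lambda>x\<in>X. f x + (\<lambda>x\<in>X. t * g x) x)" by auto
  then show ?thesis using add_mem[OF assms(1) scale_mem[OF assms(2), of t]] by simp
qed

lemma inner_axpy:
  assumes "f \<in> fst S" "g \<in> fst S" "h \<in> fst S"
  shows "snd S (\<lambda>x\<in>X. f x + t * g x) h = snd S f h + t * snd S g h"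
proof -
  have "(\<lambda>x\<in>X. f x + t * g x) = (\<lambda>x\<in>X. f x + (\<lambda>x\<in>X. t * g x) x)" by auto
  then show ?thesis
    using inner_add[OF assms(1) scale_mem[OF assms(2), of t] assms(3)] inner_scale[OF assms(2,3), of t]
    by simp
qed

lemma diff_mem:
  assumes "f \<in> fst S" "g \<in> fst S"
  shows "(\<lambda>x\<in>X. f x - g x) \<in> fst S"
  using axpy_mem[OF assms, of "-1"] by simp

lemma inner_diff:
  assumes "f \<in> fst S" "g \<in> fst S" "h \<in> fst S"
  shows "snd S (\<lambda>x\<in>X. f x - g x) h = snd S f h - snd S g h"
  using inner_axpy[OF assms, of "-1"] by simp

lemma inner_diff_right:
  assumes "f \<in> fst S" "g \<in> fst S" "h \<in> fst S"
  shows "snd S h (\<lambda>x\<in>X. f x - g x) = snd S h f - snd S h g"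
  using inner_diff[OF assms] by (simp add: inner_commute)

lemma inner_axpy_self:
  assumes "f \<in> fst S" "g \<in> fst S"
  shows "snd S (\<lambda>x\<in>X. f x + t * g x) (\<lambda>x\<in>X. f x + t * g x)
    = snd S f f + 2 * t * snd S f g + t\<^sup>2 * snd S g g"
proof -
  have "snd S (\<lambda>x\<in>X. f x + t * g x) (\<lambda>x\<in>X. f x + t * g x)
    = snd S (\<lambda>x\<in>X. f x + t * g x) f + t * snd S (\<lambda>x\<in>X. f x + t * g x) g"
    using inner_axpy[OF assms axpy_mem[OF assms]] by (simp add: inner_commute)
  then show ?thesis
    using inner_axpy[OF assms assms(1)] inner_axpy[OF assms assms(2)] inner_commute[of g f]
    by (simp add: algebra_simps power2_eq_square)
qed

lemma inner_diff_self:
  assumes "f \<in> fst S" "g \<in> fst S"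
  shows "snd S (\<lambda>x\<in>X. f x - g x) (\<lambda>x\<in>X. f x - g x) = snd S f f - 2 * snd S f g + snd S g g"
  using inner_axpy_self[OF assms, of "-1"] by simp

lemma inner_self_nonneg: "0 \<le> snd S f f"
  using inner_nonneg inner_outside by (cases "f \<in> fst S") auto

lemma Cauchy_Schwarz:
  assumes "f \<in> fst S" "g \<in> fst S"
  shows "(snd S f g)\<^sup>2 \<le> snd S f f * snd S g g"
proof (rule quadratic_nonneg_imp_discriminant)
  show "0 \<le> t\<^sup>2 * snd S g g + 2 * t * snd S f g + snd S f f" for t
    using inner_axpy_self[OF assms, of t] inner_self_nonneg[of "\<lambda>x\<in>X. f x + t * g x"] by simp
qed (rule inner_self_nonneg)

lemma Cauchy_Schwarz_norm:
  assumes "f \<in> fst S" "g \<in> fst S"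
  shows "\<bar>snd S f g\<bar> \<le> fspace_norm S f * fspace_norm S g"
  using real_sqrt_le_mono[OF Cauchy_Schwarz[OF assms]]
  by (simp add: fspace_norm_def real_sqrt_mult)

lemma norm_add:
  assumes "f \<in> fst S" "g \<in> fst S"
  shows "fspace_norm S (\<lambda>x\<in>X. f x + g x) \<le> fspace_norm S f + fspace_norm S g"
proof -
  have "snd S (\<lambda>x\<in>X. f x + g x) (\<lambda>x\<in>X. f x + g x) = snd S f f + 2 * snd S f g + snd S g g"
    using inner_axpy_self[OF assms, of 1] by simp
  also have "\<dots> \<le> (fspace_norm S f + fspace_norm S g)\<^sup>2"
    using Cauchy_Schwarz_norm[OF assms] inner_self_nonneg[of f] inner_self_nonneg[of g]
    by (simp add: power2_sum fspace_norm_def)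
  finally show ?thesis
    unfolding fspace_norm_def[of S "\<lambda>x\<in>X. f x + g x"]
    by (rule real_le_lsqrt[rotated]) (simp add: fspace_norm_def inner_self_nonneg)
qed

lemma restrict_mem: "f \<in> fst S \<Longrightarrow> restrict f X = f"
  using extensional extensional_restrict by blast

lemma mem_ext: "f \<in> fst S \<Longrightarrow> g \<in> fst S \<Longrightarrow> (\<And>x. x \<in> X \<Longrightarrow> f x = g x) \<Longrightarrow> f = g"
  using extensional by (meson extensionalityI subsetD)

lemma metric_space: "Metric_space (fst S) (\<lambda>f g. fspace_norm S (\<lambda>x\<in>X. f x - g x))"
proof
  fix f g h
  show "0 \<le> fspace_norm S (\<lambda>x\<in>X. f x - g x)" by (simp add: fspace_norm_def inner_self_nonneg)
  have neg: "snd S (\<lambda>x\<in>X. g x - f x) (\<lambda>x\<in>X. g x - f x) = snd S (\<lambda>x\<in>X. f x - g x) (\<lambda>x\<in>X. f x - g x)"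
    if "(\<lambda>x\<in>X. f x - g x) \<in> fst S" for f g
  proof -
    have eq: "(\<lambda>x\<in>X. g x - f x) = (\<lambda>x\<in>X. -1 * (\<lambda>x\<in>X. f x - g x) x)" by auto
    have m: "(\<lambda>x\<in>X. -1 * (\<lambda>x\<in>X. f x - g x) x) \<in> fst S" by (rule scale_mem[OF that])
    show ?thesis
      unfolding eq using inner_scale[OF that m, of "-1"] inner_scale[OF that that, of "-1"]
      by (simp add: inner_commute)
  qed
  \<comment> \<open>\<open>Metric_space\<close> demands symmetry for all functions, also off the
    carrier. If neither difference is a member, both inner products have the default value
    zero.\<close>
  show "fspace_norm S (\<lambda>x\<in>X. f x - g x) = fspace_norm S (\<lambda>x\<in>X. g x - f x)"
  proof (cases "(\<lambda>x\<in>X. f x - g x) \<in> fst S")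
    case True
    show ?thesis unfolding fspace_norm_def by (rule arg_cong[OF neg[OF True, symmetric]])
  next
    case False
    show ?thesis
    proof (cases "(\<lambda>x\<in>X. g x - f x) \<in> fst S")
      case True
      show ?thesis unfolding fspace_norm_def by (rule arg_cong[OF neg[OF True]])
    next
      case F: False
      show ?thesis unfolding fspace_norm_def by (simp only: inner_outside[OF False] inner_outside[OF F])
    qed
  qed
  assume f: "f \<in> fst S" and g: "g \<in> fst S"
  show "fspace_norm S (\<lambda>x\<in>X. f x - g x) = 0 \<longleftrightarrow> f = g"
  proof
    assume "fspace_norm S (\<lambda>x\<in>X. f x - g x) = 0"
    then have "(\<lambda>x\<in>X. f x - g x) = (\<lambda>x\<in>X. 0)"
      using inner_definite[OF diff_mem[OF f g]] by (simp add: fspace_norm_def)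
    then have "(\<lambda>x\<in>X. f x - g x) x = 0" if "x \<in> X" for x using that by (simp only: restrict_apply if_True)
    then have "f x = g x" if "x \<in> X" for x using that by simp
    then show "f = g" using mem_ext[OF f g] by blast
  next
    assume "f = g"
    then show "fspace_norm S (\<lambda>x\<in>X. f x - g x) = 0"
      using inner_diff_self[OF f f] by (simp add: fspace_norm_def)
  qed
  assume h: "h \<in> fst S"
  have "(\<lambda>x\<in>X. f x - h x) = (\<lambda>x\<in>X. (\<lambda>x\<in>X. f x - g x) x + (\<lambda>x\<in>X. g x - h x) x)" by auto
  then show "fspace_norm S (\<lambda>x\<in>X. f x - h x)
      \<le> fspace_norm S (\<lambda>x\<in>X. f x - g x) + fspace_norm S (\<lambda>x\<in>X. g x - h x)"
    using norm_add[OF diff_mem[OF f g] diff_mem[OF g h]] by simp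
qed

lemma lincomb_mem:
  assumes "finite I" "\<And>i. i \<in> I \<Longrightarrow> g i \<in> fst S"
  shows "(\<lambda>x\<in>X. \<Sum>i\<in>I. c i * g i x) \<in> fst S"
  using assms
proof (induction I rule: finite_induct)
  case empty
  show ?case unfolding sum.empty by (rule zero_mem)
next
  case (insert i I)
  have "(\<lambda>x\<in>X. (\<lambda>x\<in>X. \<Sum>i\<in>I. c i * g i x) x + c i * g i x) \<in> fst S"
    by (rule axpy_mem) (use insert in auto)
  moreover have "(\<lambda>x\<in>X. (\<lambda>x\<in>X. \<Sum>i\<in>I. c i * g i x) x + c i * g i x)
      = (\<lambda>x\<in>X. \<Sum>i\<in>insert i I. c i * g i x)"
    using insert by (auto simp: add.commute)
  ultimately show ?case by (simp only:)
qed

lemma inner_lincomb: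
  assumes "finite I" "\<And>i. i \<in> I \<Longrightarrow> g i \<in> fst S" "h \<in> fst S"
  shows "snd S h (\<lambda>x\<in>X. \<Sum>i\<in>I. c i * g i x) = (\<Sum>i\<in>I. c i * snd S h (g i))"
  using assms
proof (induction I rule: finite_induct)
  case empty
  have "snd S (\<lambda>x\<in>X. 0) h = 0" using inner_diff[OF empty(2) empty(2) empty(2)] by simp
  then show ?case unfolding sum.empty by (simp only: inner_commute)
next
  case (insert i I)
  have "(\<lambda>x\<in>X. \<Sum>i\<in>insert i I. c i * g i x)
      = (\<lambda>x\<in>X. (\<lambda>x\<in>X. \<Sum>i\<in>I. c i * g i x) x + c i * g i x)"
    using insert by (auto simp: add.commute)
  moreover have "snd S (\<lambda>x\<in>X. (\<lambda>x\<in>X. \<Sum>i\<in>I. c i * g i x) x + c i * g i x) h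
      = snd S (\<lambda>x\<in>X. \<Sum>i\<in>I. c i * g i x) h + c i * snd S (g i) h"
    by (intro inner_axpy lincomb_mem) (use insert in auto)
  moreover have "snd S h (\<lambda>x\<in>X. \<Sum>i\<in>I. c i * g i x) = (\<Sum>i\<in>I. c i * snd S h (g i))"
    by (intro insert.IH) (use insert in auto)
  ultimately have "snd S (\<lambda>x\<in>X. \<Sum>i\<in>insert i I. c i * g i x) h
      = (\<Sum>i\<in>I. c i * snd S h (g i)) + c i * snd S h (g i)"
    by (simp only: inner_commute)
  also have "\<dots> = (\<Sum>i\<in>insert i I. c i * snd S h (g i))"
    using insert(1,2) by simp
  finally show ?case by (simp only: inner_commute)
qed

definition sequentially_complete :: bool where
  "sequentially_complete \<longleftrightarrow> (\<forall>s. (\<forall>n. s n \<in> fst S) \<longrightarrow>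
    (\<forall>e>0. \<exists>N. \<forall>m\<ge>N. \<forall>n\<ge>N. fspace_norm S (\<lambda>x\<in>X. s m x - s n x) < e) \<longrightarrow>
    (\<exists>g\<in>fst S. (\<lambda>n. fspace_norm S (\<lambda>x\<in>X. s n x - g x)) \<longlonglongrightarrow> 0))"

lemma mcomplete_iff:
  "Metric_space.mcomplete (fst S) (\<lambda>f g. fspace_norm S (\<lambda>x\<in>X. f x - g x)) \<longleftrightarrow> sequentially_complete"
proof -
  interpret Metric_space "fst S" "\<lambda>f g. fspace_norm S (\<lambda>x\<in>X. f x - g x)" by (rule metric_space)
  have "(\<exists>x. limitin mtopology s x sequentially) \<longleftrightarrow>
      (\<exists>g\<in>fst S. (\<lambda>n. fspace_norm S (\<lambda>x\<in>X. s n x - g x)) \<longlonglongrightarrow> 0)"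
    if "range s \<subseteq> fst S" for s
    using that unfolding limitin_metric_dist_null by (auto simp: image_subset_iff)
  moreover have "(\<forall>n. s n \<in> fst S) \<longleftrightarrow> range s \<subseteq> fst S" for s by auto
  ultimately show ?thesis
    unfolding mcomplete_def MCauchy_def sequentially_complete_def by (smt (verit))
qed

lemma hilbert_function_space_iff: "hilbert_function_space X S \<longleftrightarrow> sequentially_complete"
proof
  assume "hilbert_function_space X S"
  then show sequentially_complete using hilbert_function_space.complete mcomplete_iff by blast
next
  assume sequentially_complete
  then show "hilbert_function_space X S"
    by (intro hilbert_function_space.intro)
      (rule extensional zero_mem add_mem scale_mem inner_commute inner_add inner_scale inner_nonneg
          inner_definite inner_outside; assumption | simp add: mcomplete_iff)+
qed

end

sublocale hilbert_function_space \<subseteq> pre_hilbert_function_space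
  by (intro pre_hilbert_function_space.intro)
    (fact extensional zero_mem add_mem scale_mem inner_commute inner_add inner_scale inner_nonneg
      inner_definite inner_outside)+

lemma (in hilbert_function_space) sequentially_complete: sequentially_complete
  using hilbert_function_space_iff hilbert_function_space_axioms by blast

section \<open>Positive semidefinite kernels and the Moore--Aronszajn theorem\<close>

text \<open>An element \<open>c\<close> stands for the finite combination of point evaluations with
  these coefficients, and equally for that combination of kernel sections. On these,
  \<open>lin f\<close> is the action on \<open>f\<close>, and \<open>quad K\<close> is the inner
  product of two combinations of sections.\<close>

definition finsupp :: "'a set \<Rightarrow> ('a \<Rightarrow> real) set" where
  "finsupp X = {c. finite {x. c x \<noteq> 0} \<and> {x. c x \<noteq> 0} \<subseteq> X}"

definition lin :: "('a \<Rightarrow> real) \<Rightarrow> ('a \<Rightarrow> real) \<Rightarrow> real" where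
  "lin f c = (\<Sum>x | c x \<noteq> 0. c x * f x)"

definition quad :: "('a \<Rightarrow> 'a \<Rightarrow> real) \<Rightarrow> ('a \<Rightarrow> real) \<Rightarrow> ('a \<Rightarrow> real) \<Rightarrow> real" where
  "quad K c d = lin (\<lambda>x. lin (K x) d) c"

definition psd :: "'a set \<Rightarrow> ('a \<Rightarrow> 'a \<Rightarrow> real) \<Rightarrow> bool" where
  "psd X K \<longleftrightarrow> (\<forall>x\<in>X. \<forall>y\<in>X. K x y = K y x) \<and> (\<forall>c\<in>finsupp X. 0 \<le> quad K c c)"

lemma lin_superset:
  assumes "finite F" "{x. c x \<noteq> 0} \<subseteq> F"
  shows "lin f c = (\<Sum>x\<in>F. c x * f x)"
  unfolding lin_def by (rule sum.mono_neutral_left) (use assms in auto)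

lemma quad_superset:
  assumes "finite F" "{x. c x \<noteq> 0} \<subseteq> F" "{x. d x \<noteq> 0} \<subseteq> F"
  shows "quad K c d = (\<Sum>x\<in>F. \<Sum>y\<in>F. c x * d y * K x y)"
  unfolding quad_def lin_superset[OF assms(1,2)] lin_superset[OF assms(1,3)]
  by (simp add: sum_distrib_left mult.assoc)

lemma zero_finsupp: "(\<lambda>x. 0) \<in> finsupp X"
  by (simp add: finsupp_def)

lemma finsupp_axpy:
  assumes "c \<in> finsupp X" "d \<in> finsupp X"
  shows "(\<lambda>x. c x + t * d x) \<in> finsupp X"
proof -
  have "{x. c x + t * d x \<noteq> 0} \<subseteq> {x. c x \<noteq> 0} \<union> {x. d x \<noteq> 0}" by auto
  with assms show ?thesis unfolding finsupp_def using finite_subset by blast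
qed

lemma lin_axpy:
  assumes "c \<in> finsupp X" "d \<in> finsupp X"
  shows "lin f (\<lambda>x. c x + t * d x) = lin f c + t * lin f d"
proof -
  define F where "F = {x. c x \<noteq> 0} \<union> {x. d x \<noteq> 0}"
  have F: "finite F" using assms by (simp add: F_def finsupp_def)
  have "lin f (\<lambda>x. c x + t * d x) = (\<Sum>x\<in>F. (c x + t * d x) * f x)"
    by (rule lin_superset[OF F]) (auto simp: F_def)
  moreover have "lin f c = (\<Sum>x\<in>F. c x * f x)" by (rule lin_superset[OF F]) (auto simp: F_def)
  moreover have "lin f d = (\<Sum>x\<in>F. d x * f x)" by (rule lin_superset[OF F]) (auto simp: F_def)
  ultimately show ?thesis by (simp add: sum.distrib sum_distrib_left algebra_simps)
qed

lemma lin_diff: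
  assumes "c \<in> finsupp X" "d \<in> finsupp X"
  shows "lin f (\<lambda>x. c x - d x) = lin f c - lin f d"
  using lin_axpy[OF assms, of f "-1"] by simp

lemma lin_cong: "c \<in> finsupp X \<Longrightarrow> (\<And>x. x \<in> X \<Longrightarrow> f x = g x) \<Longrightarrow> lin f c = lin g c"
  unfolding lin_def finsupp_def by (intro sum.cong) auto

lemma lin_restrict: "c \<in> finsupp X \<Longrightarrow> lin (restrict f X) c = lin f c"
  by (rule lin_cong) auto

lemma lin_fun_add: "lin (\<lambda>x. f x + g x) c = lin f c + lin g c"
  by (simp add: lin_def sum.distrib algebra_simps)

lemma lin_fun_diff: "lin (\<lambda>x. f x - g x) c = lin f c - lin g c"
  by (simp add: lin_def sum_subtractf algebra_simps)

lemma lin_fun_scale: "lin (\<lambda>x. t * f x) c = t * lin f c"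
  by (simp add: lin_def sum_distrib_left algebra_simps)

lemma lin_fun_sum: "lin (\<lambda>x. \<Sum>i\<in>I. f i x) c = (\<Sum>i\<in>I. lin (f i) c)"
  unfolding lin_def sum_distrib_left by (rule sum.swap)

lemma delta_finsupp: "y \<in> X \<Longrightarrow> (\<lambda>x. of_bool (x = y)) \<in> finsupp X"
  by (simp add: finsupp_def)

lemma lin_delta: "lin f (\<lambda>x. of_bool (x = y)) = f y"
  by (simp add: lin_def)

lemma quad_axpy:
  assumes "c \<in> finsupp X" "d \<in> finsupp X"
  shows "quad K (\<lambda>x. c x + t * d x) e = quad K c e + t * quad K d e"
  unfolding quad_def by (rule lin_axpy[OF assms])

lemma quad_diff:
  assumes "c \<in> finsupp X" "d \<in> finsupp X"
  shows "quad K (\<lambda>x. c x - d x) e = quad K c e - quad K d e"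
  unfolding quad_def by (rule lin_diff[OF assms])

lemma quad_delta: "quad K c (\<lambda>x. of_bool (x = y)) = lin (\<lambda>x. K x y) c"
  by (simp add: quad_def lin_delta)

lemma quad_commute:
  assumes "c \<in> finsupp X" "d \<in> finsupp X" "\<And>x y. x \<in> X \<Longrightarrow> y \<in> X \<Longrightarrow> K x y = K y x"
  shows "quad K c d = quad K d c"
proof -
  define F where "F = {x. c x \<noteq> 0} \<union> {x. d x \<noteq> 0}"
  have F: "finite F" "F \<subseteq> X" using assms by (auto simp: F_def finsupp_def)
  have "quad K c d = (\<Sum>x\<in>F. \<Sum>y\<in>F. c x * d y * K x y)"
    by (rule quad_superset[OF F(1)]) (auto simp: F_def)
  also have "\<dots> = (\<Sum>y\<in>F. \<Sum>x\<in>F. c x * d y * K x y)" by (rule sum.swap)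
  also have "\<dots> = (\<Sum>y\<in>F. \<Sum>x\<in>F. d y * c x * K y x)"
    using F assms(3) by (intro sum.cong refl) (auto simp: mult.commute)
  also have "\<dots> = quad K d c"
    by (rule quad_superset[OF F(1), symmetric]) (auto simp: F_def)
  finally show ?thesis .
qed

lemma quad_kernel_add: "quad (\<lambda>x y. K x y + K' x y) c d = quad K c d + quad K' c d"
  by (simp add: quad_def lin_fun_add)

lemma quad_kernel_diff: "quad (\<lambda>x y. K x y - K' x y) c d = quad K c d - quad K' c d"
  by (simp add: quad_def lin_fun_diff)

lemma quad_kernel_scale: "quad (\<lambda>x y. t * K x y) c d = t * quad K c d"
  by (simp add: quad_def lin_fun_scale)

lemma quad_rank_one: "quad (\<lambda>x y. f x * g y) c d = lin f c * lin g d"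
proof -
  have "lin (\<lambda>x. f x * lin g d) c = lin (\<lambda>x. lin g d * f x) c" by (simp add: mult.commute)
  then show ?thesis unfolding quad_def lin_fun_scale by simp
qed

lemma psd_commute: "psd X K \<Longrightarrow> x \<in> X \<Longrightarrow> y \<in> X \<Longrightarrow> K x y = K y x"
  by (simp add: psd_def)

lemma psd_quad_nonneg: "psd X K \<Longrightarrow> c \<in> finsupp X \<Longrightarrow> 0 \<le> quad K c c"
  by (simp add: psd_def)

lemma psd_quad_commute:
  "psd X K \<Longrightarrow> c \<in> finsupp X \<Longrightarrow> d \<in> finsupp X \<Longrightarrow> quad K c d = quad K d c"
  by (rule quad_commute) (auto simp: psd_def)

lemma quad_Cauchy_Schwarz:
  assumes K: "psd X K" and c: "c \<in> finsupp X" and d: "d \<in> finsupp X"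
  shows "(quad K c d)\<^sup>2 \<le> quad K c c * quad K d d"
proof (rule quadratic_nonneg_imp_discriminant)
  fix t
  let ?e = "\<lambda>x. c x + t * d x"
  have e: "?e \<in> finsupp X" by (rule finsupp_axpy[OF c d])
  have "quad K ?e ?e = quad K ?e c + t * quad K ?e d"
    using quad_axpy[OF c d, of K t ?e] psd_quad_commute[OF K e c] psd_quad_commute[OF K e d] by simp
  also have "\<dots> = t\<^sup>2 * quad K d d + 2 * t * quad K c d + quad K c c"
    using quad_axpy[OF c d, of K t c] quad_axpy[OF c d, of K t d] psd_quad_commute[OF K c d]
    by (simp add: algebra_simps power2_eq_square)
  finally show "0 \<le> t\<^sup>2 * quad K d d + 2 * t * quad K c d + quad K c c"
    using psd_quad_nonneg[OF K e] by simp
qed (rule psd_quad_nonneg[OF K d])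

section \<open>Functions bounded by a kernel and their approximation by combinations of
  sections\<close>

definition kernel_bounded :: "'a set \<Rightarrow> ('a \<Rightarrow> 'a \<Rightarrow> real) \<Rightarrow> real \<Rightarrow> ('a \<Rightarrow> real) \<Rightarrow> bool" where
  "kernel_bounded X K M f \<longleftrightarrow> (\<forall>c\<in>finsupp X. (lin f c)\<^sup>2 \<le> M * quad K c c)"

text \<open>In the space of \<open>K\<close> this says that the combination of sections with
  coefficients \<open>c n\<close> is within \<open>1 / sqrt (n + 1)\<close> of \<open>f\<close>. It
  is phrased weakly, against all combinations \<open>d\<close>, so that it makes sense before the
  space has been constructed.\<close>

definition kernel_approx ::
    "'a set \<Rightarrow> ('a \<Rightarrow> 'a \<Rightarrow> real) \<Rightarrow> ('a \<Rightarrow> real) \<Rightarrow> (nat \<Rightarrow> 'a \<Rightarrow> real) \<Rightarrow> bool" where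
  "kernel_approx X K f c \<longleftrightarrow> (\<forall>n. c n \<in> finsupp X) \<and>
    (\<forall>n. \<forall>d\<in>finsupp X. (quad K (c n) d - lin f d)\<^sup>2 \<le> quad K d d / real (Suc n))"

lemma kernel_approx_exists:
  assumes K: "psd X K" and f: "kernel_bounded X K M f"
  shows "\<exists>c. kernel_approx X K f c"
proof -
  obtain c where "\<And>n. c n \<in> finsupp X"
    "\<And>n d. d \<in> finsupp X \<Longrightarrow> (quad K (c n) d - lin f d)\<^sup>2 \<le> quad K d d / real (Suc n)"
  proof (rule approximate_riesz[of "finsupp X" "\<lambda>c t d x. c x + t * d x" "quad K" "lin f" M])
    show "finsupp X \<noteq> {}" using zero_finsupp by blast
    show "(lin f c)\<^sup>2 \<le> M * quad K c c" if "c \<in> finsupp X" for c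
      using f that by (simp add: kernel_bounded_def)
  qed (use finsupp_axpy quad_axpy lin_axpy psd_quad_commute[OF K] psd_quad_nonneg[OF K] in auto)
  then show ?thesis unfolding kernel_approx_def by blast
qed

lemma kernel_approx_tendsto:
  assumes "kernel_approx X K f c" "d \<in> finsupp X"
  shows "(\<lambda>n. quad K (c n) d) \<longlonglongrightarrow> lin f d"
proof -
  have "(\<lambda>n. (quad K (c n) d - lin f d)\<^sup>2) \<longlonglongrightarrow> 0"
  proof (rule tendsto_sandwich[OF _ _ tendsto_const])
    show "\<forall>\<^sub>F n in sequentially. (quad K (c n) d - lin f d)\<^sup>2 \<le> quad K d d / real (Suc n)"
      using assms by (simp add: kernel_approx_def)
    show "(\<lambda>n. quad K d d / real (Suc n)) \<longlonglongrightarrow> 0"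
      by (rule LIMSEQ_Suc) (rule lim_const_over_n)
  qed simp
  then have "(\<lambda>n. quad K (c n) d - lin f d) \<longlonglongrightarrow> 0"
    by (simp add: power_tendsto_0_iff)
  then show ?thesis by (simp add: LIM_zero_iff)
qed

text \<open>Testing the approximation property on \<open>c n\<close> itself compares the squared
  norm with \<open>lin f (c n)\<close>, which the bound on \<open>f\<close> controls. The uniform
  bound is what allows the test element to vary with \<open>n\<close> in
  \<open>kernel_approx_swap\<close>.\<close>

lemma kernel_approx_bounded:
  assumes K: "psd X K" and f: "kernel_bounded X K M f" and c: "kernel_approx X K f c"
  shows "quad K (c n) (c n) \<le> 2 * (1 + \<bar>M\<bar>)"
proof -
  let ?q = "quad K (c n) (c n)" and ?l = "lin f (c n)"
  have cn: "c n \<in> finsupp X" using c by (simp add: kernel_approx_def)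
  have q: "0 \<le> ?q" by (rule psd_quad_nonneg[OF K cn])
  have "(?q - ?l)\<^sup>2 \<le> ?q / real (Suc n)" using c cn by (simp add: kernel_approx_def)
  also have "\<dots> \<le> ?q" using q by (simp add: field_simps)
  finally have 1: "(?q - ?l)\<^sup>2 \<le> ?q" .
  have "?l\<^sup>2 \<le> M * ?q" using f cn by (simp add: kernel_bounded_def)
  also have "\<dots> \<le> \<bar>M\<bar> * ?q" by (rule mult_right_mono) (use q in auto)
  finally have 2: "?l\<^sup>2 \<le> \<bar>M\<bar> * ?q" .
  \<comment> \<open>The parallelogram identity for the numbers \<open>?q - ?l\<close> and
    \<open>?l\<close>.\<close>
  have "?q\<^sup>2 + (?q - 2 * ?l)\<^sup>2 = 2 * (?q - ?l)\<^sup>2 + 2 * ?l\<^sup>2"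
    by (simp add: power2_eq_square algebra_simps)
  then have "?q\<^sup>2 \<le> 2 * (?q - ?l)\<^sup>2 + 2 * ?l\<^sup>2"
    using zero_le_power2[of "?q - 2 * ?l"] by linarith
  with 1 2 have "?q\<^sup>2 \<le> 2 * (1 + \<bar>M\<bar>) * ?q" by (simp add: algebra_simps)
  then show ?thesis using q by (cases "?q = 0") (auto simp: power2_eq_square)
qed

text \<open>Both approximants are tested against their own difference, where the two values of
  \<open>lin f\<close> cancel. What remains bounds the square of the squared distance by a multiple
  of the squared distance, and one factor is cancelled.\<close>

lemma kernel_approx_Cauchy:
  assumes K: "psd X K" and c: "kernel_approx X K f c"
  shows "quad K (\<lambda>x. c m x - c n x) (\<lambda>x. c m x - c n x) \<le> 2 / real (Suc m) + 2 / real (Suc n)"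
proof -
  let ?e = "\<lambda>x. c m x - c n x"
  have cm: "c m \<in> finsupp X" "c n \<in> finsupp X" using c by (auto simp: kernel_approx_def)
  have e: "?e \<in> finsupp X" using finsupp_axpy[OF cm, of "-1"] by simp
  have a: "(quad K (c m) ?e - lin f ?e)\<^sup>2 \<le> quad K ?e ?e / real (Suc m)"
    "(quad K (c n) ?e - lin f ?e)\<^sup>2 \<le> quad K ?e ?e / real (Suc n)"
    using c e by (auto simp: kernel_approx_def)
  have "quad K ?e ?e = (quad K (c m) ?e - lin f ?e) - (quad K (c n) ?e - lin f ?e)"
    using quad_diff[OF cm, of K ?e] by simp
  then have "(quad K ?e ?e)\<^sup>2 = ((quad K (c m) ?e - lin f ?e) - (quad K (c n) ?e - lin f ?e))\<^sup>2" by simp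
  also have "\<dots> \<le> 2 * (quad K (c m) ?e - lin f ?e)\<^sup>2 + 2 * (quad K (c n) ?e - lin f ?e)\<^sup>2"
    using zero_le_power2[of "(quad K (c m) ?e - lin f ?e) + (quad K (c n) ?e - lin f ?e)"]
    by (simp add: power2_eq_square algebra_simps)
  also have "\<dots> \<le> (2 / real (Suc m) + 2 / real (Suc n)) * quad K ?e ?e"
    using a by (simp add: algebra_simps)
  finally show ?thesis
    using psd_quad_nonneg[OF K e] by (cases "quad K ?e ?e = 0") (auto simp: power2_eq_square)
qed

lemma tendsto_two_inverse_Suc:
  assumes "e > 0"
  shows "\<exists>N. \<forall>m\<ge>N. \<forall>n\<ge>N. C * (2 / real (Suc m) + 2 / real (Suc n)) < e"
proof -
  have "(\<lambda>n. \<bar>C\<bar> * 2 / real (Suc n)) \<longlonglongrightarrow> 0"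
    by (rule LIMSEQ_Suc) (rule lim_const_over_n)
  then obtain N where N: "\<And>n. n \<ge> N \<Longrightarrow> \<bar>C\<bar> * 2 / real (Suc n) < e / 2"
    using assms order_tendstoD(2)[of "\<lambda>n. \<bar>C\<bar> * 2 / real (Suc n)" 0 sequentially "e / 2"]
    unfolding eventually_sequentially by auto
  have "C * (2 / real (Suc m) + 2 / real (Suc n)) < e" if "m \<ge> N" "n \<ge> N" for m n
  proof -
    have "C * (2 / real (Suc m) + 2 / real (Suc n)) \<le> \<bar>C\<bar> * (2 / real (Suc m) + 2 / real (Suc n))"
      by (rule mult_right_mono) auto
    with N[OF that(1)] N[OF that(2)] show ?thesis by (simp add: distrib_left)
  qed
  then show ?thesis by blast
qed

text \<open>The limit is going to be the inner product of \<open>f\<close> and \<open>g\<close>. A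
  bounded \<open>g\<close> maps the Cauchy sequence of approximants to a Cauchy sequence of
  numbers.\<close>

lemma kernel_approx_convergent:
  assumes K: "psd X K" and c: "kernel_approx X K f c" and g: "kernel_bounded X K M g"
  shows "convergent (\<lambda>n. lin g (c n))"
proof -
  have "Cauchy (\<lambda>n. lin g (c n))"
  proof (rule metric_CauchyI)
    fix e :: real assume e: "e > 0"
    obtain N where N: "\<And>m n. m \<ge> N \<Longrightarrow> n \<ge> N \<Longrightarrow> \<bar>M\<bar> * (2 / real (Suc m) + 2 / real (Suc n)) < e\<^sup>2"
      using tendsto_two_inverse_Suc[of "e\<^sup>2"] e by (metis zero_less_power)
    have "dist (lin g (c m)) (lin g (c n)) < e" if mn: "m \<ge> N" "n \<ge> N" for m n
    proof -
      let ?e = "\<lambda>x. c m x - c n x"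
      have cm: "c m \<in> finsupp X" "c n \<in> finsupp X" using c by (auto simp: kernel_approx_def)
      have fs: "?e \<in> finsupp X" using finsupp_axpy[OF cm, of "-1"] by simp
      have "(lin g (c m) - lin g (c n))\<^sup>2 \<le> M * quad K ?e ?e"
        using g fs lin_diff[OF cm, of g] by (auto simp: kernel_bounded_def)
      also have "\<dots> \<le> \<bar>M\<bar> * quad K ?e ?e"
        by (rule mult_right_mono) (auto simp: psd_quad_nonneg[OF K fs])
      also have "\<dots> \<le> \<bar>M\<bar> * (2 / real (Suc m) + 2 / real (Suc n))"
        by (rule mult_left_mono[OF kernel_approx_Cauchy[OF K c]]) simp
      also have "\<dots> < e\<^sup>2" by (rule N[OF mn])
      finally have "\<bar>lin g (c m) - lin g (c n)\<bar> < e"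
        using e by (simp add: abs_le_square_iff power2_less_imp_less)
      then show ?thesis by (simp add: dist_real_def)
    qed
    then show "\<exists>N. \<forall>m\<ge>N. \<forall>n\<ge>N. dist (lin g (c m)) (lin g (c n)) < e" by blast
  qed
  then show ?thesis by (simp add: Cauchy_convergent_iff)
qed

text \<open>The test element \<open>c n\<close> changes with \<open>n\<close>, but its squared norm
  stays bounded, so the error still tends to zero. Thus \<open>lin g (c n)\<close> may be exchanged
  for \<open>quad K (d n) (c n)\<close>, whose symmetry makes the inner product symmetric.\<close>

lemma kernel_approx_swap:
  assumes K: "psd X K" and f: "kernel_bounded X K M f" and c: "kernel_approx X K f c"
    and d: "kernel_approx X K g d"
  shows "(\<lambda>n. quad K (d n) (c n) - lin g (c n)) \<longlonglongrightarrow> 0"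
proof -
  have "(\<lambda>n. (quad K (d n) (c n) - lin g (c n))\<^sup>2) \<longlonglongrightarrow> 0"
  proof (rule tendsto_sandwich[OF _ _ tendsto_const])
    have "(quad K (d n) (c n) - lin g (c n))\<^sup>2 \<le> 2 * (1 + \<bar>M\<bar>) / real (Suc n)" for n
    proof -
      have "(quad K (d n) (c n) - lin g (c n))\<^sup>2 \<le> quad K (c n) (c n) / real (Suc n)"
        using c d by (simp add: kernel_approx_def)
      also have "\<dots> \<le> 2 * (1 + \<bar>M\<bar>) / real (Suc n)"
        by (rule divide_right_mono[OF kernel_approx_bounded[OF K f c]]) simp
      finally show ?thesis .
    qed
    then show "\<forall>\<^sub>F n in sequentially. (quad K (d n) (c n) - lin g (c n))\<^sup>2 \<le> 2 * (1 + \<bar>M\<bar>) / real (Suc n)"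
      by simp
    show "(\<lambda>n. 2 * (1 + \<bar>M\<bar>) / real (Suc n)) \<longlonglongrightarrow> 0"
      by (rule LIMSEQ_Suc) (rule lim_const_over_n)
  qed simp
  then show ?thesis by (simp add: power_tendsto_0_iff)
qed


text \<open>The carrier consists of functions from the start, so no abstract completion has to be
  realised pointwise. The inner product is read off along a chosen approximating sequence of the
  first argument.\<close>

definition moore_aronszajn :: "'a set \<Rightarrow> ('a \<Rightarrow> 'a \<Rightarrow> real) \<Rightarrow> 'a fspace" where
  "moore_aronszajn X K =
    (let C = {f \<in> extensional X. \<exists>M. kernel_bounded X K M f} in
     (C, \<lambda>f g. if f \<in> C \<and> g \<in> C then lim (\<lambda>n. lin g ((SOME c. kernel_approx X K f c) n)) else 0))"

context
  fixes X :: "'a set" and K :: "'a \<Rightarrow> 'a \<Rightarrow> real"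
  assumes K: "psd X K"
begin

private abbreviation "H \<equiv> moore_aronszajn X K"
private definition "rep f = (SOME c. kernel_approx X K f c)"

private lemma H_iff: "f \<in> fst H \<longleftrightarrow> f \<in> extensional X \<and> (\<exists>M. kernel_bounded X K M f)"
  by (simp add: moore_aronszajn_def Let_def)

private lemma rep: "f \<in> fst H \<Longrightarrow> kernel_approx X K f (rep f)"
  unfolding rep_def using kernel_approx_exists[OF K] someI_ex H_iff by metis

private lemma rep_finsupp: "f \<in> fst H \<Longrightarrow> rep f n \<in> finsupp X"
  using rep by (simp add: kernel_approx_def)

private lemma inner_tendsto:
  assumes "f \<in> fst H" "g \<in> fst H"
  shows "(\<lambda>n. lin g (rep f n)) \<longlonglongrightarrow> snd H f g"
proof -
  have "convergent (\<lambda>n. lin g (rep f n))"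
    using kernel_approx_convergent[OF K rep[OF assms(1)]] assms(2) H_iff by blast
  moreover have "snd H f g = lim (\<lambda>n. lin g (rep f n))"
    using assms by (auto simp: moore_aronszajn_def Let_def rep_def)
  ultimately show ?thesis by (simp add: convergent_LIMSEQ_iff)
qed

private lemma inner_tendsto_quad:
  assumes "f \<in> fst H" "g \<in> fst H"
  shows "(\<lambda>n. quad K (rep g n) (rep f n)) \<longlonglongrightarrow> snd H f g"
proof -
  obtain M where M: "kernel_bounded X K M f" using assms H_iff by blast
  show ?thesis
    using tendsto_add[OF kernel_approx_swap[OF K M rep[OF assms(1)] rep[OF assms(2)]]
        inner_tendsto[OF assms]] by simp
qed

private lemma inner_sym:
  assumes "f \<in> fst H" "g \<in> fst H"
  shows "snd H f g = snd H g f"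
proof (rule LIMSEQ_unique[OF inner_tendsto_quad[OF assms]])
  show "(\<lambda>n. quad K (rep g n) (rep f n)) \<longlonglongrightarrow> snd H g f"
    using inner_tendsto_quad[OF assms(2,1)] psd_quad_commute[OF K rep_finsupp[OF assms(1)] rep_finsupp[OF assms(2)]]
    by simp
qed

text \<open>Cauchy-Schwarz for the approximants passes to the limit, so the squared norm is itself
  an admissible bound for the evaluations of \<open>f\<close>.\<close>

private lemma lin_le_inner:
  assumes f: "f \<in> fst H" and d: "d \<in> finsupp X"
  shows "(lin f d)\<^sup>2 \<le> snd H f f * quad K d d"
proof (rule LIMSEQ_le)
  show "(\<lambda>n. (quad K (rep f n) d)\<^sup>2) \<longlonglongrightarrow> (lin f d)\<^sup>2"
    by (intro tendsto_power kernel_approx_tendsto[OF rep[OF f] d])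
  show "(\<lambda>n. quad K (rep f n) (rep f n) * quad K d d) \<longlonglongrightarrow> snd H f f * quad K d d"
    by (intro tendsto_mult tendsto_const inner_tendsto_quad f)
  show "\<exists>N. \<forall>n\<ge>N. (quad K (rep f n) d)\<^sup>2 \<le> quad K (rep f n) (rep f n) * quad K d d"
    using quad_Cauchy_Schwarz[OF K rep_finsupp[OF f] d] by blast
qed

private lemma inner_pos: "f \<in> fst H \<Longrightarrow> 0 \<le> snd H f f"
  by (rule LIMSEQ_le_const[OF inner_tendsto_quad]) (auto intro: psd_quad_nonneg[OF K] rep_finsupp)

text \<open>Tested on the approximants of \<open>f\<close>, the bound becomes in the limit an
  inequality between the square of \<open>snd H f f\<close> and \<open>M * snd H f f\<close>, from
  which one factor cancels.\<close>

private lemma inner_le: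
  assumes f: "f \<in> fst H" and M: "kernel_bounded X K M f" and M0: "0 \<le> M"
  shows "snd H f f \<le> M"
proof -
  have "(snd H f f)\<^sup>2 \<le> M * snd H f f"
  proof (rule LIMSEQ_le)
    show "(\<lambda>n. (lin f (rep f n))\<^sup>2) \<longlonglongrightarrow> (snd H f f)\<^sup>2"
      by (intro tendsto_power inner_tendsto f)
    show "(\<lambda>n. M * quad K (rep f n) (rep f n)) \<longlonglongrightarrow> M * snd H f f"
      by (intro tendsto_mult tendsto_const inner_tendsto_quad f)
    show "\<exists>N. \<forall>n\<ge>N. (lin f (rep f n))\<^sup>2 \<le> M * quad K (rep f n) (rep f n)"
      using M rep_finsupp[OF f] by (auto simp: kernel_bounded_def)
  qed
  then show ?thesis
    using inner_pos[OF f] M0 by (cases "snd H f f = 0") (auto simp: power2_eq_square)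
qed

private lemma bounded_restrict: "kernel_bounded X K M f \<Longrightarrow> (\<lambda>x\<in>X. f x) \<in> fst H"
  unfolding H_iff kernel_bounded_def by (auto simp: lin_restrict)

private lemma H_axpy_mem:
  assumes "f \<in> fst H" "g \<in> fst H"
  shows "(\<lambda>x\<in>X. f x + t * g x) \<in> fst H"
proof -
  have "kernel_bounded X K (2 * snd H f f + 2 * t\<^sup>2 * snd H g g) (\<lambda>x. f x + t * g x)"
    unfolding kernel_bounded_def
  proof
    fix c assume c: "c \<in> finsupp X"
    have "(lin (\<lambda>x. f x + t * g x) c)\<^sup>2 = (lin f c + t * lin g c)\<^sup>2"
      by (simp add: lin_fun_add lin_fun_scale)
    also have "\<dots> \<le> 2 * (lin f c)\<^sup>2 + 2 * t\<^sup>2 * (lin g c)\<^sup>2"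
      using zero_le_power2[of "lin f c - t * lin g c"] by (simp add: power2_eq_square algebra_simps)
    also have "\<dots> \<le> 2 * (snd H f f * quad K c c) + 2 * t\<^sup>2 * (snd H g g * quad K c c)"
      by (intro add_mono mult_left_mono lin_le_inner assms c) auto
    finally show "(lin (\<lambda>x. f x + t * g x) c)\<^sup>2 \<le> (2 * snd H f f + 2 * t\<^sup>2 * snd H g g) * quad K c c"
      by (simp add: algebra_simps)
  qed
  then show ?thesis by (rule bounded_restrict)
qed

private lemma H_zero_mem: "(\<lambda>x\<in>X. 0) \<in> fst H"
  by (rule bounded_restrict[of 0]) (simp add: kernel_bounded_def lin_def)

private lemma H_inner_axpy:
  assumes "f \<in> fst H" "g \<in> fst H" "h \<in> fst H"
  shows "snd H (\<lambda>x\<in>X. f x + t * g x) h = snd H f h + t * snd H g h"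
proof -
  have "(\<lambda>n. lin (\<lambda>x\<in>X. f x + t * g x) (rep h n)) \<longlonglongrightarrow> snd H h (\<lambda>x\<in>X. f x + t * g x)"
    by (intro inner_tendsto H_axpy_mem assms)
  moreover have "(\<lambda>n. lin f (rep h n) + t * lin g (rep h n)) \<longlonglongrightarrow> snd H h f + t * snd H h g"
    by (intro tendsto_add tendsto_mult tendsto_const inner_tendsto assms)
  moreover have "lin (\<lambda>x\<in>X. f x + t * g x) (rep h n) = lin f (rep h n) + t * lin g (rep h n)" for n
    unfolding lin_restrict[OF rep_finsupp[OF assms(3)]] lin_fun_add lin_fun_scale ..
  ultimately have "snd H h (\<lambda>x\<in>X. f x + t * g x) = snd H h f + t * snd H h g"
    using LIMSEQ_unique by (simp only:)
  then show ?thesis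
    using inner_sym[OF assms(3,1)] inner_sym[OF assms(3,2)]
      inner_sym[OF assms(3) H_axpy_mem[OF assms(1,2), of t]] by (simp only:)
qed

private lemma H_pre: "pre_hilbert_function_space X H"
proof
  show "fst H \<subseteq> extensional X" using H_iff by blast
  show z: "(\<lambda>x\<in>X. 0) \<in> fst H" by (rule H_zero_mem)
  fix f g h :: "'a \<Rightarrow> real" and c :: real
  show outside: "snd H f g = 0" if "f \<notin> fst H" for f g
    using that by (auto simp: moore_aronszajn_def Let_def)
  have outside': "snd H f g = 0" if "g \<notin> fst H" for f g
    using that by (auto simp: moore_aronszajn_def Let_def)
  show "snd H f g = snd H g f"
  proof (cases "f \<in> fst H \<and> g \<in> fst H")
    case True
    then show ?thesis using inner_sym by blast
  next
    case False
    then show ?thesis by (metis outside outside')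
  qed
  show "f \<in> fst H \<Longrightarrow> g \<in> fst H \<Longrightarrow> (\<lambda>x\<in>X. f x + g x) \<in> fst H"
    using H_axpy_mem[of f g 1] by simp
  have eq: "(\<lambda>x\<in>X. (\<lambda>x\<in>X. 0) x + c * f x) = (\<lambda>x\<in>X. c * f x)" by auto
  show "f \<in> fst H \<Longrightarrow> (\<lambda>x\<in>X. c * f x) \<in> fst H"
    using H_axpy_mem[OF z, of f c] unfolding eq .
  show "f \<in> fst H \<Longrightarrow> g \<in> fst H \<Longrightarrow> h \<in> fst H \<Longrightarrow>
      snd H (\<lambda>x\<in>X. f x + g x) h = snd H f h + snd H g h"
    using H_inner_axpy[of f g h 1] by simp
  have zero: "snd H (\<lambda>x\<in>X. 0) h = 0" if h: "h \<in> fst H"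
    using H_inner_axpy[OF h h h, of "-1"] by simp
  show "f \<in> fst H \<Longrightarrow> h \<in> fst H \<Longrightarrow> snd H (\<lambda>x\<in>X. c * f x) h = c * snd H f h"
    using H_inner_axpy[OF z, of f h c] zero unfolding eq by simp
  show "f \<in> fst H \<Longrightarrow> 0 \<le> snd H f f" by (rule inner_pos)
  show "f = (\<lambda>x\<in>X. 0)" if f: "f \<in> fst H" and 0: "snd H f f = 0"
  proof
    fix x
    show "f x = (\<lambda>x\<in>X. 0) x"
      using lin_le_inner[OF f delta_finsupp[of x X]] 0 f
      by (cases "x \<in> X") (auto simp: lin_delta H_iff extensional_def)
  qed
qed

interpretation pre_hilbert_function_space X H by (rule H_pre)

text \<open>A norm-Cauchy sequence converges pointwise because evaluations are bounded. For fixed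
  \<open>m\<close> the evaluation bounds of \<open>s m - s n\<close> survive the limit in
  \<open>n\<close>, so \<open>s m - g\<close> is a member of small norm.\<close>

private lemma H_complete: sequentially_complete
  unfolding sequentially_complete_def
proof (intro allI impI)
  fix s :: "nat \<Rightarrow> 'a \<Rightarrow> real"
  assume s: "\<forall>n. s n \<in> fst H"
    and Cauchy: "\<forall>e>0. \<exists>N. \<forall>m\<ge>N. \<forall>n\<ge>N. fspace_norm H (\<lambda>x\<in>X. s m x - s n x) < e"
  have diff: "(\<lambda>x\<in>X. s m x - s n x) \<in> fst H" for m n using s diff_mem by blast
  have lin_bound: "\<bar>lin (s m) c - lin (s n) c\<bar> \<le> fspace_norm H (\<lambda>x\<in>X. s m x - s n x) * sqrt (quad K c c)"
    if c: "c \<in> finsupp X" for c m n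
    using real_sqrt_le_mono[OF lin_le_inner[OF diff c, of m n]]
    by (simp add: lin_restrict[OF c] lin_fun_diff fspace_norm_def real_sqrt_mult)
  have conv: "convergent (\<lambda>n. lin (s n) c)" if c: "c \<in> finsupp X" for c
  proof -
    have "Cauchy (\<lambda>n. lin (s n) c)"
    proof (rule metric_CauchyI)
      fix e :: real assume e: "e > 0"
      define q where "q = sqrt (quad K c c)"
      have q: "q \<ge> 0" by (simp add: q_def psd_quad_nonneg[OF K c])
      \<comment> \<open>\<open>q\<close> may vanish, hence the division by
        \<open>q + 1\<close>.\<close>
      obtain N where N: "\<And>m n. m \<ge> N \<Longrightarrow> n \<ge> N \<Longrightarrow> fspace_norm H (\<lambda>x\<in>X. s m x - s n x) < e / (q + 1)"
        using Cauchy e q by (metis add_nonneg_pos divide_pos_pos zero_less_one)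
      have "dist (lin (s m) c) (lin (s n) c) < e" if "m \<ge> N" "n \<ge> N" for m n
      proof -
        have "dist (lin (s m) c) (lin (s n) c) \<le> fspace_norm H (\<lambda>x\<in>X. s m x - s n x) * q"
          using lin_bound[OF c] by (simp add: q_def dist_real_def)
        also have "\<dots> \<le> e / (q + 1) * q"
          by (rule mult_right_mono) (use N[OF that] q in auto)
        also have "\<dots> < e" using q e by (simp add: field_simps)
        finally show ?thesis .
      qed
      then show "\<exists>N. \<forall>m\<ge>N. \<forall>n\<ge>N. dist (lin (s m) c) (lin (s n) c) < e" by blast
    qed
    then show ?thesis by (simp add: Cauchy_convergent_iff)
  qed
  define g where "g = (\<lambda>x\<in>X. lim (\<lambda>n. s n x))"
  have s_lim: "(\<lambda>n. s n x) \<longlonglongrightarrow> g x" if "x \<in> X" for x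
    using conv[OF delta_finsupp[OF that]] that by (simp add: g_def lin_delta convergent_LIMSEQ_iff)
  have lin_lim: "(\<lambda>n. lin (s n) c) \<longlonglongrightarrow> lin g c" if "c \<in> finsupp X" for c
    unfolding lin_def using that by (intro tendsto_sum tendsto_mult tendsto_const s_lim) (auto simp: finsupp_def)
  have bound: "kernel_bounded X K (e\<^sup>2) (\<lambda>x\<in>X. s m x - g x)"
    if "\<And>n. n \<ge> N \<Longrightarrow> fspace_norm H (\<lambda>x\<in>X. s m x - s n x) < e" for m N e
    unfolding kernel_bounded_def
  proof
    fix c assume c: "c \<in> finsupp X"
    have "(\<lambda>n. \<bar>lin (s m) c - lin (s n) c\<bar>) \<longlonglongrightarrow> \<bar>lin (s m) c - lin g c\<bar>"
      by (intro tendsto_intros lin_lim c)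
    then have "\<bar>lin (s m) c - lin g c\<bar> \<le> e * sqrt (quad K c c)"
    proof (rule LIMSEQ_le_const2)
      show "\<exists>N. \<forall>n\<ge>N. \<bar>lin (s m) c - lin (s n) c\<bar> \<le> e * sqrt (quad K c c)"
      proof (intro exI allI impI)
        fix n assume n: "n \<ge> N"
        have "\<bar>lin (s m) c - lin (s n) c\<bar> \<le> fspace_norm H (\<lambda>x\<in>X. s m x - s n x) * sqrt (quad K c c)"
          by (rule lin_bound[OF c])
        also have "\<dots> \<le> e * sqrt (quad K c c)"
          by (rule mult_right_mono) (use that[OF n] psd_quad_nonneg[OF K c] in auto)
        finally show "\<bar>lin (s m) c - lin (s n) c\<bar> \<le> e * sqrt (quad K c c)" .
      qed
    qed
    from power_mono[OF this, of 2]
    show "(lin (\<lambda>x\<in>X. s m x - g x) c)\<^sup>2 \<le> e\<^sup>2 * quad K c c"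
      by (simp add: lin_restrict[OF c] lin_fun_diff power_mult_distrib psd_quad_nonneg[OF K c])
  qed
  have mem: "(\<lambda>x\<in>X. s m x - g x) \<in> fst H" and small: "fspace_norm H (\<lambda>x\<in>X. s m x - g x) \<le> e"
    if "\<And>n. n \<ge> N \<Longrightarrow> fspace_norm H (\<lambda>x\<in>X. s m x - s n x) < e" "e > 0" for m N e
  proof -
    show m: "(\<lambda>x\<in>X. s m x - g x) \<in> fst H"
      unfolding H_iff using bound[OF that(1)] by blast
    show "fspace_norm H (\<lambda>x\<in>X. s m x - g x) \<le> e"
      unfolding fspace_norm_def
      by (rule real_le_lsqrt) (use inner_le[OF m bound[OF that(1)]] that(2) in auto)
  qed
  obtain N1 where N1: "\<And>m n. m \<ge> N1 \<Longrightarrow> n \<ge> N1 \<Longrightarrow> fspace_norm H (\<lambda>x\<in>X. s m x - s n x) < 1"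
    using Cauchy zero_less_one by blast
  have g: "g \<in> fst H"
  proof -
    \<comment> \<open>Only differences \<open>s m - g\<close> are known to be members;
      \<open>g\<close> itself is recovered by subtracting one of them from
      \<open>s N1\<close>.\<close>
    have "(\<lambda>x\<in>X. s N1 x - (\<lambda>x\<in>X. s N1 x - g x) x) \<in> fst H"
      by (intro diff_mem mem[of N1 N1 1]) (use s N1 in auto)
    moreover have "(\<lambda>x\<in>X. s N1 x - (\<lambda>x\<in>X. s N1 x - g x) x) = g"
      by (auto simp: g_def)
    ultimately show ?thesis by (simp only:)
  qed
  moreover have "(\<lambda>n. fspace_norm H (\<lambda>x\<in>X. s n x - g x)) \<longlonglongrightarrow> 0"
  proof (rule LIMSEQ_I)
    fix e :: real assume e: "e > 0"
    then have "e / 2 > 0" by simp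
    then obtain N where N: "\<And>m n. m \<ge> N \<Longrightarrow> n \<ge> N \<Longrightarrow> fspace_norm H (\<lambda>x\<in>X. s m x - s n x) < e / 2"
      using Cauchy by meson
    have "norm (fspace_norm H (\<lambda>x\<in>X. s n x - g x) - 0) < e" if n: "n \<ge> N" for n
    proof -
      have "fspace_norm H (\<lambda>x\<in>X. s n x - g x) \<le> e / 2"
        by (rule small[of N]) (use N n e in auto)
      moreover have "0 \<le> fspace_norm H (\<lambda>x\<in>X. s n x - g x)"
        by (simp add: fspace_norm_def inner_self_nonneg)
      ultimately show ?thesis using e by simp
    qed
    then show "\<exists>no. \<forall>n\<ge>no. norm (fspace_norm H (\<lambda>x\<in>X. s n x - g x) - 0) < e" by blast
  qed
  ultimately show "\<exists>g\<in>fst H. (\<lambda>n. fspace_norm H (\<lambda>x\<in>X. s n x - g x)) \<longlonglongrightarrow> 0" by blast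
qed

theorem moore_aronszajn_rkhs: "rkhs X H K"
proof -
  interpret hilbert_function_space X H using hilbert_function_space_iff H_complete by blast
  show ?thesis
  proof
    fix y assume y: "y \<in> X"
    show m: "(\<lambda>x\<in>X. K x y) \<in> fst H"
    proof (rule bounded_restrict)
      show "kernel_bounded X K (K y y) (\<lambda>x. K x y)"
        unfolding kernel_bounded_def
        using quad_Cauchy_Schwarz[OF K _ delta_finsupp[OF y]]
        by (auto simp: quad_delta lin_delta mult.commute)
    qed
    fix f assume f: "f \<in> fst H"
    have "(\<lambda>n. lin (\<lambda>x. K x y) (rep f n)) \<longlonglongrightarrow> f y"
      using kernel_approx_tendsto[OF rep[OF f] delta_finsupp[OF y]] by (simp add: quad_delta lin_delta)
    moreover have "(\<lambda>n. lin (\<lambda>x\<in>X. K x y) (rep f n)) \<longlonglongrightarrow> snd H f (\<lambda>x\<in>X. K x y)"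
      by (rule inner_tendsto[OF f m])
    ultimately show "snd H f (\<lambda>x\<in>X. K x y) = f y"
      unfolding lin_restrict[OF rep_finsupp[OF f]] by (rule LIMSEQ_unique[rotated])
  qed
qed

end

section \<open>Membership and norm in an arbitrary space with a reproducing kernel\<close>

context pre_hilbert_function_space
begin

lemma inner_tendsto:
  assumes s: "\<And>n. s n \<in> fst S" and g: "g \<in> fst S" and h: "h \<in> fst S"
    and lim: "(\<lambda>n. fspace_norm S (\<lambda>x\<in>X. s n x - g x)) \<longlonglongrightarrow> 0"
  shows "(\<lambda>n. snd S h (s n)) \<longlonglongrightarrow> snd S h g"
proof -
  have "(\<lambda>n. snd S h (s n) - snd S h g) \<longlonglongrightarrow> 0"
  proof (rule Lim_null_comparison)
    show "(\<lambda>n. fspace_norm S h * fspace_norm S (\<lambda>x\<in>X. s n x - g x)) \<longlonglongrightarrow> 0"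
      using tendsto_mult[OF tendsto_const[of "fspace_norm S h"] lim] by simp
    show "\<forall>\<^sub>F n in sequentially. norm (snd S h (s n) - snd S h g)
        \<le> fspace_norm S h * fspace_norm S (\<lambda>x\<in>X. s n x - g x)"
    proof (rule always_eventually, rule allI)
      fix n
      show "norm (snd S h (s n) - snd S h g) \<le> fspace_norm S h * fspace_norm S (\<lambda>x\<in>X. s n x - g x)"
        using Cauchy_Schwarz_norm[OF h diff_mem[OF s g], of n] inner_diff_right[OF s g h, of n] by simp
    qed
  qed
  then show ?thesis by (simp add: LIM_zero_iff)
qed

lemma inner_self_tendsto:
  assumes s: "\<And>n. s n \<in> fst S" and g: "g \<in> fst S"
    and lim: "(\<lambda>n. fspace_norm S (\<lambda>x\<in>X. s n x - g x)) \<longlonglongrightarrow> 0"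
  shows "(\<lambda>n. snd S (s n) (s n)) \<longlonglongrightarrow> snd S g g"
proof -
  have "(\<lambda>n. (fspace_norm S (\<lambda>x\<in>X. s n x - g x))\<^sup>2 + 2 * snd S g (s n) - snd S g g)
      \<longlonglongrightarrow> 0\<^sup>2 + 2 * snd S g g - snd S g g"
    by (intro tendsto_intros lim inner_tendsto[OF s g g lim])
  moreover have "(fspace_norm S (\<lambda>x\<in>X. s n x - g x))\<^sup>2 + 2 * snd S g (s n) - snd S g g = snd S (s n) (s n)" for n
    using inner_diff_self[OF s g, of n] inner_self_nonneg[of "\<lambda>x\<in>X. s n x - g x"] inner_commute[of g "s n"]
    by (simp add: fspace_norm_def)
  ultimately show ?thesis by simp
qed

end

lemma (in hilbert_function_space) complete_sequence:
  assumes "\<And>n. s n \<in> fst S"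
    and "\<And>m n. snd S (\<lambda>x\<in>X. s m x - s n x) (\<lambda>x\<in>X. s m x - s n x) \<le> 2 / real (Suc m) + 2 / real (Suc n)"
  obtains g where "g \<in> fst S" "(\<lambda>n. fspace_norm S (\<lambda>x\<in>X. s n x - g x)) \<longlonglongrightarrow> 0"
proof -
  have "\<exists>N. \<forall>m\<ge>N. \<forall>n\<ge>N. fspace_norm S (\<lambda>x\<in>X. s m x - s n x) < e" if e: "e > 0" for e
  proof -
    obtain N where N: "\<And>m n. m \<ge> N \<Longrightarrow> n \<ge> N \<Longrightarrow> 1 * (2 / real (Suc m) + 2 / real (Suc n)) < e\<^sup>2"
      using tendsto_two_inverse_Suc[of "e\<^sup>2" 1] e by (metis zero_less_power)
    have "fspace_norm S (\<lambda>x\<in>X. s m x - s n x) < e" if "m \<ge> N" "n \<ge> N" for m n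
      unfolding fspace_norm_def by (rule real_less_lsqrt) (use assms(2)[of m n] N[OF that] e in auto)
    then show ?thesis by blast
  qed
  then have "\<exists>g\<in>fst S. (\<lambda>n. fspace_norm S (\<lambda>x\<in>X. s n x - g x)) \<longlonglongrightarrow> 0"
    using sequentially_complete[unfolded sequentially_complete_def, rule_format, of s] assms(1) by simp
  with that show ?thesis by (elim bexE)
qed

context rkhs
begin

lemma section_lincomb:
  assumes c: "c \<in> finsupp X"
  shows "(\<lambda>x\<in>X. lin (K x) c) \<in> fst S"
    and "f \<in> fst S \<Longrightarrow> snd S f (\<lambda>x\<in>X. lin (K x) c) = lin f c"
proof -
  let ?I = "{x. c x \<noteq> 0}"
  have I: "finite ?I" "?I \<subseteq> X" using c by (auto simp: finsupp_def)
  have eq: "(\<lambda>x\<in>X. lin (K x) c) = (\<lambda>x\<in>X. \<Sum>y\<in>?I. c y * (\<lambda>x\<in>X. K x y) x)"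
    by (auto simp: lin_def)
  show "(\<lambda>x\<in>X. lin (K x) c) \<in> fst S"
    unfolding eq by (rule lincomb_mem[OF I(1)]) (rule section_mem, use I in blast)
  assume f: "f \<in> fst S"
  have "snd S f (\<lambda>x\<in>X. lin (K x) c) = (\<Sum>y\<in>?I. c y * snd S f (\<lambda>x\<in>X. K x y))"
    unfolding eq by (rule inner_lincomb[OF I(1) _ f]) (rule section_mem, use I in blast)
  also have "\<dots> = lin f c"
    unfolding lin_def by (rule sum.cong) (use I reproducing[OF f] in auto)
  finally show "snd S f (\<lambda>x\<in>X. lin (K x) c) = lin f c" .
qed

lemma inner_section_lincomb:
  assumes c: "c \<in> finsupp X" and d: "d \<in> finsupp X"
  shows "snd S (\<lambda>x\<in>X. lin (K x) d) (\<lambda>x\<in>X. lin (K x) c) = quad K c d"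
  using section_lincomb(2)[OF c section_lincomb(1)[OF d]] lin_restrict[OF c] by (simp add: quad_def)

lemma kernel_commute: "x \<in> X \<Longrightarrow> y \<in> X \<Longrightarrow> K x y = K y x"
  using reproducing[OF section_mem[of y], of x] reproducing[OF section_mem[of x], of y]
    inner_commute[of "\<lambda>z\<in>X. K z x" "\<lambda>z\<in>X. K z y"] by simp

lemma psd: "psd X K"
  unfolding psd_def
proof (intro conjI ballI)
  fix c assume c: "c \<in> finsupp X"
  show "0 \<le> quad K c c" unfolding inner_section_lincomb[OF c c, symmetric] by (rule inner_self_nonneg)
qed (rule kernel_commute)

lemma kernel_bounded:
  assumes f: "f \<in> fst S"
  shows "kernel_bounded X K (snd S f f) f"
  unfolding kernel_bounded_def
proof
  fix c assume c: "c \<in> finsupp X"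
  show "(lin f c)\<^sup>2 \<le> snd S f f * quad K c c"
    using Cauchy_Schwarz[OF f section_lincomb(1)[OF c]] section_lincomb(2)[OF c f]
      inner_section_lincomb[OF c c] by simp
qed

lemma evaluation_bound:
  assumes "f \<in> fst S" "x \<in> X"
  shows "(f x)\<^sup>2 \<le> snd S f f * K x x"
  using kernel_bounded[OF assms(1)] delta_finsupp[OF assms(2)]
  by (force simp: kernel_bounded_def quad_delta lin_delta)

text \<open>The converse of \<open>kernel_bounded\<close>, on which uniqueness and embeddings rest.
  The combinations of sections that approximate \<open>f\<close> weakly form a Cauchy sequence in
  \<open>S\<close>; by completeness it has a limit, and reproduction shows that the values of the
  limit are those of \<open>f\<close>.\<close>

lemma mem_if_kernel_bounded:
  assumes ext: "f \<in> extensional X" and f: "kernel_bounded X K M f" and M: "0 \<le> M"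
  shows "f \<in> fst S" and "snd S f f \<le> M"
proof -
  obtain c where c: "kernel_approx X K f c" using kernel_approx_exists[OF psd f] by blast
  have fs: "c n \<in> finsupp X" for n using c by (simp add: kernel_approx_def)
  define s where "s n = (\<lambda>x\<in>X. lin (K x) (c n))" for n
  have s: "s n \<in> fst S" for n unfolding s_def by (rule section_lincomb(1)[OF fs])
  have "snd S (\<lambda>x\<in>X. s m x - s n x) (\<lambda>x\<in>X. s m x - s n x) \<le> 2 / real (Suc m) + 2 / real (Suc n)" for m n
  proof -
    let ?e = "\<lambda>x. c m x - c n x"
    have e: "?e \<in> finsupp X" using finsupp_axpy[OF fs fs, of m "-1" n] by simp
    have "(\<lambda>x\<in>X. s m x - s n x) = (\<lambda>x\<in>X. lin (K x) ?e)"
      by (auto simp: s_def lin_diff[OF fs fs])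
    then show ?thesis using inner_section_lincomb[OF e e] kernel_approx_Cauchy[OF psd c, of m n] by simp
  qed
  then obtain g where g: "g \<in> fst S" and lim: "(\<lambda>n. fspace_norm S (\<lambda>x\<in>X. s n x - g x)) \<longlonglongrightarrow> 0"
    using complete_sequence[of s] s by blast
  have "f x = g x" if x: "x \<in> X" for x
  proof (rule LIMSEQ_unique)
    have "(\<lambda>n. quad K (c n) (\<lambda>z. of_bool (z = x))) \<longlonglongrightarrow> f x"
      using kernel_approx_tendsto[OF c delta_finsupp[OF x]] by (simp add: lin_delta)
    moreover have "quad K (c n) (\<lambda>z. of_bool (z = x)) = s n x" for n
      unfolding quad_delta s_def using x kernel_commute by (auto intro!: lin_cong[OF fs])
    ultimately show "(\<lambda>n. s n x) \<longlonglongrightarrow> f x" by simp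
    have "(\<lambda>n. snd S (\<lambda>z\<in>X. K z x) (s n)) \<longlonglongrightarrow> snd S (\<lambda>z\<in>X. K z x) g"
      by (rule inner_tendsto[OF s g section_mem[OF x] lim])
    then show "(\<lambda>n. s n x) \<longlonglongrightarrow> g x"
      using reproducing[OF s x] reproducing[OF g x] by (simp add: inner_commute)
  qed
  then have fg: "f = g" using ext g extensional by (meson extensionalityI subsetD)
  then show "f \<in> fst S" using g by simp
  \<comment> \<open>For the coefficients \<open>c n\<close> the bound compares the inner product of
    \<open>g\<close> with \<open>s n\<close> to the squared norm of \<open>s n\<close>; both
    converge to \<open>snd S g g\<close>.\<close>
  have "(snd S g g)\<^sup>2 \<le> M * snd S g g"
  proof (rule LIMSEQ_le)
    show "(\<lambda>n. (snd S g (s n))\<^sup>2) \<longlonglongrightarrow> (snd S g g)\<^sup>2"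
      by (intro tendsto_power inner_tendsto[OF s g g lim])
    show "(\<lambda>n. M * snd S (s n) (s n)) \<longlonglongrightarrow> M * snd S g g"
      by (intro tendsto_mult tendsto_const inner_self_tendsto[OF s g lim])
    show "\<exists>N. \<forall>n\<ge>N. (snd S g (s n))\<^sup>2 \<le> M * snd S (s n) (s n)"
      using f fs fg section_lincomb(2)[OF fs g] inner_section_lincomb[OF fs fs]
      by (auto simp: kernel_bounded_def s_def)
  qed
  then show "snd S f f \<le> M"
    unfolding fg using inner_nonneg[OF g] M by (cases "snd S g g = 0") (auto simp: power2_eq_square)
qed

end

section \<open>Uniqueness, embeddings and kernels of closed subspaces\<close>

lemma rkhs_unique:
  assumes "rkhs X S K" "rkhs X T K"
  shows "S = T"
proof -
  interpret S: rkhs X S K by fact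
  interpret T: rkhs X T K by fact
  \<comment> \<open>Membership and norm bounds transfer through \<open>kernel_bounded\<close>, which
    mentions the kernel but not the space.\<close>
  have le: "f \<in> fst T \<and> snd T f f \<le> snd S f f" if "f \<in> fst S" for f
    using T.mem_if_kernel_bounded[OF _ S.kernel_bounded[OF that] S.inner_self_nonneg] S.extensional that
    by blast
  have ge: "f \<in> fst S \<and> snd S f f \<le> snd T f f" if "f \<in> fst T" for f
    using S.mem_if_kernel_bounded[OF _ T.kernel_bounded[OF that] T.inner_self_nonneg] T.extensional that
    by blast
  have carrier: "fst S = fst T" using le ge by blast
  have self: "snd S f f = snd T f f" if "f \<in> fst S" for f
    using le[OF that] ge[of f] by fastforce
  \<comment> \<open>On the common carrier, equal squared norms of \<open>f\<close>, \<open>g\<close>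
    and \<open>f + g\<close> give equal inner products. Elsewhere both take the default value
    zero.\<close>
  have "snd S f g = snd T f g" for f g
  proof (cases "f \<in> fst S \<and> g \<in> fst S")
    case True
    then have f: "f \<in> fst S" and g: "g \<in> fst S" by auto
    show ?thesis
      using S.inner_axpy_self[OF f g, of 1, unfolded power_one mult_1_left] T.inner_axpy_self[OF f[unfolded carrier] g[unfolded carrier], of 1, unfolded power_one mult_1_left] self[OF S.axpy_mem[OF f g, of 1], unfolded mult_1_left]
        f g carrier self[OF f] self[OF g] by linarith
  next
    case False
    then show ?thesis
      using S.inner_outside[of f g] T.inner_outside[of f g] S.inner_outside[of g f] T.inner_outside[of g f]
        S.inner_commute[of f g] T.inner_commute[of f g] carrier by auto
  qed
  then have "snd S = snd T" by blast
  with carrier show ?thesis by (simp add: prod_eq_iff)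
qed

lemma rkhs_of_eq: "rkhs X S K \<Longrightarrow> rkhs_of X K = S"
  unfolding rkhs_of_def using rkhs_unique by blast

lemma rkhs_rkhs_of: "psd X K \<Longrightarrow> rkhs X (rkhs_of X K) K"
  using moore_aronszajn_rkhs rkhs_of_eq by metis

lemma continuously_embedded_if_kernel_le:
  assumes "rkhs X S K" "rkhs X T L" and le: "psd X (\<lambda>x y. C * L x y - K x y)" and C: "C > 0"
  shows "continuously_embedded S T"
proof -
  interpret S: rkhs X S K by fact
  interpret T: rkhs X T L by fact
  have *: "f \<in> fst T \<and> snd T f f \<le> C * snd S f f" if f: "f \<in> fst S" for f
  proof -
    have "kernel_bounded X L (C * snd S f f) f"
      unfolding kernel_bounded_def
    proof
      fix c assume c: "c \<in> finsupp X"
      have "(lin f c)\<^sup>2 \<le> snd S f f * quad K c c"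
        using S.kernel_bounded[OF f] c by (simp add: kernel_bounded_def)
      also have "\<dots> \<le> snd S f f * (C * quad L c c)"
        using psd_quad_nonneg[OF le c] S.inner_self_nonneg[of f]
        by (intro mult_left_mono) (auto simp: quad_kernel_diff quad_kernel_scale)
      finally show "(lin f c)\<^sup>2 \<le> C * snd S f f * quad L c c" by (simp add: mult_ac)
    qed
    then show ?thesis
      using T.mem_if_kernel_bounded[of f "C * snd S f f"] S.extensional f S.inner_self_nonneg[of f] C by auto
  qed
  have "fspace_norm T f \<le> sqrt C * fspace_norm S f" if "f \<in> fst S" for f
    using real_sqrt_le_mono[OF conjunct2[OF *[OF that]]] by (simp add: fspace_norm_def real_sqrt_mult)
  moreover have "sqrt C > 0" using C by simp
  ultimately show ?thesis unfolding continuously_embedded_def using * by blast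
qed

lemma reproducing_kernel_unique:
  assumes "rkhs X S K" "rkhs X S L" "x \<in> X" "y \<in> X"
  shows "K x y = L x y"
proof -
  interpret K: rkhs X S K by fact
  interpret L: rkhs X S L by fact
  show ?thesis
    using K.reproducing[OF L.section_mem[of x], of y] L.reproducing[OF K.section_mem[of y], of x]
      K.inner_commute L.kernel_commute[of x y] assms(3,4) by simp
qed

lemma rkhs_reproducing_kernel:
  assumes "rkhs X S K"
  shows "rkhs X S (reproducing_kernel X S)"
proof -
  interpret rkhs X S K by fact
  let ?P = "\<lambda>K. rkhs X S K \<and> (\<forall>x y. x \<notin> X \<or> y \<notin> X \<longrightarrow> K x y = 0)"
  \<comment> \<open>A kernel is determined only on \<open>X\<close>; setting it to zero elsewhere
    yields the unique function that the description operator selects.\<close>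
  have "rkhs X S (\<lambda>x y. if x \<in> X \<and> y \<in> X then K x y else 0)"
  proof
    fix y assume y: "y \<in> X"
    have eq: "(\<lambda>x\<in>X. if x \<in> X \<and> y \<in> X then K x y else 0) = (\<lambda>x\<in>X. K x y)" using y by auto
    show "(\<lambda>x\<in>X. if x \<in> X \<and> y \<in> X then K x y else 0) \<in> fst S"
      unfolding eq by (rule section_mem[OF y])
    show "snd S f (\<lambda>x\<in>X. if x \<in> X \<and> y \<in> X then K x y else 0) = f y" if "f \<in> fst S" for f
      unfolding eq by (rule reproducing[OF that y])
  qed
  then have ex: "?P (\<lambda>x y. if x \<in> X \<and> y \<in> X then K x y else 0)" by simp
  have unique: "L = L'" if "?P L" "?P L'" for L L'
  proof (intro ext)
    fix x y
    show "L x y = L' x y" using that reproducing_kernel_unique[of X S L L' x y] by (cases "x \<in> X \<and> y \<in> X") auto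
  qed
  have "\<exists>!K. ?P K" by (rule ex1I[of ?P, OF ex]) (rule unique[OF _ ex])
  then have "?P (reproducing_kernel X S)"
    unfolding reproducing_kernel_def by (rule theI')
  then show ?thesis by simp
qed

text \<open>Point evaluation at \<open>y\<close> is a bounded functional on \<open>V\<close>, with
  bound \<open>K y y\<close>. Its near-minimisers from \<open>approximate_riesz\<close> form a
  Cauchy sequence, and the limit, which lies in \<open>V\<close> by closedness, represents the
  evaluation.\<close>

lemma (in rkhs) rkhs_closed_subspace:
  assumes V: "V \<subseteq> fst S" and zero: "(\<lambda>x\<in>X. 0) \<in> V"
    and axpy: "\<And>f g t. f \<in> V \<Longrightarrow> g \<in> V \<Longrightarrow> (\<lambda>x\<in>X. f x + t * g x) \<in> V"
    and closed: "\<And>s g. (\<And>n. s n \<in> V) \<Longrightarrow> g \<in> fst S \<Longrightarrow>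
      (\<lambda>n. fspace_norm S (\<lambda>x\<in>X. s n x - g x)) \<longlonglongrightarrow> 0 \<Longrightarrow> g \<in> V"
  obtains L where "rkhs X (sub_fspace S V) L"
proof -
  define T where "T = sub_fspace S V"
  have fst_T: "fst T = V" and snd_T: "\<And>f g. f \<in> V \<Longrightarrow> g \<in> V \<Longrightarrow> snd T f g = snd S f g"
    by (auto simp: T_def sub_fspace_def)
  have VS: "f \<in> V \<Longrightarrow> f \<in> fst S" for f using V by blast
  have add: "f \<in> V \<Longrightarrow> g \<in> V \<Longrightarrow> (\<lambda>x\<in>X. f x + g x) \<in> V" for f g using axpy[of f g 1] by simp
  have scale: "(\<lambda>x\<in>X. c * f x) \<in> V" if "f \<in> V" for f c
  proof -
    have "(\<lambda>x\<in>X. (\<lambda>x\<in>X. 0) x + c * f x) = (\<lambda>x\<in>X. c * f x)" by auto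
    then show ?thesis using axpy[OF zero that, of c] by (simp only:)
  qed
  interpret T: pre_hilbert_function_space X T
  proof
    fix f g h :: "'a \<Rightarrow> real" and c :: real
    show "fst T \<subseteq> extensional X" using V extensional fst_T by blast
    show "(\<lambda>x\<in>X. 0) \<in> fst T" using zero fst_T by simp
    show "f \<in> fst T \<Longrightarrow> g \<in> fst T \<Longrightarrow> (\<lambda>x\<in>X. f x + g x) \<in> fst T" using add fst_T by simp
    show "f \<in> fst T \<Longrightarrow> (\<lambda>x\<in>X. c * f x) \<in> fst T" using scale fst_T by simp
    show "snd T f g = snd T g f" by (simp add: T_def sub_fspace_def inner_commute)
    show "f \<in> fst T \<Longrightarrow> g \<in> fst T \<Longrightarrow> h \<in> fst T \<Longrightarrow>
      snd T (\<lambda>x\<in>X. f x + g x) h = snd T f h + snd T g h"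
      using inner_add[OF VS VS VS] add snd_T by (simp add: fst_T)
    show "f \<in> fst T \<Longrightarrow> h \<in> fst T \<Longrightarrow> snd T (\<lambda>x\<in>X. c * f x) h = c * snd T f h"
      using inner_scale[OF VS VS] scale snd_T by (simp add: fst_T)
    show "f \<in> fst T \<Longrightarrow> 0 \<le> snd T f f" using inner_nonneg[OF VS] snd_T by (simp add: fst_T)
    show "f \<in> fst T \<Longrightarrow> snd T f f = 0 \<Longrightarrow> f = (\<lambda>x\<in>X. 0)"
      using inner_definite[OF VS] snd_T by (simp add: fst_T)
    show "f \<notin> fst T \<Longrightarrow> snd T f g = 0" by (simp add: T_def sub_fspace_def)
  qed
  have norm_T: "fspace_norm T f = fspace_norm S f" if "f \<in> V" for f
    using that by (simp add: fspace_norm_def snd_T)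
  have diff: "(\<lambda>x\<in>X. f x - g x) \<in> V" if "f \<in> V" "g \<in> V" for f g
    using axpy[OF that, of "-1"] by simp
  have "T.sequentially_complete"
    unfolding T.sequentially_complete_def
  proof (intro allI impI)
    fix s :: "nat \<Rightarrow> 'a \<Rightarrow> real"
    assume "\<forall>n. s n \<in> fst T"
      and C: "\<forall>e>0. \<exists>N. \<forall>m\<ge>N. \<forall>n\<ge>N. fspace_norm T (\<lambda>x\<in>X. s m x - s n x) < e"
    then have s: "s n \<in> V" for n by (simp add: fst_T)
    have "\<forall>e>0. \<exists>N. \<forall>m\<ge>N. \<forall>n\<ge>N. fspace_norm S (\<lambda>x\<in>X. s m x - s n x) < e"
      using C norm_T[OF diff[OF s s]] by simp
    then obtain g where g: "g \<in> fst S" "(\<lambda>n. fspace_norm S (\<lambda>x\<in>X. s n x - g x)) \<longlonglongrightarrow> 0"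
      using sequentially_complete VS[OF s] unfolding sequentially_complete_def by blast
    then have "g \<in> V" using closed s by blast
    moreover have "(\<lambda>n. fspace_norm T (\<lambda>x\<in>X. s n x - g x)) \<longlonglongrightarrow> 0"
      using g(2) norm_T[OF diff[OF s \<open>g \<in> V\<close>]] by simp
    ultimately show "\<exists>g\<in>fst T. (\<lambda>n. fspace_norm T (\<lambda>x\<in>X. s n x - g x)) \<longlonglongrightarrow> 0"
      using fst_T by blast
  qed
  then interpret T: hilbert_function_space X T using T.hilbert_function_space_iff by blast
  have "\<exists>k\<in>V. \<forall>f\<in>V. snd T f k = f y" if y: "y \<in> X" for y
  proof -
    obtain c where c: "\<And>n. c n \<in> V"
      and app: "\<And>n d. d \<in> V \<Longrightarrow> (snd T (c n) d - d y)\<^sup>2 \<le> snd T d d / real (Suc n)"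
    proof (rule approximate_riesz[of V "\<lambda>f t g. \<lambda>x\<in>X. f x + t * g x" "snd T" "\<lambda>f. f y" "K y y"])
      show "V \<noteq> {}" using zero by blast
      show "snd T (\<lambda>x\<in>X. f x + t * g x) h = snd T f h + t * snd T g h" if "f \<in> V" "g \<in> V" "h \<in> V" for f g h t
        using T.inner_axpy that by (simp add: fst_T)
      show "(f y)\<^sup>2 \<le> K y y * snd T f f" if "f \<in> V" for f
        using evaluation_bound[OF VS[OF that] y] that by (simp add: snd_T mult.commute)
    qed (use axpy y T.inner_commute T.inner_self_nonneg in auto)
    have "snd T (\<lambda>x\<in>X. c m x - c n x) (\<lambda>x\<in>X. c m x - c n x) \<le> 2 / real (Suc m) + 2 / real (Suc n)" for m n
    proof -
      let ?e = "\<lambda>x\<in>X. c m x - c n x"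
      have e: "?e \<in> V" by (rule diff[OF c c])
      let ?a = "snd T (c m) ?e - ?e y" and ?b = "snd T (c n) ?e - ?e y"
      have "snd T ?e ?e = ?a - ?b" using T.inner_diff[of "c m" "c n" ?e] c e by (simp add: fst_T)
      then have "(snd T ?e ?e)\<^sup>2 = (?a - ?b)\<^sup>2" by (simp only:)
      also have "\<dots> \<le> 2 * ?a\<^sup>2 + 2 * ?b\<^sup>2"
        by (rule power2_diff_le)
      also have "\<dots> \<le> 2 * (snd T ?e ?e / real (Suc m)) + 2 * (snd T ?e ?e / real (Suc n))"
        by (intro add_mono mult_left_mono app e) auto
      also have "\<dots> = (2 / real (Suc m) + 2 / real (Suc n)) * snd T ?e ?e"
        by (simp add: algebra_simps)
      finally have "(snd T ?e ?e)\<^sup>2 \<le> (2 / real (Suc m) + 2 / real (Suc n)) * snd T ?e ?e" .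
      then show ?thesis
        using T.inner_self_nonneg[of ?e] by (cases "snd T ?e ?e = 0") (auto simp: power2_eq_square)
    qed
    then obtain k where k: "k \<in> V" and lim: "(\<lambda>n. fspace_norm T (\<lambda>x\<in>X. c n x - k x)) \<longlonglongrightarrow> 0"
      by (rule T.complete_sequence[of c, unfolded fst_T, OF c])
    have "snd T f k = f y" if f: "f \<in> V" for f
    proof (rule LIMSEQ_unique)
      show "(\<lambda>n. snd T f (c n)) \<longlonglongrightarrow> snd T f k"
        by (rule T.inner_tendsto) (use c k f lim in \<open>auto simp: fst_T\<close>)
      have "(\<lambda>n. (snd T (c n) f - f y)\<^sup>2) \<longlonglongrightarrow> 0"
      proof (rule tendsto_sandwich[OF _ _ tendsto_const])
        show "\<forall>\<^sub>F n in sequentially. (snd T (c n) f - f y)\<^sup>2 \<le> snd T f f / real (Suc n)"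
          using app[OF f] by simp
        show "(\<lambda>n. snd T f f / real (Suc n)) \<longlonglongrightarrow> 0"
          by (rule LIMSEQ_Suc) (rule lim_const_over_n)
      qed simp
      then show "(\<lambda>n. snd T f (c n)) \<longlonglongrightarrow> f y"
        by (simp add: power_tendsto_0_iff LIM_zero_iff T.inner_commute)
    qed
    with k show ?thesis by blast
  qed
  then obtain k where k: "\<And>y. y \<in> X \<Longrightarrow> k y \<in> V" "\<And>y f. y \<in> X \<Longrightarrow> f \<in> V \<Longrightarrow> snd T f (k y) = f y"
    by metis
  have "rkhs X T (\<lambda>x y. k y x)"
  proof
    fix y assume y: "y \<in> X"
    have eq: "(\<lambda>x\<in>X. k y x) = k y" using T.restrict_mem[of "k y"] k(1)[OF y] fst_T by simp
    show "(\<lambda>x\<in>X. k y x) \<in> fst T" unfolding eq fst_T by (rule k(1)[OF y])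
    show "snd T f (\<lambda>x\<in>X. k y x) = f y" if "f \<in> fst T" for f
      unfolding eq using k(2)[OF y] that fst_T by simp
  qed
  then show ?thesis using that T_def by simp
qed


section \<open>Series expansions of kernels\<close>

lemma summable_mult_of_squares:
  fixes a b :: "nat \<Rightarrow> real"
  assumes a: "summable (\<lambda>n. (a n)\<^sup>2)" and b: "summable (\<lambda>n. (b n)\<^sup>2)"
  shows "summable (\<lambda>n. \<bar>a n * b n\<bar>)"
proof (rule summable_comparison_test')
  show "summable (\<lambda>n. (a n)\<^sup>2 + (b n)\<^sup>2)" by (rule summable_add[OF a b])
  show "norm \<bar>a n * b n\<bar> \<le> (a n)\<^sup>2 + (b n)\<^sup>2" if "n \<ge> 0" for n
  proof -
    have "2 * \<bar>a n * b n\<bar> \<le> (a n)\<^sup>2 + (b n)\<^sup>2"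
      using zero_le_power2[of "\<bar>a n\<bar> - \<bar>b n\<bar>"] by (simp add: power2_diff abs_mult)
    then show ?thesis using abs_ge_zero[of "a n * b n"] by simp
  qed
qed

lemma Cauchy_Schwarz_suminf:
  fixes a b :: "nat \<Rightarrow> real"
  assumes a: "summable (\<lambda>n. (a n)\<^sup>2)" and b: "summable (\<lambda>n. (b n)\<^sup>2)"
  shows "(\<Sum>n. a n * b n)\<^sup>2 \<le> (\<Sum>n. (a n)\<^sup>2) * (\<Sum>n. (b n)\<^sup>2)"
proof (rule LIMSEQ_le)
  have "summable (\<lambda>n. a n * b n)"
    by (rule summable_rabs_cancel[OF summable_mult_of_squares[OF a b]])
  then show "(\<lambda>N. (\<Sum>n<N. a n * b n)\<^sup>2) \<longlonglongrightarrow> (\<Sum>n. a n * b n)\<^sup>2"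
    by (intro tendsto_power summable_LIMSEQ)
  show "(\<lambda>N. (\<Sum>n<N. (a n)\<^sup>2) * (\<Sum>n<N. (b n)\<^sup>2)) \<longlonglongrightarrow> (\<Sum>n. (a n)\<^sup>2) * (\<Sum>n. (b n)\<^sup>2)"
    by (intro tendsto_mult summable_LIMSEQ a b)
  show "\<exists>N. \<forall>n\<ge>N. (\<Sum>k<n. a k * b k)\<^sup>2 \<le> (\<Sum>k<n. (a k)\<^sup>2) * (\<Sum>k<n. (b k)\<^sup>2)"
    using Cauchy_Schwarz_ineq_sum by blast
qed

lemma lin_sums:
  assumes c: "c \<in> finsupp X" and f: "\<And>x. x \<in> X \<Longrightarrow> (\<lambda>n. f n x) sums g x"
  shows "(\<lambda>n. lin (f n) c) sums lin g c"
  unfolding lin_def by (intro sums_sum sums_mult f) (use c in \<open>auto simp: finsupp_def\<close>)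

lemma quad_sums:
  assumes c: "c \<in> finsupp X"
    and K: "\<And>x y. x \<in> X \<Longrightarrow> y \<in> X \<Longrightarrow> (\<lambda>n. \<phi> n x * \<phi> n y) sums K x y"
  shows "(\<lambda>n. (lin (\<phi> n) c)\<^sup>2) sums quad K c c"
proof -
  have "(\<lambda>n. quad (\<lambda>x y. \<phi> n x * \<phi> n y) c c) sums quad K c c"
    unfolding quad_def by (intro lin_sums[OF c] K)
  then show ?thesis by (simp add: quad_rank_one power2_eq_square)
qed

lemma psd_sums:
  assumes K: "\<And>x y. x \<in> X \<Longrightarrow> y \<in> X \<Longrightarrow> (\<lambda>n. \<phi> n x * \<phi> n y) sums K x y"
  shows "psd X K"
  unfolding psd_def
proof (intro conjI ballI)
  fix x y assume "x \<in> X" "y \<in> X"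
  then show "K x y = K y x" using sums_unique2[OF K[of x y]] K[of y x] by (simp add: mult.commute)
next
  fix c assume c: "c \<in> finsupp X"
  show "0 \<le> quad K c c" using sums_le[OF _ sums_zero quad_sums[OF c K]] by simp
qed

context rkhs
begin

context
  fixes \<phi> :: "nat \<Rightarrow> 'a \<Rightarrow> real"
  assumes K_sums: "\<And>x y. x \<in> X \<Longrightarrow> y \<in> X \<Longrightarrow> (\<lambda>n. \<phi> n x * \<phi> n y) sums K x y"
begin

text \<open>Applying \<open>lin\<close> termwise leaves a sum of products of two square-summable
  sequences, and the second one sums to \<open>quad K c c\<close>. The features may be dependent, so
  a coefficient sequence bounds the norm without determining it.\<close>

lemma feature_series_bounded:
  assumes a: "summable (\<lambda>n. (a n)\<^sup>2)" and f: "\<And>x. x \<in> X \<Longrightarrow> (\<lambda>n. a n * \<phi> n x) sums f x"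
  shows "kernel_bounded X K (\<Sum>n. (a n)\<^sup>2) f"
  unfolding kernel_bounded_def
proof
  fix c assume c: "c \<in> finsupp X"
  have q: "(\<lambda>n. (lin (\<phi> n) c)\<^sup>2) sums quad K c c" by (rule quad_sums[OF c K_sums])
  have l: "(\<lambda>n. a n * lin (\<phi> n) c) sums lin f c"
    using lin_sums[OF c f] by (simp add: lin_fun_scale)
  show "(lin f c)\<^sup>2 \<le> (\<Sum>n. (a n)\<^sup>2) * quad K c c"
    unfolding sums_unique[OF l] sums_unique[OF q] by (rule Cauchy_Schwarz_suminf[OF a sums_summable[OF q]])
qed

lemma feature_series_mem:
  assumes a: "summable (\<lambda>n. (a n)\<^sup>2)" and f: "\<And>x. x \<in> X \<Longrightarrow> (\<lambda>n. a n * \<phi> n x) sums f x"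
    and ext: "f \<in> extensional X"
  shows "f \<in> fst S" and "snd S f f \<le> (\<Sum>n. (a n)\<^sup>2)"
  using mem_if_kernel_bounded[OF ext feature_series_bounded[OF a f]] suminf_nonneg[OF a] by auto

lemma feature_sum_mem:
  assumes "finite I"
  shows "(\<lambda>x\<in>X. \<Sum>n\<in>I. a n * \<phi> n x) \<in> fst S"
    and "snd S (\<lambda>x\<in>X. \<Sum>n\<in>I. a n * \<phi> n x) (\<lambda>x\<in>X. \<Sum>n\<in>I. a n * \<phi> n x) \<le> (\<Sum>n\<in>I. (a n)\<^sup>2)"
proof -
  let ?b = "\<lambda>n. if n \<in> I then a n else 0"
  have b: "(\<lambda>n. (?b n)\<^sup>2) sums (\<Sum>n\<in>I. (a n)\<^sup>2)"
    using sums_If_finite_set[OF assms, of "\<lambda>n. (a n)\<^sup>2"] by (simp add: if_distrib[of "\<lambda>x. x\<^sup>2"] cong: if_cong)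
  have f: "(\<lambda>n. ?b n * \<phi> n x) sums (\<lambda>x\<in>X. \<Sum>n\<in>I. a n * \<phi> n x) x" if "x \<in> X" for x
    using sums_If_finite_set[OF assms, of "\<lambda>n. a n * \<phi> n x"] that
    by (simp add: if_distrib[of "\<lambda>y. y * \<phi> _ x"] cong: if_cong)
  show "(\<lambda>x\<in>X. \<Sum>n\<in>I. a n * \<phi> n x) \<in> fst S"
    by (rule feature_series_mem(1)[OF sums_summable[OF b] f restrict_extensional])
  show "snd S (\<lambda>x\<in>X. \<Sum>n\<in>I. a n * \<phi> n x) (\<lambda>x\<in>X. \<Sum>n\<in>I. a n * \<phi> n x) \<le> (\<Sum>n\<in>I. (a n)\<^sup>2)"
    unfolding sums_unique[OF b]
    by (rule feature_series_mem(2)[OF sums_summable[OF b] f restrict_extensional])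
qed

lemma feature_mem: "(\<lambda>x\<in>X. \<phi> n x) \<in> fst S"
  using feature_sum_mem(1)[of "{n}" "\<lambda>_. 1"] by simp

lemma inner_feature_sum:
  assumes I: "finite I" and f: "f \<in> fst S"
  shows "snd S f (\<lambda>x\<in>X. \<Sum>n\<in>I. a n * \<phi> n x) = (\<Sum>n\<in>I. a n * snd S f (\<lambda>x\<in>X. \<phi> n x))"
proof -
  have "(\<lambda>x\<in>X. \<Sum>n\<in>I. a n * \<phi> n x) = (\<lambda>x\<in>X. \<Sum>n\<in>I. a n * (\<lambda>x\<in>X. \<phi> n x) x)" by auto
  then show ?thesis using inner_lincomb[OF I feature_mem f, of a] by simp
qed

text \<open>Bessel's inequality without orthogonality: pairing \<open>f\<close> with the feature sum
  that has the coefficients \<open>a n\<close> gives their sum of squares \<open>A\<close>, and that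
  feature sum has squared norm at most \<open>A\<close>. Hence the square of \<open>A\<close> is at
  most \<open>snd S f f * A\<close>.\<close>

lemma feature_coeff_sum_le:
  assumes f: "f \<in> fst S"
  shows "(\<Sum>n<N. (snd S f (\<lambda>x\<in>X. \<phi> n x))\<^sup>2) \<le> snd S f f"
proof -
  define a where "a n = snd S f (\<lambda>x\<in>X. \<phi> n x)" for n
  let ?g = "\<lambda>x\<in>X. \<Sum>n<N. a n * \<phi> n x"
  have g: "?g \<in> fst S" by (rule feature_sum_mem) simp
  have "(\<Sum>n<N. (a n)\<^sup>2) = snd S f ?g"
    using inner_feature_sum[OF finite_lessThan f, of a N] by (simp add: a_def power2_eq_square)
  then have "(\<Sum>n<N. (a n)\<^sup>2)\<^sup>2 \<le> snd S f f * snd S ?g ?g" using Cauchy_Schwarz[OF f g] by simp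
  also have "\<dots> \<le> snd S f f * (\<Sum>n<N. (a n)\<^sup>2)"
    by (rule mult_left_mono[OF feature_sum_mem(2)]) (auto simp: inner_self_nonneg)
  finally have "(\<Sum>n<N. (a n)\<^sup>2)\<^sup>2 \<le> snd S f f * (\<Sum>n<N. (a n)\<^sup>2)" .
  moreover have "0 \<le> (\<Sum>n<N. (a n)\<^sup>2)" by (simp add: sum_nonneg)
  ultimately show ?thesis
    unfolding a_def[symmetric] using inner_self_nonneg[of f]
    by (cases "(\<Sum>n<N. (a n)\<^sup>2) = 0") (auto simp: power2_eq_square)
qed

lemma feature_coeff_summable:
  assumes f: "f \<in> fst S"
  shows "summable (\<lambda>n. (snd S f (\<lambda>x\<in>X. \<phi> n x))\<^sup>2)"
    and "(\<Sum>n. (snd S f (\<lambda>x\<in>X. \<phi> n x))\<^sup>2) \<le> snd S f f"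
proof -
  show s: "summable (\<lambda>n. (snd S f (\<lambda>x\<in>X. \<phi> n x))\<^sup>2)"
    by (rule summableI_nonneg_bounded) (use feature_coeff_sum_le[OF f] in auto)
  show "(\<Sum>n. (snd S f (\<lambda>x\<in>X. \<phi> n x))\<^sup>2) \<le> snd S f f"
    by (rule suminf_le_const[OF s feature_coeff_sum_le[OF f]])
qed

text \<open>The section at \<open>y\<close> is the feature series with coefficients
  \<open>\<phi> n y\<close>. Its partial sums converge in norm because these coefficients are square
  summable, and pairing them with \<open>f\<close> yields the partial sums of the claimed
  series.\<close>

lemma feature_expansion:
  assumes f: "f \<in> fst S" and y: "y \<in> X"
  shows "(\<lambda>n. snd S f (\<lambda>x\<in>X. \<phi> n x) * \<phi> n y) sums f y"
proof -
  define k where "k N = (\<lambda>x\<in>X. \<Sum>n<N. \<phi> n y * \<phi> n x)" for N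
  have k: "k N \<in> fst S" for N unfolding k_def by (rule feature_sum_mem) simp
  have \<phi>2: "summable (\<lambda>n. (\<phi> n y)\<^sup>2)" using sums_summable[OF K_sums[OF y y]] by (simp add: power2_eq_square)
  have tail: "snd S (\<lambda>x\<in>X. k N x - (\<lambda>x\<in>X. K x y) x) (\<lambda>x\<in>X. k N x - (\<lambda>x\<in>X. K x y) x)
      \<le> (\<Sum>n. (\<phi> n y)\<^sup>2) - (\<Sum>n<N. (\<phi> n y)\<^sup>2)" for N
  proof -
    \<comment> \<open>The coefficients of \<open>k N\<close> minus the section: zero below
      \<open>N\<close>, and \<open>- \<phi> n y\<close> from there on.\<close>
    let ?b = "\<lambda>n. - (if n \<in> {..<N} then 0 else \<phi> n y)"
    have fin: "(\<lambda>n. if n \<in> {..<N} then (\<phi> n y)\<^sup>2 else 0) sums (\<Sum>n<N. (\<phi> n y)\<^sup>2)"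
      by (rule sums_If_finite_set) simp
    have b: "(\<lambda>n. (?b n)\<^sup>2) sums ((\<Sum>n. (\<phi> n y)\<^sup>2) - (\<Sum>n<N. (\<phi> n y)\<^sup>2))"
      by (rule sums_cong[THEN iffD1, OF _ sums_diff[OF summable_sums[OF \<phi>2] fin]]) auto
    have f: "(\<lambda>n. ?b n * \<phi> n x) sums (\<lambda>x\<in>X. k N x - (\<lambda>x\<in>X. K x y) x) x" if x: "x \<in> X" for x
    proof -
      have fin: "(\<lambda>n. if n \<in> {..<N} then \<phi> n y * \<phi> n x else 0) sums (\<Sum>n<N. \<phi> n y * \<phi> n x)"
        by (rule sums_If_finite_set) simp
      have "(\<lambda>n. ?b n * \<phi> n x) sums ((\<Sum>n<N. \<phi> n y * \<phi> n x) - K x y)"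
        by (rule sums_cong[THEN iffD1, OF _ sums_diff[OF fin K_sums[OF x y]]]) auto
      then show ?thesis using x by (simp add: k_def)
    qed
    show ?thesis
      unfolding sums_unique[OF b]
      by (rule feature_series_mem(2)[OF sums_summable[OF b] f restrict_extensional])
  qed
  have "(\<lambda>N. fspace_norm S (\<lambda>x\<in>X. k N x - (\<lambda>x\<in>X. K x y) x)) \<longlonglongrightarrow> 0"
  proof (rule tendsto_sandwich[OF _ _ tendsto_const])
    show "\<forall>\<^sub>F N in sequentially. fspace_norm S (\<lambda>x\<in>X. k N x - (\<lambda>x\<in>X. K x y) x)
        \<le> sqrt ((\<Sum>n. (\<phi> n y)\<^sup>2) - (\<Sum>n<N. (\<phi> n y)\<^sup>2))"
      unfolding fspace_norm_def by (intro always_eventually allI real_sqrt_le_mono tail)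
    have "(\<lambda>N. sqrt ((\<Sum>n. (\<phi> n y)\<^sup>2) - (\<Sum>n<N. (\<phi> n y)\<^sup>2))) \<longlonglongrightarrow> sqrt ((\<Sum>n. (\<phi> n y)\<^sup>2) - (\<Sum>n. (\<phi> n y)\<^sup>2))"
      by (intro tendsto_real_sqrt tendsto_diff tendsto_const summable_LIMSEQ \<phi>2)
    then show "(\<lambda>N. sqrt ((\<Sum>n. (\<phi> n y)\<^sup>2) - (\<Sum>n<N. (\<phi> n y)\<^sup>2))) \<longlonglongrightarrow> 0" by simp
    show "\<forall>\<^sub>F N in sequentially. 0 \<le> fspace_norm S (\<lambda>x\<in>X. k N x - (\<lambda>x\<in>X. K x y) x)"
      by (simp add: fspace_norm_def inner_self_nonneg)
  qed
  from inner_tendsto[OF k section_mem[OF y] f this]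
  have "(\<lambda>N. snd S f (k N)) \<longlonglongrightarrow> f y" unfolding reproducing[OF f y] .
  then show ?thesis
    unfolding k_def inner_feature_sum[OF finite_lessThan f] sums_def by (simp add: mult.commute)
qed

end

end

section \<open>The Schur product theorem\<close>

text \<open>Positivity concerns finitely many points at a time, and a sum of rank one kernels has a
  sum of squares as its quadratic form. The index type is left open because a product of two
  decompositions is indexed by pairs.\<close>

lemma psdI_rank_one_sum:
  assumes dec: "\<And>F. finite F \<Longrightarrow> F \<subseteq> X \<Longrightarrow>
      \<exists>(I :: 'i set) v. \<forall>x\<in>F. \<forall>y\<in>F. K x y = (\<Sum>i\<in>I. v i x * v i y)"
  shows "psd X K"
  unfolding psd_def
proof (intro conjI ballI)
  fix x y assume "x \<in> X" "y \<in> X"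
  then obtain I :: "'i set" and v where "\<forall>x'\<in>{x, y}. \<forall>y'\<in>{x, y}. K x' y' = (\<Sum>i\<in>I. v i x' * v i y')"
    using dec[of "{x, y}"] by auto
  then show "K x y = K y x" by (simp add: mult.commute)
next
  fix c assume c: "c \<in> finsupp X"
  let ?F = "{x. c x \<noteq> 0}"
  obtain I :: "'i set" and v where v: "\<forall>x\<in>?F. \<forall>y\<in>?F. K x y = (\<Sum>i\<in>I. v i x * v i y)"
    using dec[of ?F] c by (auto simp: finsupp_def)
  have c': "c \<in> finsupp ?F" using c by (simp add: finsupp_def)
  have "quad K c c = quad (\<lambda>x y. \<Sum>i\<in>I. v i x * v i y) c c"
    unfolding quad_def by (intro lin_cong[OF c'] v[rule_format])
  also have "\<dots> = (\<Sum>i\<in>I. (lin (v i) c)\<^sup>2)"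
    by (simp add: quad_def lin_fun_sum lin_fun_scale power2_eq_square)
      (simp add: quad_rank_one[unfolded quad_def lin_fun_scale])
  finally show "0 \<le> quad K c c" by (simp add: sum_nonneg)
qed

lemma finsupp_mono: "F \<subseteq> X \<Longrightarrow> finsupp F \<subseteq> finsupp X"
  by (auto simp: finsupp_def)

lemma psd_mono: "psd X K \<Longrightarrow> F \<subseteq> X \<Longrightarrow> psd F K"
  unfolding psd_def using finsupp_mono by blast

text \<open>Cholesky elimination of the point \<open>z\<close>. Subtracting \<open>u x * u y\<close>
  leaves the Schur complement, which vanishes in the row and column of \<open>z\<close>. It stays
  positive on \<open>F\<close> by Cauchy-Schwarz between \<open>c\<close> and the unit mass at
  \<open>z\<close>.\<close>

lemma psd_rank_one_sum:
  assumes "finite F" "psd F K"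
  shows "\<exists>(m :: nat) v. \<forall>x\<in>F. \<forall>y\<in>F. K x y = (\<Sum>i<m. v i x * v i y)"
  using assms
proof (induction F arbitrary: K rule: finite_induct)
  case (insert z F)
  let ?G = "insert z F"
  note K = insert.prems
  define a where "a = K z z"
  have cs: "(K x y)\<^sup>2 \<le> K x x * K y y" if "x \<in> ?G" "y \<in> ?G" for x y
    using quad_Cauchy_Schwarz[OF K delta_finsupp[OF that(1)] delta_finsupp[OF that(2)]]
    by (simp add: quad_delta lin_delta)
  have a0: "0 \<le> a"
    using psd_quad_nonneg[OF K delta_finsupp[of z]] by (simp add: quad_delta lin_delta a_def)
  have zero: "K x z = 0" if "a = 0" "x \<in> ?G" for x
    using cs[OF that(2), of z] that(1) by (simp add: a_def)
  \<comment> \<open>If \<open>a = 0\<close>, division by zero makes the rank one term vanish, as it should.\<close>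
  define u where "u x = K x z / sqrt a" for x
  define K' where "K' x y = K x y - u x * u y" for x y
  have K'z: "K' x z = 0" if "x \<in> ?G" for x
  proof (cases "a = 0")
    case True
    then show ?thesis using zero[OF True that] by (simp add: K'_def u_def)
  next
    case False
    then have "u x * u z = K x z * (a / (sqrt a * sqrt a))" by (simp add: u_def a_def)
    also have "\<dots> = K x z" using False a0 by simp
    finally show ?thesis by (simp add: K'_def)
  qed
  have "psd F K'"
    unfolding psd_def
  proof (intro conjI ballI)
    fix x y assume "x \<in> F" "y \<in> F"
    then show "K' x y = K' y x" using psd_commute[OF K, of x y] by (simp add: K'_def)
  next
    fix c assume "c \<in> finsupp F"
    then have c: "c \<in> finsupp ?G" using finsupp_mono[of F ?G] by blast
    have "(lin (\<lambda>x. K x z) c)\<^sup>2 \<le> quad K c c * a"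
      using quad_Cauchy_Schwarz[OF K c delta_finsupp[of z]] by (simp add: quad_delta lin_delta a_def)
    moreover have "lin u c = lin (\<lambda>x. K x z) c / sqrt a"
      unfolding u_def using lin_fun_scale[of "1 / sqrt a" "\<lambda>x. K x z" c] by simp
    ultimately have "(lin u c)\<^sup>2 \<le> quad K c c"
      using a0 psd_quad_nonneg[OF K c] by (cases "a = 0") (simp_all add: power_divide divide_le_eq)
    then show "0 \<le> quad K' c c"
      unfolding K'_def by (simp add: quad_kernel_diff quad_rank_one power2_eq_square)
  qed
  then obtain m :: nat and v where v: "\<forall>x\<in>F. \<forall>y\<in>F. K' x y = (\<Sum>i<m. v i x * v i y)"
    using insert.IH[of K'] by blast
  \<comment> \<open>Index \<open>m\<close> carries the new vector; the old ones are extended by zero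
    to \<open>z\<close>, where the Schur complement vanishes.\<close>
  define w where "w i x = (if i = m then u x else if x = z then 0 else v i x)" for i x
  have "K x y = (\<Sum>i<Suc m. w i x * w i y)" if x: "x \<in> ?G" and y: "y \<in> ?G" for x y
  proof -
    have "K' x y = (\<Sum>i<m. w i x * w i y)"
    proof (cases "x = z \<or> y = z")
      case True
      then have "K' x y = 0"
        using K'z[OF x] K'z[OF y] psd_commute[OF K x y] by (auto simp: K'_def mult.commute)
      with True show ?thesis by (auto simp: w_def)
    next
      case False
      then show ?thesis using v x y by (auto simp: w_def intro!: sum.cong)
    qed
    then have "K x y = (\<Sum>i<m. w i x * w i y) + u x * u y" by (simp add: K'_def)
    then show ?thesis by (simp add: w_def)
  qed
  then show ?case by (intro exI ballI)
qed simp

lemma psd_finite_rank_one_sum: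
  assumes "psd X K" "finite F" "F \<subseteq> X"
  shows "\<exists>(m :: nat) v. \<forall>x\<in>F. \<forall>y\<in>F. K x y = (\<Sum>i<m. v i x * v i y)"
  using psd_rank_one_sum[OF assms(2) psd_mono[OF assms(1,3)]] .

lemma psd_mult:
  assumes "psd X K" "psd X L"
  shows "psd X (\<lambda>x y. K x y * L x y)"
proof (rule psdI_rank_one_sum)
  fix F assume F: "finite F" "F \<subseteq> X"
  obtain m :: nat and v where v: "\<forall>x\<in>F. \<forall>y\<in>F. K x y = (\<Sum>i<m. v i x * v i y)"
    using psd_finite_rank_one_sum[OF assms(1) F] by blast
  obtain n :: nat and w where w: "\<forall>x\<in>F. \<forall>y\<in>F. L x y = (\<Sum>i<n. w i x * w i y)"
    using psd_finite_rank_one_sum[OF assms(2) F] by blast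
  have "K x y * L x y = (\<Sum>p\<in>{..<m} \<times> {..<n}. (v (fst p) x * w (snd p) x) * (v (fst p) y * w (snd p) y))"
    if "x \<in> F" "y \<in> F" for x y
    using v w that by (simp add: sum_product sum.cartesian_product case_prod_unfold mult_ac)
  then show "\<exists>(I :: (nat \<times> nat) set) v. \<forall>x\<in>F. \<forall>y\<in>F. K x y * L x y = (\<Sum>i\<in>I. v i x * v i y)"
    by (intro exI[of _ "{..<m} \<times> {..<n}"] exI[of _ "\<lambda>p x. v (fst p) x * w (snd p) x"]) blast
qed

text \<open>\<open>h\<close> may identify points, so coefficients cannot simply be carried over
  along \<open>h\<close>; composing the vectors of a rank one decomposition with \<open>h\<close> is
  insensitive to that.\<close>

lemma psd_pullback:
  assumes K: "psd Y K" and h: "\<And>x. x \<in> X \<Longrightarrow> h x \<in> Y"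
  shows "psd X (\<lambda>x y. K (h x) (h y))"
proof (rule psdI_rank_one_sum)
  fix F assume F: "finite F" "F \<subseteq> X"
  obtain m :: nat and v where v: "\<forall>x\<in>h ` F. \<forall>y\<in>h ` F. K x y = (\<Sum>i<m. v i x * v i y)"
    using psd_finite_rank_one_sum[OF K, of "h ` F"] F h by blast
  then show "\<exists>(I :: nat set) v. \<forall>x\<in>F. \<forall>y\<in>F. K (h x) (h y) = (\<Sum>i\<in>I. v i x * v i y)"
    by (intro exI[of _ "{..<m}"] exI[of _ "\<lambda>i x. v i (h x)"]) simp
qed

lemma psd_add: "psd X K \<Longrightarrow> psd X L \<Longrightarrow> psd X (\<lambda>x y. K x y + L x y)"
  by (simp add: psd_def quad_kernel_add)

lemma psd_scale: "psd X K \<Longrightarrow> 0 \<le> t \<Longrightarrow> psd X (\<lambda>x y. t * K x y)"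
  by (simp add: psd_def quad_kernel_scale)

lemma psd_const: "0 \<le> t \<Longrightarrow> psd X (\<lambda>x y. t)"
  by (rule psdI_rank_one_sum) (rule exI[of _ "{0 :: nat}"], rule exI[of _ "\<lambda>_ _. sqrt t"], simp)

lemma psd_sum: "(\<And>i. i \<in> I \<Longrightarrow> psd X (K i)) \<Longrightarrow> psd X (\<lambda>x y. \<Sum>i\<in>I. K i x y)"
  by (induction I rule: infinite_finite_induct) (auto intro: psd_const psd_add)

lemma psd_prod: "(\<And>i. i \<in> I \<Longrightarrow> psd X (K i)) \<Longrightarrow> psd X (\<lambda>x y. \<Prod>i\<in>I. K i x y)"
  by (induction I rule: infinite_finite_induct) (auto intro: psd_const psd_mult)

lemma psd_prod_diff:
  assumes "finite I" "C \<ge> 0"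
    and "\<And>i. i \<in> I \<Longrightarrow> psd X (K i)" "\<And>i. i \<in> I \<Longrightarrow> psd X (L i)"
    and "\<And>i. i \<in> I \<Longrightarrow> psd X (\<lambda>x y. C * L i x y - K i x y)"
  shows "psd X (\<lambda>x y. C ^ card I * (\<Prod>i\<in>I. L i x y) - (\<Prod>i\<in>I. K i x y))"
  using assms
proof (induction I rule: finite_induct)
  case empty
  then show ?case by (simp add: psd_const)
next
  case (insert i I)
  \<comment> \<open>Telescoping: the two mixed terms cancel, and what is left is the difference for
    \<open>insert i I\<close>.\<close>
  have "psd X (\<lambda>x y. (C * L i x y - K i x y) * (C ^ card I * (\<Prod>j\<in>I. L j x y))
      + K i x y * (C ^ card I * (\<Prod>j\<in>I. L j x y) - (\<Prod>j\<in>I. K j x y)))"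
    by (intro psd_add psd_mult psd_scale psd_prod insert.IH insert.prems zero_le_power) auto
  then show ?case using insert.hyps by (simp add: algebra_simps)
qed

section \<open>Cosine systems on the unit interval\<close>

definition unit_inner :: "(real \<Rightarrow> real) \<Rightarrow> (real \<Rightarrow> real) \<Rightarrow> real" where
  "unit_inner f g = integral {0..1} (\<lambda>x. f x * g x)"

abbreviation unit_continuous :: "(real \<Rightarrow> real) \<Rightarrow> bool" where
  "unit_continuous f \<equiv> continuous_on {0..1} f"

lemma unit_inner_commute: "unit_inner f g = unit_inner g f"
  by (simp add: unit_inner_def mult.commute)

lemma unit_integrable: "unit_continuous f \<Longrightarrow> unit_continuous g \<Longrightarrow> (\<lambda>x. f x * g x) integrable_on {0..1}"
  by (intro integrable_continuous_interval continuous_on_mult)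

lemma unit_inner_add:
  "unit_continuous f \<Longrightarrow> unit_continuous g \<Longrightarrow> unit_continuous h \<Longrightarrow>
    unit_inner (\<lambda>x. f x + g x) h = unit_inner f h + unit_inner g h"
  using Henstock_Kurzweil_Integration.integral_add[OF unit_integrable[of f h] unit_integrable[of g h]]
  by (simp add: unit_inner_def algebra_simps)

lemma unit_inner_diff:
  "unit_continuous f \<Longrightarrow> unit_continuous g \<Longrightarrow> unit_continuous h \<Longrightarrow>
    unit_inner (\<lambda>x. f x - g x) h = unit_inner f h - unit_inner g h"
  using Henstock_Kurzweil_Integration.integral_diff[OF unit_integrable[of f h] unit_integrable[of g h]]
  by (simp add: unit_inner_def algebra_simps)

lemma unit_inner_scale: "unit_inner (\<lambda>x. c * f x) h = c * unit_inner f h"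
  unfolding unit_inner_def
  using Henstock_Kurzweil_Integration.integral_cmul[of "{0..1}" c "\<lambda>x. f x * h x"] by (simp add: mult.assoc)

lemma unit_inner_zero: "unit_inner (\<lambda>x. 0) h = 0"
  by (simp add: unit_inner_def)

lemma unit_inner_sum:
  assumes "\<And>i. i \<in> I \<Longrightarrow> unit_continuous (e i)" "unit_continuous h"
  shows "unit_inner (\<lambda>x. \<Sum>i\<in>I. a i * e i x) h = (\<Sum>i\<in>I. a i * unit_inner (e i) h)"
  using assms(1)
proof (induction I rule: infinite_finite_induct)
  case (insert i I)
  then show ?case
    using unit_inner_add[of "\<lambda>x. a i * e i x" "\<lambda>x. \<Sum>i\<in>I. a i * e i x" h] assms(2)
    by (simp add: unit_inner_scale continuous_on_sum continuous_on_mult)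
qed (simp_all add: unit_inner_zero)

lemma unit_inner_nonneg: "unit_continuous f \<Longrightarrow> 0 \<le> unit_inner f f"
  unfolding unit_inner_def by (rule integral_nonneg[OF unit_integrable]) auto

lemma unit_inner_eq_0_imp:
  assumes "unit_continuous f" "unit_inner f f = 0" "x \<in> {0..1}"
  shows "f x = 0"
  using integral_eq_0_iff[of 0 1 "\<lambda>x. f x * f x"] assms by (auto simp: unit_inner_def continuous_on_mult)

definition unit_orthonormal :: "(nat \<Rightarrow> real \<Rightarrow> real) \<Rightarrow> nat set \<Rightarrow> bool" where
  "unit_orthonormal e I \<longleftrightarrow> (\<forall>i\<in>I. unit_continuous (e i)) \<and>
    (\<forall>i\<in>I. \<forall>j\<in>I. unit_inner (e i) (e j) = of_bool (i = j))"

lemma unit_inner_orthonormal_sum: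
  assumes e: "unit_orthonormal e I" and I: "finite I"
  shows "unit_inner (\<lambda>x. \<Sum>i\<in>I. a i * e i x) (\<lambda>x. \<Sum>i\<in>I. a i * e i x) = (\<Sum>i\<in>I. (a i)\<^sup>2)"
proof -
  have c: "unit_continuous (e i)" if "i \<in> I" for i using e that by (simp add: unit_orthonormal_def)
  have s: "unit_continuous (\<lambda>x. \<Sum>i\<in>I. a i * e i x)" by (intro continuous_intros c)
  have "unit_inner (e i) (\<lambda>x. \<Sum>j\<in>I. a j * e j x) = a i" if i: "i \<in> I" for i
  proof -
    have "unit_inner (e i) (\<lambda>x. \<Sum>j\<in>I. a j * e j x) = (\<Sum>j\<in>I. a j * unit_inner (e j) (e i))"
      using unit_inner_sum[of I e "e i" a, OF c c[OF i]] unit_inner_commute[of "e i" "\<lambda>x. \<Sum>j\<in>I. a j * e j x"] by simp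
    also have "\<dots> = (\<Sum>j\<in>I. if j = i then a j else 0)"
      using e i by (intro sum.cong) (auto simp: unit_orthonormal_def)
    finally show ?thesis using I i by simp
  qed
  then show ?thesis using unit_inner_sum[of I e "\<lambda>x. \<Sum>i\<in>I. a i * e i x" a, OF c s] by (simp add: power2_eq_square)
qed

lemma unit_Bessel:
  assumes e: "unit_orthonormal e I" and I: "finite I" and g: "unit_continuous g"
  shows "(\<Sum>i\<in>I. (unit_inner g (e i))\<^sup>2) \<le> unit_inner g g"
proof -
  define a where "a i = unit_inner g (e i)" for i
  define s where "s = (\<lambda>x. \<Sum>i\<in>I. a i * e i x)"
  have c: "unit_continuous (e i)" if "i \<in> I" for i using e that by (simp add: unit_orthonormal_def)
  have s: "unit_continuous s" unfolding s_def by (intro continuous_intros c)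
  have gs: "unit_continuous (\<lambda>x. g x - s x)" by (intro continuous_intros g s)
  have sg: "unit_inner s g = (\<Sum>i\<in>I. (a i)\<^sup>2)"
    unfolding s_def using unit_inner_sum[of I e g a, OF c g]
    by (simp add: a_def power2_eq_square unit_inner_commute[of _ g])
  have ss: "unit_inner s s = (\<Sum>i\<in>I. (a i)\<^sup>2)"
    unfolding s_def by (rule unit_inner_orthonormal_sum[OF e I])
  have "0 \<le> unit_inner (\<lambda>x. g x - s x) (\<lambda>x. g x - s x)" by (rule unit_inner_nonneg[OF gs])
  also have "\<dots> = unit_inner (\<lambda>x. g x - s x) g - unit_inner (\<lambda>x. g x - s x) s"
    using unit_inner_diff[OF g s gs] by (simp add: unit_inner_commute)
  also have "\<dots> = unit_inner g g - (\<Sum>i\<in>I. (a i)\<^sup>2)"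
    using unit_inner_diff[OF g s g] unit_inner_diff[OF g s s] sg ss by (simp add: unit_inner_commute)
  finally show ?thesis by (simp add: a_def)
qed

lemma unit_inner_uniform_limit:
  assumes lim: "uniform_limit {0..1} F g sequentially" and F: "\<And>n. unit_continuous (F n)"
    and w: "unit_continuous w"
  shows "unit_continuous g" and "(\<lambda>n. unit_inner (F n) w) \<longlonglongrightarrow> unit_inner g w"
proof -
  show "unit_continuous g" by (rule uniform_limit_theorem[OF _ lim]) (use F in auto)
  then have g: "bounded (g ` {0..1})" by (intro compact_imp_bounded compact_continuous_image) auto
  have wb: "bounded (w ` {0..1})" by (intro compact_imp_bounded compact_continuous_image w) auto
  have "uniform_limit {0..1} (\<lambda>n x. F n x * w x) (\<lambda>x. g x * w x) sequentially"
    by (rule uniform_lim_mult[OF lim uniform_limit_const g wb])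
  then obtain I J where IJ: "\<And>n. ((\<lambda>x. F n x * w x) has_integral I n) {0..1}"
    "((\<lambda>x. g x * w x) has_integral J) {0..1}" "(I \<longlongrightarrow> J) sequentially"
    by (rule uniform_limit_integral) (auto intro!: continuous_intros F w)
  then have "I = (\<lambda>n. unit_inner (F n) w)" "J = unit_inner g w"
    by (auto simp: unit_inner_def intro!: ext integral_unique[symmetric])
  then show "(\<lambda>n. unit_inner (F n) w) \<longlonglongrightarrow> unit_inner g w" using IJ(3) by simp
qed

section \<open>Waves, integration by parts and orthonormality\<close>

definition wave :: "real \<Rightarrow> real \<Rightarrow> real \<Rightarrow> real" where
  "wave \<omega> \<theta> x = sqrt 2 * cos (\<omega> * x + \<theta>)"

lemma wave_continuous: "continuous_on S (wave \<omega> \<theta>)"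
  unfolding wave_def by (intro continuous_intros)

lemma abs_wave_le: "\<bar>wave \<omega> \<theta> x\<bar> \<le> sqrt 2"
  by (simp add: wave_def abs_mult mult_left_le)

text \<open>Differentiation multiplies by the frequency and advances the phase by a quarter turn, so
  sines, cosines and their derivatives of all orders form one family. The factor
  \<open>sqrt 2\<close> normalises them in mean square over the interval.\<close>

lemma wave_derivative:
  "(wave \<omega> \<theta> has_real_derivative \<omega> * wave \<omega> (\<theta> + pi / 2) x) (at x within S)"
proof -
  have "cos (\<omega> * x + (\<theta> + pi / 2)) = - sin (\<omega> * x + \<theta>)"
    using minus_sin_cos_eq[of "\<omega> * x + \<theta>"] by (simp add: add.assoc)
  then show ?thesis
    unfolding wave_def by (auto intro!: derivative_eq_intros)
qed

definition wave_boundary :: "real \<Rightarrow> real \<Rightarrow> (real \<Rightarrow> real) \<Rightarrow> real" where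
  "wave_boundary \<omega> \<theta> g = g 1 * wave \<omega> \<theta> 1 - g 0 * wave \<omega> \<theta> 0"

lemma unit_inner_wave_derivative:
  assumes g: "\<And>x. x \<in> {0..1} \<Longrightarrow> (g has_real_derivative g' x) (at x within {0..1})"
    and g': "unit_continuous g'"
  shows "unit_inner g' (wave \<omega> \<theta>) = wave_boundary \<omega> \<theta> g - \<omega> * unit_inner g (wave \<omega> (\<theta> + pi / 2))"
proof -
  have gc: "unit_continuous g" by (rule DERIV_continuous_on[OF g])
  have "((\<lambda>x. g' x * wave \<omega> \<theta> x + \<omega> * (g x * wave \<omega> (\<theta> + pi / 2) x)) has_integral wave_boundary \<omega> \<theta> g) {0..1}"
    unfolding wave_boundary_def
  proof (rule fundamental_theorem_of_calculus)
    fix x :: real assume x: "x \<in> {0..1}"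
    have "((\<lambda>x. g x * wave \<omega> \<theta> x) has_real_derivative
        g' x * wave \<omega> \<theta> x + \<omega> * wave \<omega> (\<theta> + pi / 2) x * g x) (at x within {0..1})"
      by (rule DERIV_mult[OF g[OF x] wave_derivative])
    then show "((\<lambda>x. g x * wave \<omega> \<theta> x) has_vector_derivative
        g' x * wave \<omega> \<theta> x + \<omega> * (g x * wave \<omega> (\<theta> + pi / 2) x)) (at x within {0..1})"
      by (simp add: has_real_derivative_iff_has_vector_derivative mult_ac)
  qed simp
  then have "wave_boundary \<omega> \<theta> g = integral {0..1} (\<lambda>x. g' x * wave \<omega> \<theta> x + \<omega> * (g x * wave \<omega> (\<theta> + pi / 2) x))"
    by (simp add: integral_unique)
  also have "\<dots> = unit_inner g' (wave \<omega> \<theta>) + integral {0..1} (\<lambda>x. \<omega> * (g x * wave \<omega> (\<theta> + pi / 2) x))"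
    unfolding unit_inner_def
    by (intro Henstock_Kurzweil_Integration.integral_add integrable_continuous_interval continuous_intros g' gc wave_continuous)
  also have "integral {0..1} (\<lambda>x. \<omega> * (g x * wave \<omega> (\<theta> + pi / 2) x)) = \<omega> * unit_inner g (wave \<omega> (\<theta> + pi / 2))"
    using unit_inner_scale[of \<omega> g "wave \<omega> (\<theta> + pi / 2)"] by (simp add: unit_inner_def mult.assoc)
  finally show ?thesis by simp
qed

text \<open>Each integration by parts advances the phase of the wave by a quarter turn. The phase
  starts \<open>n\<close> quarter turns early so that the pairing with \<open>G 0\<close> ends at
  the prescribed \<theta>.\<close>

lemma unit_inner_wave_iterated_derivative:
  assumes G: "\<And>\<tau> x. \<tau> < n \<Longrightarrow> x \<in> {0..1} \<Longrightarrow> (G \<tau> has_real_derivative G (Suc \<tau>) x) (at x within {0..1})"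
    and Gn: "unit_continuous (G n)"
  shows "unit_inner (G n) (wave \<omega> (\<theta> - real n * pi / 2)) = (- \<omega>) ^ n * unit_inner (G 0) (wave \<omega> \<theta>)
    + (\<Sum>\<tau><n. (- \<omega>) ^ (n - Suc \<tau>) * wave_boundary \<omega> (\<theta> - real (Suc \<tau>) * pi / 2) (G \<tau>))"
  using assms
proof (induction n)
  case (Suc n)
  have cont: "unit_continuous (G n)" by (rule DERIV_continuous_on[OF Suc.prems(1)]) auto
  have shift: "\<theta> - real (Suc n) * pi / 2 + pi / 2 = \<theta> - real n * pi / 2" by (simp add: field_simps)
  have "unit_inner (G (Suc n)) (wave \<omega> (\<theta> - real (Suc n) * pi / 2))
      = wave_boundary \<omega> (\<theta> - real (Suc n) * pi / 2) (G n) - \<omega> * unit_inner (G n) (wave \<omega> (\<theta> - real n * pi / 2))"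
    using unit_inner_wave_derivative[of "G n" "G (Suc n)" \<omega> "\<theta> - real (Suc n) * pi / 2"] Suc.prems
    unfolding shift by simp
  also have "unit_inner (G n) (wave \<omega> (\<theta> - real n * pi / 2)) = (- \<omega>) ^ n * unit_inner (G 0) (wave \<omega> \<theta>)
    + (\<Sum>\<tau><n. (- \<omega>) ^ (n - Suc \<tau>) * wave_boundary \<omega> (\<theta> - real (Suc \<tau>) * pi / 2) (G \<tau>))"
    by (rule Suc.IH) (use Suc.prems cont in auto)
  also have "\<omega> * ((- \<omega>) ^ n * unit_inner (G 0) (wave \<omega> \<theta>)
      + (\<Sum>\<tau><n. (- \<omega>) ^ (n - Suc \<tau>) * wave_boundary \<omega> (\<theta> - real (Suc \<tau>) * pi / 2) (G \<tau>)))
    = - ((- \<omega>) ^ Suc n * unit_inner (G 0) (wave \<omega> \<theta>)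
      + (\<Sum>\<tau><n. (- \<omega>) ^ (Suc n - Suc \<tau>) * wave_boundary \<omega> (\<theta> - real (Suc \<tau>) * pi / 2) (G \<tau>)))"
    unfolding distrib_left sum_distrib_left minus_add_distrib sum_negf[symmetric]
  proof (intro arg_cong2[where f = "(+)"] sum.cong refl)
    fix \<tau> assume "\<tau> \<in> {..<n}"
    then have "Suc n - Suc \<tau> = Suc (n - Suc \<tau>)" by auto
    then show "\<omega> * ((- \<omega>) ^ (n - Suc \<tau>) * wave_boundary \<omega> (\<theta> - real (Suc \<tau>) * pi / 2) (G \<tau>))
      = - ((- \<omega>) ^ (Suc n - Suc \<tau>) * wave_boundary \<omega> (\<theta> - real (Suc \<tau>) * pi / 2) (G \<tau>))" by simp
  qed simp
  finally show ?case by simp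
qed simp

lemma integral_cos:
  fixes a b :: real
  assumes "a \<noteq> 0"
  shows "integral {0..1} (\<lambda>x. cos (a * x + b)) = (sin (a + b) - sin b) / a"
proof -
  have "((\<lambda>x. cos (a * x + b)) has_integral (sin (a * 1 + b) / a - sin (a * 0 + b) / a)) {0..1}"
  proof (rule fundamental_theorem_of_calculus[of 0 1 "\<lambda>x. sin (a * x + b) / a"])
    fix x :: real
    have "((\<lambda>x. sin (a * x + b) / a) has_real_derivative cos (a * x + b)) (at x within {0..1})"
      using assms by (auto intro!: derivative_eq_intros)
    then show "((\<lambda>x. sin (a * x + b) / a) has_vector_derivative cos (a * x + b)) (at x within {0..1})"
      by (simp add: has_real_derivative_iff_has_vector_derivative)
  qed simp
  then show ?thesis using assms by (simp add: integral_unique diff_divide_distrib)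
qed

lemma unit_inner_waves:
  "unit_inner (wave a b) (wave c d)
    = integral {0..1} (\<lambda>x. cos ((a - c) * x + (b - d))) + integral {0..1} (\<lambda>x. cos ((a + c) * x + (b + d)))"
proof -
  have "wave a b x * wave c d x = cos ((a - c) * x + (b - d)) + cos ((a + c) * x + (b + d))" for x
  proof -
    have "wave a b x * wave c d x = 2 * (cos (a * x + b) * cos (c * x + d))" by (simp add: wave_def)
    also have "\<dots> = cos (a * x + b - (c * x + d)) + cos (a * x + b + (c * x + d))"
      by (simp add: cos_times_cos)
    finally show ?thesis by (simp add: algebra_simps)
  qed
  then have "unit_inner (wave a b) (wave c d)
      = integral {0..1} (\<lambda>x. cos ((a - c) * x + (b - d)) + cos ((a + c) * x + (b + d)))"
    by (simp add: unit_inner_def)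
  also have "\<dots> = integral {0..1} (\<lambda>x. cos ((a - c) * x + (b - d))) + integral {0..1} (\<lambda>x. cos ((a + c) * x + (b + d)))"
    by (intro Henstock_Kurzweil_Integration.integral_add integrable_continuous_interval continuous_intros)
  finally show ?thesis .
qed

definition half_wave :: "real \<Rightarrow> nat \<Rightarrow> real \<Rightarrow> real" where
  "half_wave \<theta> k = wave (pi * real (Suc k)) \<theta>"

text \<open>The sum-frequency integrals contain the sines of \<theta> + \<theta> plus integer
  multiples of \<open>pi\<close>. They vanish because \<theta> is a multiple of a quarter turn, so
  the system consists, up to sign, of half-period cosines only or of half-period sines only.\<close>

lemma half_wave_orthonormal:
  assumes "\<theta> = of_int m * pi / 2"
  shows "unit_orthonormal (half_wave \<theta>) I"
  unfolding unit_orthonormal_def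
proof (intro conjI ballI)
  fix i j
  show "unit_continuous (half_wave \<theta> i)" unfolding half_wave_def by (rule wave_continuous)
  have sin_add: "sin (pi * of_int n + of_int m * pi) = 0" for n
    using sin_integer_2pi sin_int_times_real[of "n + m" pi] sin_zero_iff_int2[of "pi * of_int n + of_int m * pi"]
    by (metis distrib_right mult.commute of_int_add)
  have sinm: "sin (of_int m * pi) = 0" for m using sin_zero_iff_int2[of "of_int m * pi"] by blast
  have tt: "\<theta> + \<theta> = of_int m * pi" using assms by simp
  have plus: "integral {0..1} (\<lambda>x. cos ((pi * real (Suc i) + pi * real (Suc j)) * x + (\<theta> + \<theta>))) = 0"
  proof (subst integral_cos)
    have "pi * real (Suc i) + pi * real (Suc j) > 0" by (simp add: add_pos_pos)
    then show "pi * real (Suc i) + pi * real (Suc j) \<noteq> 0" by linarith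
    have "pi * real (Suc i) + pi * real (Suc j) + (\<theta> + \<theta>) = pi * of_int (int (Suc i + Suc j)) + of_int m * pi"
      unfolding tt by (simp add: algebra_simps)
    then have "sin (pi * real (Suc i) + pi * real (Suc j) + (\<theta> + \<theta>)) = 0" using sin_add by metis
    moreover have "sin (\<theta> + \<theta>) = 0" unfolding tt by (rule sinm)
    ultimately show "(sin (pi * real (Suc i) + pi * real (Suc j) + (\<theta> + \<theta>)) - sin (\<theta> + \<theta>))
        / (pi * real (Suc i) + pi * real (Suc j)) = 0" by simp
  qed
  have minus: "integral {0..1} (\<lambda>x. cos ((pi * real (Suc i) - pi * real (Suc j)) * x + (\<theta> - \<theta>))) = of_bool (i = j)"
  proof (cases "i = j")
    case False
    have eq: "pi * real (Suc i) - pi * real (Suc j) + (\<theta> - \<theta>) = of_int (int i - int j) * pi"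
      by (simp add: algebra_simps)
    have "sin (pi * real (Suc i) - pi * real (Suc j) + (\<theta> - \<theta>)) = 0" unfolding eq by (rule sinm)
    moreover have "pi * real (Suc i) - pi * real (Suc j) \<noteq> 0" using False by simp
    ultimately show ?thesis using False by (subst integral_cos) auto
  qed simp
  show "unit_inner (half_wave \<theta> i) (half_wave \<theta> j) = of_bool (i = j)"
    unfolding half_wave_def unit_inner_waves plus minus by simp
qed

text \<open>Even \<open>j\<close> give the cosines and odd \<open>j\<close> the sines of frequency \<open>2 * pi * Suc (j div 2)\<close>.\<close>

definition full_freq :: "nat \<Rightarrow> real" where
  "full_freq j = 2 * pi * real (Suc (j div 2))"

definition full_wave :: "real \<Rightarrow> nat \<Rightarrow> real \<Rightarrow> real" where
  "full_wave \<theta> j = wave (full_freq j) (\<theta> - real (j mod 2) * pi / 2)"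

lemma sin_add_2pi_int: "sin (2 * pi * of_int n + b) = sin (b :: real)"
  by (simp add: sin_add)

lemma cos_add_2pi_int: "cos (2 * pi * of_int n + b) = cos (b :: real)"
  by (simp add: cos_add)

lemma full_freq_pos: "full_freq j > 0"
  by (simp add: full_freq_def)

lemma full_freq_ge: "real (Suc j) \<le> full_freq j"
proof -
  have "Suc j \<le> 2 * Suc (j div 2)" by presburger
  then have "real (Suc j) \<le> 2 * 1 * real (Suc (j div 2))" by linarith
  also have "\<dots> \<le> 2 * pi * real (Suc (j div 2))"
    by (intro mult_right_mono mult_left_mono) (use pi_gt3 in auto)
  finally show ?thesis by (simp add: full_freq_def)
qed

text \<open>Every frequency completes whole periods on the interval, so any phase is allowed. Two
  waves of the same frequency differ by a quarter turn and are orthogonal for that reason.\<close>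

lemma full_wave_orthonormal: "unit_orthonormal (full_wave \<theta>) I"
  unfolding unit_orthonormal_def
proof (intro conjI ballI)
  fix i j
  show "unit_continuous (full_wave \<theta> i)" unfolding full_wave_def by (rule wave_continuous)
  let ?i = "\<theta> - real (i mod 2) * pi / 2" and ?j = "\<theta> - real (j mod 2) * pi / 2"
  have plus: "integral {0..1} (\<lambda>x. cos ((full_freq i + full_freq j) * x + (?i + ?j))) = 0"
  proof (subst integral_cos)
    show "full_freq i + full_freq j \<noteq> 0" using full_freq_pos[of i] full_freq_pos[of j] by linarith
    have "full_freq i + full_freq j = 2 * pi * of_int (int (Suc (i div 2)) + int (Suc (j div 2)))"
      by (simp add: full_freq_def algebra_simps)
    then have "sin (full_freq i + full_freq j + (?i + ?j)) = sin (?i + ?j)" using sin_add_2pi_int by metis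
    then show "(sin (full_freq i + full_freq j + (?i + ?j)) - sin (?i + ?j)) / (full_freq i + full_freq j) = 0"
      by simp
  qed
  have minus: "integral {0..1} (\<lambda>x. cos ((full_freq i - full_freq j) * x + (?i - ?j))) = of_bool (i = j)"
  proof (cases "i div 2 = j div 2")
    case True
    then have 0: "full_freq i - full_freq j = 0" by (simp add: full_freq_def)
    show ?thesis
    proof (cases "i = j")
      case False
      then have "i mod 2 \<noteq> j mod 2" using True by (metis div_mult_mod_eq)
      then have "?i - ?j = pi / 2 \<or> ?i - ?j = - (pi / 2)"
        by (cases "even i"; cases "even j") (auto simp: odd_iff_mod_2_eq_one even_iff_mod_2_eq_zero)
      then have "cos (?i - ?j) = 0" by (metis cos_minus cos_pi_half)
      then show ?thesis using False 0 by simp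
    qed simp
  next
    case False
    have eq: "full_freq i - full_freq j = 2 * pi * of_int (int (i div 2) - int (j div 2))"
      by (simp add: full_freq_def algebra_simps)
    then have "sin (full_freq i - full_freq j + (?i - ?j)) = sin (?i - ?j)" using sin_add_2pi_int by metis
    moreover have "full_freq i - full_freq j \<noteq> 0" using False unfolding eq by simp
    ultimately show ?thesis using False by (subst integral_cos) auto
  qed
  show "unit_inner (full_wave \<theta> i) (full_wave \<theta> j) = of_bool (i = j)"
    unfolding full_wave_def unit_inner_waves plus minus by simp
qed


section \<open>Completeness of the cosine and trigonometric systems\<close>

lemma unit_inner_pythagoras_le:
  assumes f: "unit_continuous f" and p: "unit_continuous p" and fp: "unit_inner f p = 0"
    and e: "\<And>x. x \<in> {0..1} \<Longrightarrow> \<bar>f x - p x\<bar> \<le> e"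
  shows "unit_inner f f \<le> e\<^sup>2"
proof -
  have d: "unit_continuous (\<lambda>x. f x - p x)" by (intro continuous_intros f p)
  \<comment> \<open>Orthogonality makes the squared distance of \<open>f\<close> and
    \<open>p\<close> the sum of their squared norms.\<close>
  have "unit_inner f f \<le> unit_inner f f + unit_inner p p" using unit_inner_nonneg[OF p] by simp
  also have "\<dots> = unit_inner f (\<lambda>x. f x - p x) - unit_inner p (\<lambda>x. f x - p x)"
    using unit_inner_diff[OF f p f] unit_inner_diff[OF f p p] fp by (simp add: unit_inner_commute)
  also have "\<dots> = unit_inner (\<lambda>x. f x - p x) (\<lambda>x. f x - p x)"
    using unit_inner_diff[OF f p d] by simp
  also have "\<dots> \<le> integral {0..1} (\<lambda>x::real. e\<^sup>2)"
    unfolding unit_inner_def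
  proof (rule integral_le[OF unit_integrable[OF d d]])
    fix x :: real assume "x \<in> {0..1}"
    from power_mono[OF e[OF this] abs_ge_zero, of 2]
    show "(f x - p x) * (f x - p x) \<le> e\<^sup>2" by (simp add: power2_eq_square)
  qed (rule integrable_continuous_interval, rule continuous_on_const)
  finally show ?thesis by simp
qed

text \<open>The substitution \<open>t = cos (pi * x)\<close> maps the unit interval homeomorphically
  onto that from -1 to 1 and turns polynomials in \<open>t\<close> into cosine polynomials.
  \<open>f\<close> is orthogonal to all of these, and by Weierstrass it is a uniform limit of
  them.\<close>

lemma half_cosine_complete:
  assumes f: "unit_continuous f"
    and ortho: "\<And>k. unit_inner f (\<lambda>x. cos (pi * real k * x)) = 0"
    and x: "x \<in> {0..1}"
  shows "f x = 0"
proof -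
  \<comment> \<open>The second cosine keeps the induction going: the product formula trades one
    factor \<open>cos (pi * x)\<close> for the neighbouring frequencies, and for
    \<open>k = 0\<close> that factor itself becomes the cosine of frequency
    \<open>pi\<close>.\<close>
  have power: "unit_inner f (\<lambda>x. cos (pi * x) ^ i * cos (pi * real k * x)) = 0" for i k
  proof (induction i arbitrary: k)
    case (Suc i)
    show ?case
    proof (cases k)
      case 0
      then show ?thesis using Suc.IH[of 1] by (simp add: mult.commute)
    next
      case (Suc l)
      let ?c = "\<lambda>k x. cos (pi * x) ^ i * cos (pi * real k * x)"
      have c: "unit_continuous (?c k)" for k by (intro continuous_intros)
      have "cos (pi * x) ^ Suc i * cos (pi * real k * x) = 1 / 2 * ?c (Suc k) x + 1 / 2 * ?c l x" for x
      proof -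
        have "cos (pi * x) * cos (pi * real k * x)
            = (cos (pi * real k * x - pi * x) + cos (pi * real k * x + pi * x)) / 2"
          by (subst mult.commute) (rule cos_times_cos)
        also have "pi * real k * x - pi * x = pi * real l * x" using Suc by (simp add: algebra_simps)
        also have "pi * real k * x + pi * x = pi * real (Suc k) * x" by (simp add: algebra_simps)
        finally have "cos (pi * x) * cos (pi * real k * x) = (cos (pi * real l * x) + cos (pi * real (Suc k) * x)) / 2" .
        then show ?thesis by (simp only: power_Suc mult.assoc mult.left_commute[of "cos (pi * x)"]) (simp add: field_simps)
      qed
      then have "unit_inner f (\<lambda>x. cos (pi * x) ^ Suc i * cos (pi * real k * x))
          = unit_inner (\<lambda>x. 1 / 2 * ?c (Suc k) x + 1 / 2 * ?c l x) f"
        by (simp only: unit_inner_commute)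
      also have "\<dots> = unit_inner (\<lambda>x. 1 / 2 * ?c (Suc k) x) f + unit_inner (\<lambda>x. 1 / 2 * ?c l x) f"
        by (intro unit_inner_add continuous_intros f)
      also have "\<dots> = 0"
        unfolding unit_inner_scale using Suc.IH[of "Suc k"] Suc.IH[of l] by (simp add: unit_inner_commute)
      finally show ?thesis .
    qed
  qed (use ortho in simp)
  have poly: "unit_inner f (\<lambda>x. p (cos (pi * x))) = 0" if p: "real_polynomial_function p" for p
  proof -
    obtain a n where "p = (\<lambda>x. \<Sum>i\<le>n. a i * x ^ i)" using p real_polynomial_function_iff_sum[of p] by blast
    then have "unit_inner f (\<lambda>x. p (cos (pi * x))) = (\<Sum>i\<le>n. a i * unit_inner (\<lambda>x. cos (pi * x) ^ i) f)"
      using unit_inner_sum[of "{..n}" "\<lambda>i x. cos (pi * x) ^ i" f a] f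
      by (simp add: unit_inner_commute[of f] continuous_intros)
    also have "\<dots> = 0" using power[of _ 0] by (simp add: unit_inner_commute[of _ f])
    finally show ?thesis .
  qed
  define h where "h t = f (arccos t / pi)" for t
  have h: "continuous_on {-1..1} h"
    unfolding h_def
  proof (rule continuous_on_compose2[OF f])
    show "continuous_on {-1..1} (\<lambda>t. arccos t / pi)" by (intro continuous_intros) auto
    show "(\<lambda>t. arccos t / pi) ` {-1..1} \<subseteq> {0..1}" using arccos_lbound arccos_ubound by auto
  qed
  have fh: "f x = h (cos (pi * x))" if "x \<in> {0..1}" for x
    using that by (simp add: h_def arccos_cos mult_left_le)
  have "unit_inner f f \<le> e\<^sup>2" if e: "e > 0" for e
  proof -
    obtain p where p: "real_polynomial_function p" "\<And>t. t \<in> {-1..1} \<Longrightarrow> \<bar>h t - p t\<bar> < e"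
      using Stone_Weierstrass_real_polynomial_function[of "{-1..1}" h e] h e by auto
    have pc: "continuous_on UNIV p"
      using p(1) continuous_real_polymonial_function continuous_at_imp_continuous_on by blast
    show ?thesis
    proof (rule unit_inner_pythagoras_le[OF f _ poly[OF p(1)]])
      show "unit_continuous (\<lambda>x. p (cos (pi * x)))"
        by (rule continuous_on_compose2[OF pc]) (auto intro!: continuous_intros)
      show "\<bar>f x - p (cos (pi * x))\<bar> \<le> e" if "x \<in> {0..1}" for x
        using p(2)[of "cos (pi * x)"] fh[OF that] by simp
    qed
  qed
  then have "unit_inner f f \<le> e" if "e > 0" for e
    using that by (metis real_sqrt_gt_0_iff real_sqrt_pow2 less_imp_le)
  then have "unit_inner f f \<le> 0" by (rule field_le_epsilon[of _ 0, simplified])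
  then have "unit_inner f f = 0" using unit_inner_nonneg[OF f] by simp
  then show ?thesis using unit_inner_eq_0_imp[OF f _ x] by simp
qed

text \<open>The arguments \<open>x / 2\<close> and \<open>1 - x / 2\<close> sweep the two halves of
  the interval, each at half speed. An antiderivative \<open>H\<close> of \<open>h\<close> handles
  both substitutions at once.\<close>

lemma integral_fold:
  assumes h: "unit_continuous h"
  shows "integral {0..1} (\<lambda>x. h (x / 2) + h (1 - x / 2)) = 2 * integral {0..1} h"
proof -
  define H where "H x = integral {0..x} h" for x
  have H: "(H has_real_derivative h x) (at x within {0..1})" if "x \<in> {0..1}" for x
    unfolding H_def by (rule integral_has_real_derivative[OF h that])
  have "((\<lambda>x. h (x / 2) + h (1 - x / 2)) has_integral
      ((2 * H (1 / 2) - 2 * H (1 - 1 / 2)) - (2 * H (0 / 2) - 2 * H (1 - 0 / 2)))) {0..1}"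
  proof (rule fundamental_theorem_of_calculus[of 0 1 "\<lambda>x. 2 * H (x / 2) - 2 * H (1 - x / 2)"])
    fix x :: real assume x: "x \<in> {0..1}"
    have 1: "((H \<circ> (\<lambda>x. x / 2)) has_real_derivative h (x / 2) * (1 / 2)) (at x within {0..1})"
    proof (rule DERIV_image_chain)
      show "(H has_real_derivative h (x / 2)) (at (x / 2) within (\<lambda>x. x / 2) ` {0..1})"
        by (rule DERIV_subset[OF H]) (use x in auto)
    qed (auto intro!: derivative_eq_intros)
    have 2: "((H \<circ> (\<lambda>x. 1 - x / 2)) has_real_derivative h (1 - x / 2) * (- 1 / 2)) (at x within {0..1})"
    proof (rule DERIV_image_chain)
      show "(H has_real_derivative h (1 - x / 2)) (at (1 - x / 2) within (\<lambda>x. 1 - x / 2) ` {0..1})"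
        by (rule DERIV_subset[OF H]) (use x in auto)
    qed (auto intro!: derivative_eq_intros)
    have "((\<lambda>x. 2 * H (x / 2) - 2 * H (1 - x / 2)) has_real_derivative
        2 * (h (x / 2) * (1 / 2)) - 2 * (h (1 - x / 2) * (- 1 / 2))) (at x within {0..1})"
      using 1 2 unfolding comp_def by (intro DERIV_diff DERIV_cmult)
    then show "((\<lambda>x. 2 * H (x / 2) - 2 * H (1 - x / 2)) has_vector_derivative h (x / 2) + h (1 - x / 2))
        (at x within {0..1})"
      by (simp add: has_real_derivative_iff_has_vector_derivative)
  qed simp
  then show ?thesis by (simp add: integral_unique H_def)
qed

text \<open>Folding the interval at its midpoint reduces the trigonometric system to the half-period
  cosines: the even part of \<open>r\<close> and \<open>sin\<close> times its odd part are orthogonal to all of them.\<close>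

lemma trigonometric_complete:
  assumes r: "unit_continuous r" and periodic: "r 0 = r 1"
    and cos: "\<And>k. unit_inner r (\<lambda>x. cos (2 * pi * real k * x)) = 0"
    and sin: "\<And>k. unit_inner r (\<lambda>x. sin (2 * pi * real k * x)) = 0"
    and x: "x \<in> {0..1}"
  shows "r x = 0"
proof -
  define e where "e y = r (y / 2) + r (1 - y / 2)" for y
  \<comment> \<open>The factor \<open>sin (pi * y)\<close> turns the odd part into something that
    can be paired with cosines: after unfolding, the products
    \<open>sin (2 * pi * u) * cos (2 * pi * k * u)\<close> are combinations of sines, to which
    \<open>r\<close> is orthogonal.\<close>
  define d where "d y = (r (y / 2) - r (1 - y / 2)) * sin (pi * y)" for y
  have r1: "unit_continuous (\<lambda>y. r (y / 2))" by (rule continuous_on_compose2[OF r]) (auto intro!: continuous_intros)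
  have r2: "unit_continuous (\<lambda>y. r (1 - y / 2))" by (rule continuous_on_compose2[OF r]) (auto intro!: continuous_intros)
  have cos_refl: "cos (2 * pi * real k * (1 - y / 2)) = cos (pi * real k * y)" for k y
    using cos_add_2pi_int[of "int k" "- (pi * real k * y)"] by (simp add: algebra_simps)
  have sin_refl: "sin (2 * pi * real k * (1 - y / 2)) = - sin (pi * real k * y)" for k y
    using sin_add_2pi_int[of "int k" "- (pi * real k * y)"] by (simp add: algebra_simps)
  have e0: "e y = 0" if y: "y \<in> {0..1}" for y
  proof (rule half_cosine_complete[OF _ _ y])
    show "unit_continuous e" unfolding e_def by (intro continuous_intros r1 r2)
    fix k
    let ?h = "\<lambda>u. r u * cos (2 * pi * real k * u)"
    have "unit_inner e (\<lambda>x. cos (pi * real k * x)) = integral {0..1} (\<lambda>x. ?h (x / 2) + ?h (1 - x / 2))"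
      unfolding unit_inner_def e_def cos_refl by (simp add: algebra_simps)
    also have "\<dots> = 2 * unit_inner r (\<lambda>x. cos (2 * pi * real k * x))"
      unfolding unit_inner_def by (rule integral_fold) (intro continuous_intros r)
    finally show "unit_inner e (\<lambda>x. cos (pi * real k * x)) = 0" using cos by simp
  qed
  have d0: "d y = 0" if y: "y \<in> {0..1}" for y
  proof (rule half_cosine_complete[OF _ _ y])
    show "unit_continuous d" unfolding d_def by (intro continuous_intros r1 r2)
    fix k
    let ?w = "\<lambda>u. sin (2 * pi * u) * cos (2 * pi * real k * u)"
    let ?h = "\<lambda>u. r u * ?w u"
    have "sin (2 * pi * (1 - y / 2)) = - sin (pi * y)" for y using sin_refl[of 1 y] by simp
    then have "unit_inner d (\<lambda>x. cos (pi * real k * x)) = integral {0..1} (\<lambda>x. ?h (x / 2) + ?h (1 - x / 2))"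
      unfolding unit_inner_def d_def cos_refl by (simp add: algebra_simps)
    also have "\<dots> = 2 * unit_inner r ?w"
      unfolding unit_inner_def by (rule integral_fold) (intro continuous_intros r)
    also have "unit_inner r ?w = 0"
    proof (cases k)
      case 0
      then show ?thesis using sin[of 1] by simp
    next
      case (Suc l)
      have "?w u = 1 / 2 * sin (2 * pi * real (Suc k) * u) + (- 1 / 2) * sin (2 * pi * real l * u)" for u
      proof -
        have "?w u = (sin (2 * pi * u + 2 * pi * real k * u) + sin (2 * pi * u - 2 * pi * real k * u)) / 2"
          by (rule sin_times_cos)
        also have "2 * pi * u + 2 * pi * real k * u = 2 * pi * real (Suc k) * u" by (simp add: algebra_simps)
        also have "2 * pi * u - 2 * pi * real k * u = - (2 * pi * real l * u)" using Suc by (simp add: algebra_simps)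
        finally show ?thesis by simp
      qed
      then have "unit_inner r ?w = unit_inner (\<lambda>u. 1 / 2 * sin (2 * pi * real (Suc k) * u) + (- 1 / 2) * sin (2 * pi * real l * u)) r"
        by (simp only: unit_inner_commute)
      also have "\<dots> = unit_inner (\<lambda>u. 1 / 2 * sin (2 * pi * real (Suc k) * u)) r + unit_inner (\<lambda>u. (- 1 / 2) * sin (2 * pi * real l * u)) r"
        by (intro unit_inner_add continuous_intros r)
      also have "\<dots> = 0"
        unfolding unit_inner_scale using sin[of "Suc k"] sin[of l] by (simp add: unit_inner_commute)
      finally show ?thesis .
    qed
    finally show "unit_inner d (\<lambda>x. cos (pi * real k * x)) = 0" by simp
  qed
  have half: "r (y / 2) = 0 \<and> r (1 - y / 2) = 0" if y: "y \<in> {0..1}" for y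
  \<comment> \<open>Here the sine vanishes and \<open>d\<close> gives no information. At
    \<open>y = 0\<close> the two points are the endpoints, where \<open>r\<close> agrees by
    periodicity; at \<open>y = 1\<close> both are the midpoint.\<close>
  proof (cases "y = 0 \<or> y = 1")
    case True
    then show ?thesis using e0[OF y] periodic by (auto simp: e_def)
  next
    case False
    then have "sin (pi * y) > 0" using y by (intro sin_gt_zero) auto
    then have "r (y / 2) = r (1 - y / 2)" using d0[OF y] by (simp add: d_def)
    then show ?thesis using e0[OF y] by (simp add: e_def)
  qed
  show ?thesis
  proof (cases "x \<le> 1 / 2")
    case True
    then show ?thesis using half[of "2 * x"] x by simp
  next
    case False
    then have "r (1 - 2 * (1 - x) / 2) = 0" using half[of "2 * (1 - x)"] x by simp
    moreover have "1 - 2 * (1 - x) / 2 = x" by (simp add: field_simps)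
    ultimately show ?thesis by (simp only:)
  qed
qed

section \<open>Expansions with absolutely summable coefficients\<close>

lemma orthonormal_series:
  assumes e: "unit_orthonormal e UNIV" and bound: "\<And>n x. x \<in> {0..1} \<Longrightarrow> \<bar>e n x\<bar> \<le> C"
    and a: "summable (\<lambda>n. \<bar>a n\<bar>)"
  obtains g where "\<And>x. x \<in> {0..1} \<Longrightarrow> (\<lambda>n. a n * e n x) sums g x" "unit_continuous g"
    "\<And>w. unit_continuous w \<Longrightarrow> (\<lambda>n. a n * unit_inner (e n) w) sums unit_inner g w"
proof
  let ?g = "\<lambda>x. \<Sum>n. a n * e n x"
  have ec: "unit_continuous (e n)" for n using e by (simp add: unit_orthonormal_def)
  have ab: "norm (a n * e n x) \<le> \<bar>a n\<bar> * C" if "x \<in> {0..1}" for n x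
    using bound[OF that] by (simp add: abs_mult mult_left_mono)
  have s: "summable (\<lambda>n. \<bar>a n\<bar> * C)" by (rule summable_mult2[OF a])
  have lim: "uniform_limit {0..1} (\<lambda>N x. \<Sum>n<N. a n * e n x) ?g sequentially"
    by (rule Weierstrass_m_test[OF ab s])
  have Fc: "unit_continuous (\<lambda>x. \<Sum>n<N. a n * e n x)" for N by (intro continuous_intros ec)
  show "(\<lambda>n. a n * e n x) sums ?g x" if "x \<in> {0..1}" for x
    by (intro summable_sums summable_comparison_test'[OF s, of 0] ab[OF that])
  show "unit_continuous ?g" by (rule unit_inner_uniform_limit(1)[OF lim Fc continuous_on_const])
  show "(\<lambda>n. a n * unit_inner (e n) w) sums unit_inner ?g w" if w: "unit_continuous w" for w
    using unit_inner_uniform_limit(2)[OF lim Fc w] unfolding sums_def by (simp add: unit_inner_sum[OF ec w])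
qed

lemma orthonormal_coeff_sums:
  assumes e: "unit_orthonormal e UNIV"
    and s: "\<And>w. unit_continuous w \<Longrightarrow> (\<lambda>n. a n * unit_inner (e n) w) sums unit_inner g w"
  shows "unit_inner g (e m) = a m"
proof -
  have "(\<lambda>n. a n * unit_inner (e n) (e m)) sums unit_inner g (e m)"
    using e by (intro s) (simp add: unit_orthonormal_def)
  moreover have "(\<lambda>n. a n * unit_inner (e n) (e m)) = (\<lambda>n. if n = m then a n else 0)"
    using e by (auto simp: unit_orthonormal_def)
  ultimately show ?thesis using sums_single[of m a] sums_unique2 by metis
qed

text \<open>The cosine series converges uniformly to a continuous \<open>g\<close> with the same
  coefficients as \<open>f\<close>. Thus \<open>f - g\<close>, less the mean of \<open>f\<close>, is
  continuous and orthogonal to every half-period cosine including the constant, and completeness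
  applies.\<close>

lemma half_wave_expansion:
  assumes f: "unit_continuous f" and a: "summable (\<lambda>k. \<bar>unit_inner f (half_wave 0 k)\<bar>)"
    and x: "x \<in> {0..1}"
  shows "(\<lambda>k. unit_inner f (half_wave 0 k) * half_wave 0 k x) sums (f x - integral {0..1} f)"
proof -
  have e: "unit_orthonormal (half_wave 0) UNIV" by (rule half_wave_orthonormal[of _ 0]) simp
  obtain g where g: "\<And>x. x \<in> {0..1} \<Longrightarrow> (\<lambda>k. unit_inner f (half_wave 0 k) * half_wave 0 k x) sums g x"
    and gc: "unit_continuous g"
    and gw: "\<And>w. unit_continuous w \<Longrightarrow> (\<lambda>k. unit_inner f (half_wave 0 k) * unit_inner (half_wave 0 k) w) sums unit_inner g w"
    by (rule orthonormal_series[OF e _ a, of "sqrt 2"]) (auto simp: half_wave_def abs_wave_le)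
  have int0: "unit_inner (half_wave 0 k) (\<lambda>x. 1) = 0" for k
    using integral_cos[of "pi * real (Suc k)" 0] sin_npi[of "Suc k"]
      Henstock_Kurzweil_Integration.integral_cmul[of "{0..1}" "sqrt 2" "\<lambda>x. cos (pi * real (Suc k) * x + 0)"]
    by (simp add: unit_inner_def half_wave_def wave_def mult.commute)
  have g1: "unit_inner g (\<lambda>x. 1) = 0"
    using gw[of "\<lambda>x. 1"] int0 sums_unique2[OF _ sums_zero] by simp
  define c where "c = integral {0..1} f"
  have cc: "unit_continuous (\<lambda>x. c)" by simp
  have fg: "unit_continuous (\<lambda>x. f x - g x)" by (intro continuous_intros f gc)
  have h: "unit_continuous (\<lambda>x. f x - g x - c)" by (intro continuous_intros f gc)
  have "f x - g x - c = 0"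
  proof (rule half_cosine_complete[OF h _ x])
    fix k
    show "unit_inner (\<lambda>x. f x - g x - c) (\<lambda>x. cos (pi * real k * x)) = 0"
    proof (cases k)
      case 0
      have "unit_inner (\<lambda>x. f x - g x - c) (\<lambda>x. 1) = unit_inner f (\<lambda>x. 1) - unit_inner g (\<lambda>x. 1) - unit_inner (\<lambda>x. c) (\<lambda>x. 1)"
        using unit_inner_diff[OF fg cc, of "\<lambda>x. 1"] unit_inner_diff[OF f gc, of "\<lambda>x. 1"] by simp
      also have "\<dots> = 0" unfolding g1 by (simp add: unit_inner_def c_def)
      finally show ?thesis using 0 by simp
    next
      case (Suc l)
      have w: "unit_continuous (half_wave 0 l)" unfolding half_wave_def by (rule wave_continuous)
      have eq: "(\<lambda>x. cos (pi * real k * x)) = (\<lambda>x. 1 / sqrt 2 * half_wave 0 l x)"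
        using Suc by (auto simp: half_wave_def wave_def)
      have "unit_inner (\<lambda>x. c) (half_wave 0 l) = c * unit_inner (half_wave 0 l) (\<lambda>x. 1)"
        using unit_inner_scale[of c "\<lambda>x. 1" "half_wave 0 l"] by (simp add: unit_inner_commute)
      then have "unit_inner (\<lambda>x. f x - g x - c) (half_wave 0 l) = 0"
        using unit_inner_diff[OF fg cc w] unit_inner_diff[OF f gc w] orthonormal_coeff_sums[OF e gw, of l] int0
        by simp
      then show ?thesis
        unfolding eq using unit_inner_scale[of "1 / sqrt 2" "half_wave 0 l" "\<lambda>x. f x - g x - c"]
        by (simp add: unit_inner_commute)
    qed
  qed
  then show ?thesis using g[OF x] by (simp add: c_def algebra_simps)
qed

text \<open>As for half waves, \<open>f\<close> minus the sum of its series is orthogonal to the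
  whole system. The sum of the series takes equal values at the endpoints, which is why
  \<open>f\<close> has to do so too; the vanishing mean accounts for the constant.\<close>

lemma full_wave_expansion:
  assumes f: "unit_continuous f" and periodic: "f 0 = f 1" and mean: "integral {0..1} f = 0"
    and a: "summable (\<lambda>j. \<bar>unit_inner f (full_wave 0 j)\<bar>)" and x: "x \<in> {0..1}"
  shows "(\<lambda>j. unit_inner f (full_wave 0 j) * full_wave 0 j x) sums f x"
proof -
  have e: "unit_orthonormal (full_wave 0) UNIV" by (rule full_wave_orthonormal)
  obtain g where g: "\<And>x. x \<in> {0..1} \<Longrightarrow> (\<lambda>j. unit_inner f (full_wave 0 j) * full_wave 0 j x) sums g x"
    and gc: "unit_continuous g"
    and gw: "\<And>w. unit_continuous w \<Longrightarrow> (\<lambda>j. unit_inner f (full_wave 0 j) * unit_inner (full_wave 0 j) w) sums unit_inner g w"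
    by (rule orthonormal_series[OF e _ a, of "sqrt 2"]) (auto simp: full_wave_def abs_wave_le)
  have int0: "unit_inner (full_wave 0 j) (\<lambda>x. 1) = 0" for j
  proof -
    have "full_freq j = 2 * pi * of_int (int (Suc (j div 2)))" by (simp add: full_freq_def)
    then have "sin (full_freq j + b) = sin b" for b using sin_add_2pi_int by metis
    then have "integral {0..1} (\<lambda>x. cos (full_freq j * x + b)) = 0" for b
      using integral_cos[of "full_freq j" b] full_freq_pos[of j] by simp
    from this[of "0 - real (j mod 2) * pi / 2"] show ?thesis
      using Henstock_Kurzweil_Integration.integral_cmul[of "{0..1}" "sqrt 2"
          "\<lambda>x. cos (full_freq j * x + (0 - real (j mod 2) * pi / 2))"]
      unfolding unit_inner_def full_wave_def wave_def by simp
  qed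
  have g1: "unit_inner g (\<lambda>x. 1) = 0"
    using gw[of "\<lambda>x. 1"] int0 sums_unique2[OF _ sums_zero] by simp
  have h: "unit_continuous (\<lambda>x. f x - g x)" by (intro continuous_intros f gc)
  have w: "unit_continuous (full_wave 0 j)" for j unfolding full_wave_def by (rule wave_continuous)
  have ortho: "unit_inner (\<lambda>x. f x - g x) (full_wave 0 j) = 0" for j
    using unit_inner_diff[OF f gc w] orthonormal_coeff_sums[OF e gw, of j] by simp
  have ortho': "unit_inner (\<lambda>x. f x - g x) (\<lambda>x. 1 / sqrt 2 * full_wave 0 j x) = 0" for j
    using unit_inner_scale[of "1 / sqrt 2" "full_wave 0 j" "\<lambda>x. f x - g x"] ortho[of j]
    by (simp add: unit_inner_commute)
  have cos_eq: "(\<lambda>x. cos (2 * pi * real (Suc k) * x)) = (\<lambda>x. 1 / sqrt 2 * full_wave 0 (2 * k) x)" for k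
    by (auto simp: full_wave_def wave_def full_freq_def)
  have sin_eq: "(\<lambda>x. sin (2 * pi * real (Suc k) * x)) = (\<lambda>x. 1 / sqrt 2 * full_wave 0 (2 * k + 1) x)" for k
  proof
    fix x
    show "sin (2 * pi * real (Suc k) * x) = 1 / sqrt 2 * full_wave 0 (2 * k + 1) x"
      using sin_cos_eq[of "2 * pi * real (Suc k) * x"] cos_minus[of "2 * pi * real (Suc k) * x - pi / 2"]
      by (simp add: full_wave_def wave_def full_freq_def)
  qed
  have per: "g 0 = g 1"
  proof (rule sums_unique2[OF g])
    have "full_wave 0 j 1 = full_wave 0 j 0" for j
    proof -
      have "full_freq j = 2 * pi * of_int (int (Suc (j div 2)))" by (simp add: full_freq_def)
      then have "cos (full_freq j + b) = cos b" for b using cos_add_2pi_int by metis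
      then show ?thesis by (simp only: full_wave_def wave_def mult_1_right mult_zero_right add_0)
    qed
    then show "(\<lambda>j. unit_inner f (full_wave 0 j) * full_wave 0 j 0) sums g 1" using g[of 1] by simp
  qed simp
  have "f x - g x = 0"
  proof (rule trigonometric_complete[OF h _ _ _ x])
    show "f 0 - g 0 = f 1 - g 1" using periodic per by simp
    fix k
    show "unit_inner (\<lambda>x. f x - g x) (\<lambda>x. sin (2 * pi * real k * x)) = 0"
      by (cases k) (simp_all only: sin_eq ortho', simp add: unit_inner_def)
    show "unit_inner (\<lambda>x. f x - g x) (\<lambda>x. cos (2 * pi * real k * x)) = 0"
    proof (cases k)
      case 0
      have "unit_inner f (\<lambda>x. 1) = 0" using mean by (simp add: unit_inner_def)
      then show ?thesis using 0 unit_inner_diff[OF f gc, of "\<lambda>x. 1"] g1 by simp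
    qed (simp only: cos_eq ortho')
  qed
  then show ?thesis using g[OF x] by simp
qed

section \<open>Bernoulli polynomials\<close>

text \<open>Division by the factorial removes all factors from differentiation: the derivative of
  \<open>bern (Suc n)\<close> is \<open>bern n\<close>.\<close>

definition bern :: "nat \<Rightarrow> real \<Rightarrow> real" where
  "bern n x = bernoulli_poly n x / fact n"

lemma bernoulli_poly_derivative:
  "(bernoulli_poly (Suc n) has_real_derivative real (Suc n) * bernoulli_poly n x) (at x within S)"
proof -
  have summand: "((\<lambda>x. real (Suc n choose k) * bernoulli_number k * x ^ (Suc n - k)) has_real_derivative
      real (Suc n) * (real (n choose k) * bernoulli_number k * x ^ (n - k))) (at x within S)" if k: "k \<le> n" for k
  proof -
    have "(Suc n - k) * (Suc n choose k) = Suc n * (n choose k)" using binomial_absorb_comp[of "Suc n" k] by simp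
    then have "real (Suc n - k) * real (Suc n choose k) = real (Suc n) * real (n choose k)"
      by (metis of_nat_mult)
    then have "(real (Suc n - k) * real (Suc n choose k)) * (bernoulli_number k * x ^ (n - k))
        = (real (Suc n) * real (n choose k)) * (bernoulli_number k * x ^ (n - k))" by (simp only:)
    then have "real (Suc n choose k) * bernoulli_number k * (real (Suc n - k) * x ^ (Suc n - k - 1))
        = real (Suc n) * (real (n choose k) * bernoulli_number k * x ^ (n - k))"
      by (simp add: mult_ac del: of_nat_Suc)
    moreover have "((\<lambda>x. c * x ^ m) has_real_derivative c * (real m * x ^ (m - 1))) (at x within S)" for c and m :: nat
      by (auto intro!: derivative_eq_intros)
    ultimately show ?thesis by metis
  qed
  have "((\<lambda>x. (\<Sum>k\<le>n. real (Suc n choose k) * bernoulli_number k * x ^ (Suc n - k)) + bernoulli_number (Suc n))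
      has_real_derivative (\<Sum>k\<le>n. real (Suc n) * (real (n choose k) * bernoulli_number k * x ^ (n - k))) + 0) (at x within S)"
    by (intro DERIV_add DERIV_sum DERIV_const summand) auto
  then show ?thesis by (simp add: bernoulli_poly_def[abs_def] sum_distrib_left)
qed

lemma bern_derivative: "(bern (Suc n) has_real_derivative bern n x) (at x within S)"
proof -
  have "((\<lambda>x. bernoulli_poly (Suc n) x / fact (Suc n)) has_real_derivative
      real (Suc n) * bernoulli_poly n x / fact (Suc n)) (at x within S)"
    by (rule DERIV_cdivide[OF bernoulli_poly_derivative])
  then show ?thesis by (simp add: bern_def[abs_def] field_simps del: of_nat_Suc)
qed

lemma bern_0 [simp]: "bern 0 x = 1"
  by (simp add: bern_def bernoulli_poly_def)

lemma bern_continuous: "continuous_on S (bern n)"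
proof (cases n)
  case 0
  then have "bern n = (\<lambda>x. 1)" by auto
  then show ?thesis by simp
next
  case (Suc m)
  then show ?thesis using DERIV_continuous_on[OF bern_derivative] by blast
qed

text \<open>The recursion that defines the Bernoulli numbers says exactly that all terms of the
  value at 1 except the last cancel, and that last term is the value at 0. In degree one there is a
  jump instead (\<open>bern_1_jump\<close>).\<close>

lemma bern_periodic: "bern (Suc (Suc n)) 1 = bern (Suc (Suc n)) 0"
proof -
  let ?b = bernoulli_number and ?m = "Suc (Suc n)"
  have "bernoulli_poly ?m 1 = (\<Sum>k\<le>n. real (?m choose k) * ?b k) + real ?m * ?b (Suc n) + ?b ?m"
    by (simp add: bernoulli_poly_def del: bernoulli_number.simps(2))
  also have "(\<Sum>k\<le>n. real (?m choose k) * ?b k) + real ?m * ?b (Suc n) = 0"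
    unfolding bernoulli_number.simps(2)[of n] by (simp add: field_simps del: of_nat_Suc)
  also have "0 + ?b ?m = (\<Sum>k\<le>?m. if k = ?m then ?b k else 0)" by (simp del: bernoulli_number.simps(2))
  also have "\<dots> = bernoulli_poly ?m 0"
    unfolding bernoulli_poly_def by (intro sum.cong refl) (auto simp del: bernoulli_number.simps(2))
  finally show ?thesis by (simp add: bern_def)
qed

lemma bern_1_jump: "bern (Suc 0) 1 - bern (Suc 0) 0 = 1"
  by (simp add: bern_def bernoulli_poly_def)

lemma unit_FTC:
  assumes "\<And>x. x \<in> {0..1} \<Longrightarrow> (g has_real_derivative g' x) (at x within {0..1})"
  shows "integral {0..1} g' = g 1 - g 0"
  using fundamental_theorem_of_calculus[of 0 1 g g'] assms
  by (simp add: has_real_derivative_iff_has_vector_derivative integral_unique)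

lemma integral_bern: "integral {0..1} (bern n) = of_bool (n = 0)"
proof (cases n)
  case 0
  then have "bern n = (\<lambda>x. 1)" by auto
  then show ?thesis using 0 by simp
next
  case (Suc m)
  then show ?thesis using unit_FTC[OF bern_derivative, of n] bern_periodic[of m] by simp
qed

lemma full_wave_periodic: "wave (full_freq j) \<theta> 1 = wave (full_freq j) \<theta> 0"
proof -
  have "full_freq j = 2 * pi * of_int (int (Suc (j div 2)))" by (simp add: full_freq_def)
  then have "cos (full_freq j + b) = cos b" for b using cos_add_2pi_int by metis
  then show ?thesis by (simp only: wave_def mult_1_right mult_zero_right add_0)
qed

lemma wave_boundary_periodic: "wave_boundary (full_freq j) \<theta> g = (g 1 - g 0) * wave (full_freq j) \<theta> 0"
  by (simp add: wave_boundary_def full_wave_periodic algebra_simps)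

lemma integral_full_wave: "unit_inner (full_wave \<theta> j) (\<lambda>x. 1) = 0"
proof -
  have "((\<lambda>x. wave (full_freq j) (\<theta> - real (j mod 2) * pi / 2 - pi / 2) x / full_freq j)
    has_real_derivative full_wave \<theta> j x) (at x within {0..1})" for x
    using DERIV_cdivide[OF wave_derivative[of "full_freq j" "\<theta> - real (j mod 2) * pi / 2 - pi / 2" x "{0..1}"], of "full_freq j"]
      full_freq_pos[of j] by (simp add: full_wave_def)
  from unit_FTC[OF this] show ?thesis
    by (simp add: unit_inner_def full_wave_periodic)
qed

lemma inverse_full_freq_summable: "summable (\<lambda>j. (1 / full_freq j)\<^sup>2)"
proof (rule summable_comparison_test')
  show "summable (\<lambda>j. inverse (real (Suc j) ^ 2))"
    using inverse_power_summable[of 2, where 'a = real] by (subst summable_Suc_iff) simp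
  show "norm ((1 / full_freq j)\<^sup>2) \<le> inverse (real (Suc j) ^ 2)" if "j \<ge> 0" for j
  proof -
    have "real (Suc j) ^ 2 \<le> full_freq j ^ 2" by (rule power_mono[OF full_freq_ge]) simp
    then show ?thesis by (simp add: power_divide inverse_eq_divide frac_le)
  qed
qed

lemma full_freq_ge_1: "1 \<le> full_freq j"
  using full_freq_ge[of j] by simp

lemma inverse_full_freq_power_le:
  assumes "n \<ge> 1"
  shows "1 / full_freq j ^ n \<le> 1 / full_freq j"
proof -
  have "full_freq j ^ 1 \<le> full_freq j ^ n" by (rule power_increasing[OF assms full_freq_ge_1])
  then show ?thesis using full_freq_pos[of j] by (simp add: frac_le)
qed

text \<open>Integrating by parts \<open>2 * \<alpha>\<close> times reduces the polynomial to the
  constant, which is orthogonal to the wave. All boundary terms vanish by periodicity except the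
  last, the unit jump of the polynomial of degree one; it contributes the value at 0 of a wave,
  which is nonzero for cosines only.\<close>

lemma unit_inner_bern_full_wave:
  assumes "\<alpha> \<ge> 1"
  shows "unit_inner (bern (2 * \<alpha>)) (full_wave 0 j)
    = (-1) ^ (\<alpha> + 1) * sqrt 2 * of_bool (even j) / full_freq j ^ (2 * \<alpha>)"
proof -
  let ?\<omega> = "full_freq j" and ?\<theta> = "0 - real (j mod 2) * pi / 2"
  have bd: "wave_boundary ?\<omega> \<theta> (bern (2 * \<alpha> - \<tau>)) = (if \<tau> = 2 * \<alpha> - 1 then wave ?\<omega> \<theta> 0 else 0)" if "\<tau> < 2 * \<alpha>" for \<tau> \<theta>
  proof (cases "\<tau> = 2 * \<alpha> - 1")
    case True
    then have "2 * \<alpha> - \<tau> = Suc 0" using assms by simp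
    then show ?thesis using True bern_1_jump by (simp add: wave_boundary_periodic)
  next
    case False
    then have "2 * \<alpha> - \<tau> = Suc (Suc (2 * \<alpha> - \<tau> - 2))" using that by simp
    then show ?thesis using False bern_periodic[of "2 * \<alpha> - \<tau> - 2"] by (simp add: wave_boundary_periodic)
  qed
  have "unit_inner (bern (2 * \<alpha> - 2 * \<alpha>)) (wave ?\<omega> (?\<theta> - real (2 * \<alpha>) * pi / 2))
      = (- ?\<omega>) ^ (2 * \<alpha>) * unit_inner (bern (2 * \<alpha> - 0)) (wave ?\<omega> ?\<theta>)
        + (\<Sum>\<tau><2 * \<alpha>. (- ?\<omega>) ^ (2 * \<alpha> - Suc \<tau>) * wave_boundary ?\<omega> (?\<theta> - real (Suc \<tau>) * pi / 2) (bern (2 * \<alpha> - \<tau>)))"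
  proof (rule unit_inner_wave_iterated_derivative[where G = "\<lambda>\<tau>. bern (2 * \<alpha> - \<tau>)"])
    fix \<tau> and x :: real assume "\<tau> < 2 * \<alpha>"
    then have "2 * \<alpha> - \<tau> = Suc (2 * \<alpha> - Suc \<tau>)" by simp
    then show "(bern (2 * \<alpha> - \<tau>) has_real_derivative bern (2 * \<alpha> - Suc \<tau>) x) (at x within {0..1})"
      using bern_derivative by simp
  qed (rule bern_continuous)
  also have "(\<Sum>\<tau><2 * \<alpha>. (- ?\<omega>) ^ (2 * \<alpha> - Suc \<tau>) * wave_boundary ?\<omega> (?\<theta> - real (Suc \<tau>) * pi / 2) (bern (2 * \<alpha> - \<tau>)))
      = (\<Sum>\<tau><2 * \<alpha>. if \<tau> = 2 * \<alpha> - 1 then wave ?\<omega> (?\<theta> - real (2 * \<alpha>) * pi / 2) 0 else 0)"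
    by (intro sum.cong refl) (use assms in \<open>auto simp: bd\<close>)
  also have "\<dots> = wave ?\<omega> (?\<theta> - real (2 * \<alpha>) * pi / 2) 0" using assms by simp
  also have "unit_inner (bern (2 * \<alpha> - 2 * \<alpha>)) (wave ?\<omega> (?\<theta> - real (2 * \<alpha>) * pi / 2)) = 0"
  proof -
    have "bern (2 * \<alpha> - 2 * \<alpha>) = (\<lambda>x. 1)" by auto
    moreover have "?\<theta> - real (2 * \<alpha>) * pi / 2 = - (real (2 * \<alpha>) * pi / 2) - real (j mod 2) * pi / 2" by simp
    ultimately show ?thesis using integral_full_wave[of "- (real (2 * \<alpha>) * pi / 2)" j]
      unfolding full_wave_def by (simp only: unit_inner_commute)
  qed
  finally have "?\<omega> ^ (2 * \<alpha>) * unit_inner (bern (2 * \<alpha>)) (full_wave 0 j) = - wave ?\<omega> (?\<theta> - real (2 * \<alpha>) * pi / 2) 0"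
    by (simp add: full_wave_def)
  also have "wave ?\<omega> (?\<theta> - real (2 * \<alpha>) * pi / 2) 0 = sqrt 2 * ((-1) ^ \<alpha> * of_bool (even j))"
  proof -
    have "cos (?\<theta> - real (2 * \<alpha>) * pi / 2) = cos (real (j mod 2) * pi / 2 + real \<alpha> * pi)"
    proof -
      have "?\<theta> - real (2 * \<alpha>) * pi / 2 = - (real (j mod 2) * pi / 2 + real \<alpha> * pi)" by simp
      then show ?thesis using cos_minus[of "real (j mod 2) * pi / 2 + real \<alpha> * pi"] by (simp only:)
    qed
    also have "\<dots> = cos (real (j mod 2) * pi / 2) * (-1) ^ \<alpha>" by (simp add: cos_add)
    also have "cos (real (j mod 2) * pi / 2) = of_bool (even j)" by (cases "even j") (auto simp: even_iff_mod_2_eq_zero odd_iff_mod_2_eq_one)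
    finally show ?thesis by (simp add: wave_def mult.commute)
  qed
  finally show ?thesis using full_freq_pos[of j] by (simp add: field_simps)
qed

text \<open>The Fourier series of the Bernoulli polynomial at \<open>\<bar>x - y\<bar>\<close>
  contains only cosines, which do not see the absolute value. The addition formula splits each into
  the product of two cosines plus the product of two sines of the same frequency.\<close>

lemma full_wave_kernel_sums:
  assumes \<alpha>: "\<alpha> \<ge> 1" and x: "x \<in> {0..1}" and y: "y \<in> {0..1}"
  shows "(\<lambda>j. full_wave 0 j x * full_wave 0 j y / full_freq j ^ (2 * \<alpha>)) sums
    ((-1) ^ (\<alpha> + 1) * bern (2 * \<alpha>) \<bar>x - y\<bar>)"
proof -
  let ?z = "\<bar>x - y\<bar>"
  have z: "?z \<in> {0..1}" using x y by auto
  have ab: "norm (full_wave 0 j u * full_wave 0 j v / full_freq j ^ (2 * \<alpha>)) \<le> 2 * (1 / full_freq j)\<^sup>2" for u v j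
  proof -
    have "\<bar>full_wave 0 j u * full_wave 0 j v\<bar> \<le> sqrt 2 * sqrt 2"
      unfolding full_wave_def abs_mult by (intro mult_mono abs_wave_le) auto
    moreover have "1 / full_freq j ^ (2 * \<alpha>) \<le> (1 / full_freq j)\<^sup>2"
    proof -
      have "full_freq j ^ 2 \<le> full_freq j ^ (2 * \<alpha>)" by (rule power_increasing[OF _ full_freq_ge_1]) (use \<alpha> in simp)
      then show ?thesis using full_freq_pos[of j] by (simp add: frac_le power_divide)
    qed
    ultimately have "\<bar>full_wave 0 j u * full_wave 0 j v\<bar> * (1 / full_freq j ^ (2 * \<alpha>)) \<le> 2 * (1 / full_freq j)\<^sup>2"
      by (intro mult_mono) (auto simp: full_freq_pos less_imp_le)
    then show ?thesis using full_freq_pos[of j] by (simp add: abs_mult)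
  qed
  have summ: "summable (\<lambda>j. full_wave 0 j u * full_wave 0 j v / full_freq j ^ (2 * \<alpha>))" for u v
    by (rule summable_comparison_test'[OF summable_mult[OF inverse_full_freq_summable] ab])
  have coeff: "unit_inner (bern (2 * \<alpha>)) (full_wave 0 j) * full_wave 0 j ?z
      = (-1) ^ (\<alpha> + 1) * (if even j then sqrt 2 * full_wave 0 j ?z / full_freq j ^ (2 * \<alpha>) else 0)" for j
    by (simp add: unit_inner_bern_full_wave[OF \<alpha>])
  have "(\<lambda>j. unit_inner (bern (2 * \<alpha>)) (full_wave 0 j) * full_wave 0 j ?z) sums bern (2 * \<alpha>) ?z"
  proof (rule full_wave_expansion[OF bern_continuous _ _ _ z])
    have e: "2 * \<alpha> = Suc (Suc (2 * \<alpha> - 2))" using \<alpha> by simp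
    show "bern (2 * \<alpha>) 0 = bern (2 * \<alpha>) 1" using bern_periodic[of "2 * \<alpha> - 2"] e by metis
    show "integral {0..1} (bern (2 * \<alpha>)) = 0" using integral_bern[of "2 * \<alpha>"] \<alpha> by simp
    show "summable (\<lambda>j. \<bar>unit_inner (bern (2 * \<alpha>)) (full_wave 0 j)\<bar>)"
    proof (rule summable_comparison_test'[OF summable_mult[OF inverse_full_freq_summable, of "sqrt 2"]])
      fix j :: nat
      have "1 / full_freq j ^ (2 * \<alpha>) \<le> (1 / full_freq j)\<^sup>2"
      proof -
        have "full_freq j ^ 2 \<le> full_freq j ^ (2 * \<alpha>)" by (rule power_increasing[OF _ full_freq_ge_1]) (use \<alpha> in simp)
        then show ?thesis using full_freq_pos[of j] by (simp add: frac_le power_divide)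
      qed
      then have "sqrt 2 * (1 / full_freq j ^ (2 * \<alpha>)) \<le> sqrt 2 * (1 / full_freq j)\<^sup>2"
        by (rule mult_left_mono) simp
      then show "norm \<bar>unit_inner (bern (2 * \<alpha>)) (full_wave 0 j)\<bar> \<le> sqrt 2 * (1 / full_freq j)\<^sup>2"
        unfolding unit_inner_bern_full_wave[OF \<alpha>] using full_freq_pos[of j]
        by (auto simp: abs_mult power_abs)
    qed
  qed
  then have "(\<lambda>j. (-1) ^ (\<alpha> + 1) * (unit_inner (bern (2 * \<alpha>)) (full_wave 0 j) * full_wave 0 j ?z)) sums ((-1) ^ (\<alpha> + 1) * bern (2 * \<alpha>) ?z)"
    by (rule sums_mult)
  then have ev: "(\<lambda>j. if even j then sqrt 2 * full_wave 0 j ?z / full_freq j ^ (2 * \<alpha>) else 0) sums ((-1) ^ (\<alpha> + 1) * bern (2 * \<alpha>) ?z)"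
    unfolding coeff by (simp add: mult.assoc[symmetric] power_mult_distrib[symmetric])
  have pair: "(\<Sum>j\<in>{n * 2..<n * 2 + 2}. f j) = f (2 * n) + f (2 * n + 1)" for f :: "nat \<Rightarrow> real" and n
    by (simp add: numeral_2_eq_2 mult.commute)
  \<comment> \<open>Indices \<open>2 * n\<close> and \<open>2 * n + 1\<close> share a frequency.
    Both series are grouped in these pairs, and then they agree term by term.\<close>
  from sums_group[OF ev, of 2]
  have 1: "(\<lambda>n. sqrt 2 * full_wave 0 (2 * n) ?z / full_freq (2 * n) ^ (2 * \<alpha>)) sums ((-1) ^ (\<alpha> + 1) * bern (2 * \<alpha>) ?z)"
    unfolding pair by simp
  have 2: "(\<lambda>n. full_wave 0 (2 * n) x * full_wave 0 (2 * n) y / full_freq (2 * n) ^ (2 * \<alpha>)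
      + full_wave 0 (2 * n + 1) x * full_wave 0 (2 * n + 1) y / full_freq (2 * n + 1) ^ (2 * \<alpha>))
    sums (\<Sum>j. full_wave 0 j x * full_wave 0 j y / full_freq j ^ (2 * \<alpha>))"
    using sums_group[OF summable_sums[OF summ], of 2 x y] unfolding pair by simp
  have "sqrt 2 * full_wave 0 (2 * n) ?z / full_freq (2 * n) ^ (2 * \<alpha>) =
      full_wave 0 (2 * n) x * full_wave 0 (2 * n) y / full_freq (2 * n) ^ (2 * \<alpha>)
      + full_wave 0 (2 * n + 1) x * full_wave 0 (2 * n + 1) y / full_freq (2 * n + 1) ^ (2 * \<alpha>)" for n
  proof -
    let ?w = "full_freq (2 * n)"
    have eq: "full_freq (2 * n + 1) = ?w" by (simp add: full_freq_def)
    have sin: "full_wave 0 (2 * n + 1) u = sqrt 2 * sin (?w * u)" for u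
      using sin_cos_eq[of "?w * u"] cos_minus[of "?w * u - pi / 2"] eq by (simp add: full_wave_def wave_def)
    have cos: "full_wave 0 (2 * n) u = sqrt 2 * cos (?w * u)" for u by (simp add: full_wave_def wave_def)
    have "cos (?w * ?z) = cos (?w * x - ?w * y)"
      using cos_minus[of "?w * x - ?w * y"] by (cases "x \<le> y") (auto simp: algebra_simps abs_if)
    then have "cos (?w * ?z) = cos (?w * x) * cos (?w * y) + sin (?w * x) * sin (?w * y)" by (simp add: cos_diff)
    moreover have "sqrt 2 * u * (sqrt 2 * v) = 2 * (u * v)" for u v
    proof -
      have "sqrt 2 * u * (sqrt 2 * v) = sqrt 2 * sqrt 2 * (u * v)" by (simp only: mult_ac)
      then show ?thesis by simp
    qed
    moreover have "sqrt 2 * (sqrt 2 * u) = 2 * u" for u by (simp flip: mult.assoc)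
    ultimately show ?thesis
      unfolding sin cos eq by (simp only: add_divide_distrib distrib_left)
  qed
  then have "(\<Sum>j. full_wave 0 j x * full_wave 0 j y / full_freq j ^ (2 * \<alpha>)) = (-1) ^ (\<alpha> + 1) * bern (2 * \<alpha>) ?z"
    using 1 sums_unique2[OF 2] by simp
  then show ?thesis using summable_sums[OF summ, of x y] by (simp only:)
qed

section \<open>Termwise differentiation\<close>

text \<open>Below order \<alpha> the differentiated features have the common square-summable bound
  \<beta>, so with square-summable coefficients the differentiated series converge absolutely and
  uniformly. This justifies differentiating term by term.\<close>

lemma unit_deriv_series:
  assumes deriv: "\<And>n \<tau> x. x \<in> {0..1} \<Longrightarrow> (\<phi> n \<tau> has_real_derivative \<phi> n (Suc \<tau>) x) (at x within {0..1})"
    and bound: "\<And>n \<tau> x. \<tau> < \<alpha> \<Longrightarrow> x \<in> {0..1} \<Longrightarrow> \<bar>\<phi> n \<tau> x\<bar> \<le> \<beta> n"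
    and \<beta>: "summable (\<lambda>n. (\<beta> n)\<^sup>2)" and a: "summable (\<lambda>n. (a n)\<^sup>2)"
    and f: "\<And>x. x \<in> {0..1} \<Longrightarrow> (\<lambda>n. a n * \<phi> n 0 x) sums f x"
    and \<tau>: "\<tau> < \<alpha>"
  shows "uniform_limit {0..1} (\<lambda>N x. \<Sum>n<N. a n * \<phi> n \<tau> x) (unit_deriv \<tau> f) sequentially"
    and "x \<in> {0..1} \<Longrightarrow> (\<lambda>n. a n * \<phi> n \<tau> x) sums unit_deriv \<tau> f x"
proof -
  have lim: "uniform_limit {0..1} (\<lambda>N x. \<Sum>n<N. a n * \<phi> n \<tau> x) (\<lambda>x. \<Sum>n. a n * \<phi> n \<tau> x) sequentially"
    and summ: "x \<in> {0..1} \<Longrightarrow> summable (\<lambda>n. a n * \<phi> n \<tau> x)" if \<tau>: "\<tau> < \<alpha>" for \<tau> x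
  proof -
    have le: "norm (a n * \<phi> n \<tau> x) \<le> \<bar>a n * \<beta> n\<bar>" if "x \<in> {0..1}" for n x
      unfolding real_norm_def abs_mult by (rule mult_left_mono) (use bound[OF \<tau> that, of n] in auto)
    note s = summable_mult_of_squares[OF a \<beta>]
    show "uniform_limit {0..1} (\<lambda>N x. \<Sum>n<N. a n * \<phi> n \<tau> x) (\<lambda>x. \<Sum>n. a n * \<phi> n \<tau> x) sequentially"
      by (rule Weierstrass_m_test[OF le s])
    show "summable (\<lambda>n. a n * \<phi> n \<tau> x)" if "x \<in> {0..1}"
      by (rule summable_comparison_test'[OF s le[OF that]])
  qed
  have eq: "unit_deriv \<tau> f x = (\<Sum>n. a n * \<phi> n \<tau> x)" if "\<tau> < \<alpha>" "x \<in> {0..1}" for \<tau> x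
    using that
  proof (induction \<tau> arbitrary: x)
    case 0
    then show ?case using sums_unique[OF f] by (simp add: unit_deriv_def)
  next
    case (Suc \<tau>)
    then have \<tau>: "\<tau> < \<alpha>" by simp
    let ?g' = "\<lambda>x. \<Sum>n. a n * \<phi> n (Suc \<tau>) x"
    obtain g where g: "\<And>x. x \<in> {0..1} \<Longrightarrow> (\<lambda>n. a n * \<phi> n \<tau> x) sums g x"
      "\<And>x. x \<in> {0..1} \<Longrightarrow> (g has_real_derivative ?g' x) (at x within {0..1})"
    proof -
      have "\<exists>g. \<forall>x\<in>{0..1}. (\<lambda>n. a n * \<phi> n \<tau> x) sums g x \<and> (g has_real_derivative ?g' x) (at x within {0..1})"
        by (rule has_field_derivative_series[of "{0..1}" "\<lambda>n x. a n * \<phi> n \<tau> x" "\<lambda>n x. a n * \<phi> n (Suc \<tau>) x" ?g' 0])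
          (use deriv summ[OF \<tau>] lim[OF Suc.prems(1)] in \<open>auto intro!: DERIV_cmult\<close>)
      with that show ?thesis by blast
    qed
    have "(unit_deriv \<tau> f has_real_derivative ?g' x) (at x within {0..1})"
    proof (rule has_field_derivative_transform_within[OF g(2)[OF Suc.prems(2)] zero_less_one Suc.prems(2)])
      fix y :: real assume y: "y \<in> {0..1}"
      show "g y = unit_deriv \<tau> f y" using Suc.IH[OF \<tau> y] sums_unique[OF g(1)[OF y]] by simp
    qed
    then have "vector_derivative (unit_deriv \<tau> f) (at x within {0..1}) = ?g' x"
      by (intro vector_derivative_within_closed_interval[OF zero_less_one Suc.prems(2)])
        (simp add: has_real_derivative_iff_has_vector_derivative)
    then show ?case by (simp add: unit_deriv_def)
  qed
  show "uniform_limit {0..1} (\<lambda>N x. \<Sum>n<N. a n * \<phi> n \<tau> x) (unit_deriv \<tau> f) sequentially"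
  proof -
    have "uniform_limit {0..1} (\<lambda>N x. \<Sum>n<N. a n * \<phi> n \<tau> x) (\<lambda>x. \<Sum>n. a n * \<phi> n \<tau> x) sequentially
      \<longleftrightarrow> uniform_limit {0..1} (\<lambda>N x. \<Sum>n<N. a n * \<phi> n \<tau> x) (unit_deriv \<tau> f) sequentially"
      by (rule uniform_limit_cong') (use eq[OF \<tau>] in auto)
    then show ?thesis using lim[OF \<tau>] by (rule iffD1)
  qed
  show "(\<lambda>n. a n * \<phi> n \<tau> x) sums unit_deriv \<tau> f x" if x: "x \<in> {0..1}"
    unfolding eq[OF \<tau> x] by (rule summable_sums[OF summ[OF \<tau> x]])
qed

section \<open>Features of the Sobolev and cosine kernels\<close>

text \<open>The argument \<open>\<tau>\<close> is the order of differentiation in \<open>x\<close>.\<close>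

definition sob_feature :: "nat \<Rightarrow> nat \<Rightarrow> nat \<Rightarrow> real \<Rightarrow> real" where
  "sob_feature \<alpha> n \<tau> x = (if n \<le> \<alpha> then if \<tau> \<le> n then bern (n - \<tau>) x else 0
    else full_freq (n - Suc \<alpha>) ^ \<tau> / full_freq (n - Suc \<alpha>) ^ \<alpha> * full_wave (real \<tau> * pi / 2) (n - Suc \<alpha>) x)"

text \<open>The weight turns the sum of products of features into the cosine kernel. Every
  derivative contributes \<open>pi * (k + 1)\<close>, so at order \<alpha> the weight cancels and
  \<open>pi ^ \<alpha>\<close> times an orthonormal system remains.\<close>

definition cos_feature :: "nat \<Rightarrow> nat \<Rightarrow> nat \<Rightarrow> real \<Rightarrow> real" where
  "cos_feature \<alpha> k \<tau> x = (pi * real (Suc k)) ^ \<tau> / real (Suc k) ^ \<alpha> * half_wave (real \<tau> * pi / 2) k x"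

lemma scaled_wave_derivative:
  "((\<lambda>x. \<omega> ^ \<tau> / c * wave \<omega> (real \<tau> * pi / 2 - d) x) has_real_derivative
    \<omega> ^ Suc \<tau> / c * wave \<omega> (real (Suc \<tau>) * pi / 2 - d) x) (at x within S)"
proof -
  have eq: "real \<tau> * pi / 2 - d + pi / 2 = real (Suc \<tau>) * pi / 2 - d" by (simp add: field_simps)
  show ?thesis
    using DERIV_cmult[OF wave_derivative[of \<omega> "real \<tau> * pi / 2 - d" x S], of "\<omega> ^ \<tau> / c"]
    unfolding eq by (simp add: mult_ac)
qed

lemma sob_feature_derivative:
  "(sob_feature \<alpha> n \<tau> has_real_derivative sob_feature \<alpha> n (Suc \<tau>) x) (at x within S)"
proof (cases "n \<le> \<alpha>")
  case n: True
  show ?thesis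
  proof (cases "\<tau> < n")
    case True
    then have s: "n - \<tau> = Suc (n - Suc \<tau>)" by simp
    have "sob_feature \<alpha> n \<tau> = bern (Suc (n - Suc \<tau>))" using n True s by (auto simp: sob_feature_def)
    then show ?thesis using bern_derivative[of "n - Suc \<tau>" x S] n True by (simp add: sob_feature_def)
  next
    case False
    then have "sob_feature \<alpha> n \<tau> = (\<lambda>x. of_bool (\<tau> = n))" using n by (auto simp: sob_feature_def)
    then show ?thesis using False n by (simp add: sob_feature_def)
  qed
next
  case False
  then have eq: "sob_feature \<alpha> n \<tau> = (\<lambda>x. full_freq (n - Suc \<alpha>) ^ \<tau> / full_freq (n - Suc \<alpha>) ^ \<alpha> *
      wave (full_freq (n - Suc \<alpha>)) (real \<tau> * pi / 2 - real ((n - Suc \<alpha>) mod 2) * pi / 2) x)" for \<tau>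
    by (auto simp: sob_feature_def full_wave_def)
  show ?thesis unfolding eq by (rule scaled_wave_derivative)
qed

lemma cos_feature_derivative:
  "(cos_feature \<alpha> k \<tau> has_real_derivative cos_feature \<alpha> k (Suc \<tau>) x) (at x within S)"
  using scaled_wave_derivative[of "pi * real (Suc k)" \<tau> "real (Suc k) ^ \<alpha>" 0 x S]
  by (simp only: cos_feature_def[abs_def] half_wave_def diff_zero)

lemma sob_feature_continuous: "continuous_on S (sob_feature \<alpha> n \<tau>)"
  by (rule DERIV_continuous_on[OF sob_feature_derivative])

lemma cos_feature_continuous: "continuous_on S (cos_feature \<alpha> n \<tau>)"
  by (rule DERIV_continuous_on[OF cos_feature_derivative])

lemma inverse_Suc_square_summable: "summable (\<lambda>k. (1 / real (Suc k))\<^sup>2)"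
proof -
  have "summable (\<lambda>k. inverse (real (Suc k) ^ 2))"
    using inverse_power_summable[of 2, where 'a = real] by (subst summable_Suc_iff) simp
  then show ?thesis by (simp add: power_divide inverse_eq_divide)
qed

lemma power_div_power_le:
  fixes w :: real
  assumes "1 \<le> w" "\<tau> < \<alpha>"
  shows "w ^ \<tau> / w ^ \<alpha> \<le> 1 / w"
proof -
  have "w ^ Suc \<tau> \<le> w ^ \<alpha>" by (rule power_increasing) (use assms in auto)
  then show ?thesis using assms(1) by (simp add: field_simps)
qed

lemma sob_feature_bound:
  obtains \<beta> where "summable (\<lambda>n. (\<beta> n :: real)\<^sup>2)"
    "\<And>n \<tau> x. \<tau> < \<alpha> \<Longrightarrow> x \<in> {0..1} \<Longrightarrow> \<bar>sob_feature \<alpha> n \<tau> x\<bar> \<le> \<beta> n"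
proof -
  have "\<exists>M. \<forall>x\<in>{0..1}. \<bar>bern m x\<bar> \<le> M" for m
  proof -
    have "bounded (bern m ` {0..1})"
      by (intro compact_imp_bounded compact_continuous_image bern_continuous) auto
    then show ?thesis by (simp add: bounded_iff)
  qed
  then obtain M where M: "\<And>m x. x \<in> {0..1} \<Longrightarrow> \<bar>bern m x\<bar> \<le> M m" by metis
  have M0: "0 \<le> M m" for m using M[of 0 m] abs_ge_zero[of "bern m 0"] by simp
  \<comment> \<open>The bound has to serve all orders at once: the sum of the maxima covers every
    polynomial \<open>bern (n - \<tau>)\<close>, and a wave feature of order below \<alpha> still
    has one inverse power of the frequency left.\<close>
  define \<beta> where "\<beta> n = (if n \<le> \<alpha> then \<Sum>m\<le>\<alpha>. M m else sqrt 2 * (1 / full_freq (n - Suc \<alpha>)))" for n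
  have "(\<beta> (n + Suc \<alpha>))\<^sup>2 = 2 * (1 / full_freq n)\<^sup>2" for n
    by (simp add: \<beta>_def power_mult_distrib power_divide)
  then have "summable (\<lambda>n. (\<beta> (n + Suc \<alpha>))\<^sup>2)"
    using summable_mult[OF inverse_full_freq_summable, of 2] by simp
  then have "summable (\<lambda>n. (\<beta> n)\<^sup>2)" using summable_iff_shift[of "\<lambda>n. (\<beta> n)\<^sup>2" "Suc \<alpha>"] by blast
  moreover have "\<bar>sob_feature \<alpha> n \<tau> x\<bar> \<le> \<beta> n" if \<tau>: "\<tau> < \<alpha>" and x: "x \<in> {0..1}" for n \<tau> x
  proof (cases "n \<le> \<alpha>")
    case True
    have "M (n - \<tau>) \<le> (\<Sum>m\<le>\<alpha>. M m)" by (rule member_le_sum) (use True M0 in auto)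
    then show ?thesis using True M[OF x, of "n - \<tau>"] sum_nonneg[of "{..\<alpha>}" M] M0
      by (auto simp: sob_feature_def \<beta>_def)
  next
    case False
    let ?w = "full_freq (n - Suc \<alpha>)"
    have "\<bar>sob_feature \<alpha> n \<tau> x\<bar> = ?w ^ \<tau> / ?w ^ \<alpha> * \<bar>full_wave (real \<tau> * pi / 2) (n - Suc \<alpha>) x\<bar>"
      using False full_freq_pos[of "n - Suc \<alpha>"] by (simp add: sob_feature_def abs_mult)
    also have "\<dots> \<le> 1 / ?w * sqrt 2"
      by (intro mult_mono power_div_power_le[OF full_freq_ge_1 \<tau>])
        (auto simp: full_wave_def abs_wave_le full_freq_pos less_imp_le)
    finally show ?thesis using False by (simp add: \<beta>_def)
  qed
  ultimately show ?thesis by (rule that)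
qed

lemma cos_feature_bound:
  obtains \<beta> where "summable (\<lambda>n. (\<beta> n :: real)\<^sup>2)"
    "\<And>n \<tau> x. \<tau> < \<alpha> \<Longrightarrow> x \<in> {0..1} \<Longrightarrow> \<bar>cos_feature \<alpha> n \<tau> x\<bar> \<le> \<beta> n"
proof
  show "summable (\<lambda>k. (sqrt 2 * pi ^ \<alpha> * (1 / real (Suc k)))\<^sup>2)"
    unfolding power_mult_distrib[of _ "1 / real (Suc _)"] by (rule summable_mult[OF inverse_Suc_square_summable])
  show "\<bar>cos_feature \<alpha> k \<tau> x\<bar> \<le> sqrt 2 * pi ^ \<alpha> * (1 / real (Suc k))" if \<tau>: "\<tau> < \<alpha>" for k \<tau> x
  proof -
    have "\<bar>cos_feature \<alpha> k \<tau> x\<bar> = pi ^ \<tau> * (real (Suc k) ^ \<tau> / real (Suc k) ^ \<alpha>) * \<bar>half_wave (real \<tau> * pi / 2) k x\<bar>"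
      by (simp add: cos_feature_def abs_mult power_mult_distrib del: of_nat_Suc)
    also have "\<dots> \<le> pi ^ \<alpha> * (1 / real (Suc k)) * sqrt 2"
      by (intro mult_mono power_div_power_le[OF _ \<tau>] power_increasing)
        (use pi_ge_two \<tau> in \<open>auto simp: half_wave_def abs_wave_le\<close>)
    finally show ?thesis by (simp add: mult_ac)
  qed
qed

text \<open>The features up to index \<alpha> give the finite Bernoulli sum, feature 0 being its
  leading 1. The features from index \<alpha> + 1 on give the Fourier series of the last term of the
  kernel.\<close>

lemma sob_kernel_sums:
  assumes \<alpha>: "\<alpha> \<ge> 1" and x: "x \<in> {0..1}" and y: "y \<in> {0..1}"
  shows "(\<lambda>n. sob_feature \<alpha> n 0 x * sob_feature \<alpha> n 0 y) sums sob_kernel \<alpha> x y"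
proof -
  let ?f = "\<lambda>n. sob_feature \<alpha> n 0 x * sob_feature \<alpha> n 0 y"
  have "?f (j + Suc \<alpha>) = full_wave 0 j x * full_wave 0 j y / full_freq j ^ (2 * \<alpha>)" for j
    by (simp add: sob_feature_def mult_2 power_add)
  then have "(\<lambda>j. ?f (j + Suc \<alpha>)) sums ((-1) ^ (\<alpha> + 1) * bern (2 * \<alpha>) \<bar>x - y\<bar>)"
    using full_wave_kernel_sums[OF assms] by simp
  then have "?f sums ((-1) ^ (\<alpha> + 1) * bern (2 * \<alpha>) \<bar>x - y\<bar> + (\<Sum>n<Suc \<alpha>. ?f n))"
    by (rule iffD1[OF sums_iff_shift])
  moreover have "(\<Sum>n<Suc \<alpha>. ?f n) = 1 + (\<Sum>\<tau>=1..\<alpha>. bernoulli_poly \<tau> x * bernoulli_poly \<tau> y / (fact \<tau>)\<^sup>2)"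
  proof -
    have "(\<Sum>n<Suc \<alpha>. ?f n) = (\<Sum>n\<le>\<alpha>. bern n x * bern n y)"
      unfolding lessThan_Suc_atMost by (intro sum.cong) (auto simp: sob_feature_def)
    also have "\<dots> = 1 + (\<Sum>n<\<alpha>. bern (Suc n) x * bern (Suc n) y)" by (simp add: sum.atMost_shift)
    also have "(\<Sum>n<\<alpha>. bern (Suc n) x * bern (Suc n) y) = (\<Sum>\<tau>=1..\<alpha>. bern \<tau> x * bern \<tau> y)"
      using sum.atLeast1_atMost_eq[of "\<lambda>\<tau>. bern \<tau> x * bern \<tau> y" \<alpha>] by simp
    finally show ?thesis by (simp add: bern_def power2_eq_square)
  qed
  ultimately show ?thesis by (simp add: sob_kernel_def bern_def algebra_simps)
qed

definition cos_kernel1 :: "nat \<Rightarrow> real \<Rightarrow> real \<Rightarrow> real" where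
  "cos_kernel1 \<alpha> x y = (\<Sum>k. 2 * cos (pi * real (Suc k) * x) * cos (pi * real (Suc k) * y) / real (Suc k) ^ (2 * \<alpha>))"

lemma cos_kernel1_sums:
  assumes "\<alpha> \<ge> 1"
  shows "(\<lambda>k. cos_feature \<alpha> k 0 x * cos_feature \<alpha> k 0 y) sums cos_kernel1 \<alpha> x y"
proof -
  have eq: "cos_feature \<alpha> k 0 x * cos_feature \<alpha> k 0 y
      = 2 * cos (pi * real (Suc k) * x) * cos (pi * real (Suc k) * y) / real (Suc k) ^ (2 * \<alpha>)" for k
  proof -
    let ?c = "real (Suc k) ^ \<alpha>"
    have f: "cos_feature \<alpha> k 0 z = sqrt 2 * cos (pi * real (Suc k) * z) / ?c" for z
      by (simp add: cos_feature_def half_wave_def wave_def del: of_nat_Suc)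
    have "?c * ?c = real (Suc k) ^ (2 * \<alpha>)" by (simp only: mult_2 power_add)
    moreover have "cos_feature \<alpha> k 0 x * cos_feature \<alpha> k 0 y
        = (sqrt 2 * sqrt 2) * cos (pi * real (Suc k) * x) * cos (pi * real (Suc k) * y) / (?c * ?c)"
      unfolding f times_divide_times_eq by (simp only: mult_ac)
    ultimately show ?thesis by simp
  qed
  have "summable (\<lambda>k. cos_feature \<alpha> k 0 x * cos_feature \<alpha> k 0 y)"
  proof (rule summable_comparison_test'[OF summable_mult[OF inverse_Suc_square_summable, of 2]])
    fix k :: nat
    have "\<bar>2 * cos (pi * real (Suc k) * x) * cos (pi * real (Suc k) * y)\<bar> \<le> 2 * 1 * 1"
      unfolding abs_mult by (intro mult_mono) auto
    moreover have "1 / real (Suc k) ^ (2 * \<alpha>) \<le> (1 / real (Suc k))\<^sup>2"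
    proof -
      have "real (Suc k) ^ 2 \<le> real (Suc k) ^ (2 * \<alpha>)" by (rule power_increasing) (use assms in auto)
      then show ?thesis by (simp add: frac_le power_divide)
    qed
    ultimately have "\<bar>2 * cos (pi * real (Suc k) * x) * cos (pi * real (Suc k) * y)\<bar> * (1 / real (Suc k) ^ (2 * \<alpha>))
        \<le> 2 * 1 * 1 * (1 / real (Suc k))\<^sup>2" by (intro mult_mono) auto
    then show "norm (cos_feature \<alpha> k 0 x * cos_feature \<alpha> k 0 y) \<le> 2 * (1 / real (Suc k))\<^sup>2"
      unfolding eq by (simp add: abs_mult del: of_nat_Suc)
  qed
  then show ?thesis unfolding eq cos_kernel1_def by (rule summable_sums)
qed

section \<open>Smooth functions in the Sobolev space\<close>

lemma unit_inner_one: "unit_inner f (\<lambda>x. 1) = integral {0..1} f"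
  by (simp add: unit_inner_def)

lemma integral_square_le:
  assumes f: "unit_continuous f"
  shows "(integral {0..1} f)\<^sup>2 \<le> unit_inner f f"
proof -
  have "unit_orthonormal (\<lambda>_ x. 1) {0}" by (simp add: unit_orthonormal_def unit_inner_one)
  from unit_Bessel[OF this _ f] show ?thesis by (simp add: unit_inner_one)
qed

text \<open>The Bernoulli part \<open>P\<close> is chosen so that its derivatives of order at most
  \<alpha> have the means of those of \<open>g\<close>; this is possible because
  \<open>bern m\<close> has mean zero unless \<open>m = 0\<close>. All derivatives of the remainder
  \<open>r\<close> are then mean free, so the lower ones are periodic. Integration by parts without
  boundary terms yields the Fourier coefficients of \<open>r\<close> from those of its \<alpha>-th
  derivative.\<close>

lemma smooth_sob_expansion:
  assumes \<alpha>: "\<alpha> \<ge> 1"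
    and g: "\<And>\<tau> x. \<tau> < \<alpha> \<Longrightarrow> x \<in> {0..1} \<Longrightarrow> (g \<tau> has_real_derivative g (Suc \<tau>) x) (at x within {0..1})"
    and g\<alpha>: "unit_continuous (g \<alpha>)"
  obtains a where "summable (\<lambda>n. (a n)\<^sup>2)"
    "(\<Sum>n. (a n)\<^sup>2) \<le> (\<Sum>\<tau><\<alpha>. (integral {0..1} (g \<tau>))\<^sup>2) + unit_inner (g \<alpha>) (g \<alpha>)"
    "\<And>x. x \<in> {0..1} \<Longrightarrow> (\<lambda>n. a n * sob_feature \<alpha> n 0 x) sums g 0 x"
proof -
  define c where "c \<tau> = integral {0..1} (g \<tau>)" for \<tau>
  define P where "P \<tau> = (\<lambda>x. \<Sum>n\<le>\<alpha>. c n * sob_feature \<alpha> n \<tau> x)" for \<tau>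
  define r where "r \<tau> x = g \<tau> x - P \<tau> x" for \<tau> x
  have gc: "unit_continuous (g \<tau>)" if "\<tau> \<le> \<alpha>" for \<tau>
    using that g\<alpha> DERIV_continuous_on[OF g] by (cases "\<tau> = \<alpha>") auto
  have Pc: "unit_continuous (P \<tau>)" for \<tau> unfolding P_def by (intro continuous_intros sob_feature_continuous)
  have rc: "unit_continuous (r \<tau>)" if "\<tau> \<le> \<alpha>" for \<tau>
    unfolding r_def using gc[OF that] Pc by (rule continuous_on_diff)
  have rd: "(r \<tau> has_real_derivative r (Suc \<tau>) x) (at x within {0..1})" if "\<tau> < \<alpha>" "x \<in> {0..1}" for \<tau> x
    unfolding r_def P_def by (intro DERIV_diff g that DERIV_sum DERIV_cmult sob_feature_derivative)
  have one: "unit_continuous (\<lambda>x. 1 :: real)" by simp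
  have intP: "unit_inner (P \<tau>) (\<lambda>x. 1) = c \<tau>" if "\<tau> \<le> \<alpha>" for \<tau>
  proof -
    have "unit_inner (sob_feature \<alpha> n \<tau>) (\<lambda>x. 1) = of_bool (n = \<tau>)" if "n \<le> \<alpha>" for n
    proof (cases "\<tau> \<le> n")
      case True
      then have "sob_feature \<alpha> n \<tau> = bern (n - \<tau>)" using that by (auto simp: sob_feature_def)
      then show ?thesis using True integral_bern[of "n - \<tau>"] by (auto simp: unit_inner_one)
    next
      case False
      then have "sob_feature \<alpha> n \<tau> = (\<lambda>x. 0)" using that by (auto simp: sob_feature_def)
      then show ?thesis using False by (simp add: unit_inner_one)
    qed
    then have "unit_inner (P \<tau>) (\<lambda>x. 1) = (\<Sum>n\<le>\<alpha>. c n * of_bool (n = \<tau>))"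
      unfolding P_def unit_inner_sum[OF sob_feature_continuous one] by simp
    also have "\<dots> = (\<Sum>n\<le>\<alpha>. if n = \<tau> then c n else 0)" by (intro sum.cong) auto
    finally show ?thesis using that by simp
  qed
  have mean: "unit_inner (r \<tau>) (\<lambda>x. 1) = 0" if "\<tau> \<le> \<alpha>" for \<tau>
    unfolding r_def using unit_inner_diff[OF gc[OF that] Pc one] intP[OF that] by (simp add: unit_inner_one c_def)
  \<comment> \<open>The jump of a derivative across the interval is the mean of the next one, which
    is zero.\<close>
  have periodic: "r \<tau> 1 = r \<tau> 0" if "\<tau> < \<alpha>" for \<tau>
    using unit_FTC[OF rd[OF that]] mean[of "Suc \<tau>"] that by (simp add: unit_inner_one)
  define d where "d j = unit_inner (r \<alpha>) (full_wave (- (real \<alpha> * pi / 2)) j)" for j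
  have d: "d j = (- full_freq j) ^ \<alpha> * unit_inner (r 0) (full_wave 0 j)" for j
  proof -
    have eq: "- (real \<alpha> * pi / 2) - real (j mod 2) * pi / 2 = 0 - real (j mod 2) * pi / 2 - real \<alpha> * pi / 2" by simp
    have "(\<Sum>\<tau><\<alpha>. (- full_freq j) ^ (\<alpha> - Suc \<tau>) * wave_boundary (full_freq j)
        (0 - real (j mod 2) * pi / 2 - real (Suc \<tau>) * pi / 2) (r \<tau>)) = 0"
      by (intro sum.neutral) (simp add: wave_boundary_periodic periodic)
    then show ?thesis
      unfolding d_def full_wave_def eq using unit_inner_wave_iterated_derivative[where G = r and n = \<alpha>, OF rd rc] by simp
  qed
  \<comment> \<open>The mean of the top derivative is split off orthogonally. The square that is
    lost here returns as the coefficient of index \<alpha>, so the final bound has no extra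
    term.\<close>
  have rr: "unit_inner (r \<alpha>) (r \<alpha>) = unit_inner (g \<alpha>) (g \<alpha>) - (c \<alpha>)\<^sup>2"
  proof -
    have "P \<alpha> x = c \<alpha>" for x
    proof -
      have "P \<alpha> x = (\<Sum>n\<le>\<alpha>. if n = \<alpha> then c n else 0)"
        unfolding P_def by (intro sum.cong) (auto simp: sob_feature_def)
      then show ?thesis by simp
    qed
    then have r: "r \<alpha> = (\<lambda>x. g \<alpha> x - c \<alpha> * 1)" by (auto simp: r_def)
    have cc: "unit_continuous (\<lambda>x. c \<alpha> * 1)" by simp
    have "unit_inner (r \<alpha>) (r \<alpha>) = unit_inner (g \<alpha>) (r \<alpha>) - unit_inner (\<lambda>x. c \<alpha> * 1) (r \<alpha>)"
      using unit_inner_diff[OF g\<alpha> cc rc[OF order_refl]] unfolding r[symmetric] .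
    also have "unit_inner (\<lambda>x. c \<alpha> * 1) (r \<alpha>) = 0"
      unfolding unit_inner_scale using mean[of \<alpha>] by (simp add: unit_inner_commute)
    also have "unit_inner (g \<alpha>) (r \<alpha>) = unit_inner (g \<alpha>) (g \<alpha>) - unit_inner (\<lambda>x. c \<alpha> * 1) (g \<alpha>)"
      using unit_inner_diff[OF g\<alpha> cc g\<alpha>] unfolding r[symmetric] by (simp add: unit_inner_commute)
    also have "unit_inner (\<lambda>x. c \<alpha> * 1) (g \<alpha>) = c \<alpha> * unit_inner (g \<alpha>) (\<lambda>x. 1)"
      unfolding unit_inner_scale by (simp add: unit_inner_commute)
    also have "\<dots> = (c \<alpha>)\<^sup>2" by (simp add: unit_inner_one c_def power2_eq_square)
    finally show ?thesis by simp
  qed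
  have d_le: "(\<Sum>j<N. (d j)\<^sup>2) \<le> unit_inner (g \<alpha>) (g \<alpha>) - (c \<alpha>)\<^sup>2" for N
    unfolding d_def rr[symmetric] by (rule unit_Bessel[OF full_wave_orthonormal _ rc]) auto
  have ds: "summable (\<lambda>j. (d j)\<^sup>2)"
    by (rule summableI_nonneg_bounded[OF _ d_le]) simp
  \<comment> \<open>The sign comes from \<alpha> integrations by parts; the inverse power of the
    frequency is already part of the feature.\<close>
  define a where "a n = (if n \<le> \<alpha> then c n else (-1) ^ \<alpha> * d (n - Suc \<alpha>))" for n
  have a_shift: "(a (j + Suc \<alpha>))\<^sup>2 = (d j)\<^sup>2" for j by (simp add: a_def power_mult_distrib flip: power_mult)
  have as: "summable (\<lambda>n. (a n)\<^sup>2)"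
    using ds summable_iff_shift[of "\<lambda>n. (a n)\<^sup>2" "Suc \<alpha>"] unfolding a_shift by blast
  moreover have "(\<Sum>n. (a n)\<^sup>2) \<le> (\<Sum>\<tau><\<alpha>. (integral {0..1} (g \<tau>))\<^sup>2) + unit_inner (g \<alpha>) (g \<alpha>)"
  proof -
    have "(\<Sum>n. (a n)\<^sup>2) = (\<Sum>j. (d j)\<^sup>2) + (\<Sum>n<Suc \<alpha>. (a n)\<^sup>2)"
      using suminf_split_initial_segment[OF as, of "Suc \<alpha>"] unfolding a_shift .
    also have "(\<Sum>n<Suc \<alpha>. (a n)\<^sup>2) = (\<Sum>\<tau><\<alpha>. (c \<tau>)\<^sup>2) + (c \<alpha>)\<^sup>2" by (simp add: a_def)
    finally show ?thesis using suminf_le_const[OF ds d_le] by (simp add: c_def)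
  qed
  moreover have "(\<lambda>n. a n * sob_feature \<alpha> n 0 x) sums g 0 x" if x: "x \<in> {0..1}" for x
  proof -
    let ?b = "\<lambda>j. unit_inner (r 0) (full_wave 0 j)"
    have b: "?b j = (-1) ^ \<alpha> * d j / full_freq j ^ \<alpha>" for j
    proof -
      have "(-1) ^ \<alpha> * d j = ((-1) ^ \<alpha> * (-1) ^ \<alpha>) * (full_freq j ^ \<alpha> * ?b j)"
        unfolding d power_minus[of "full_freq j"] by (simp only: mult_ac)
      also have "(-1) ^ \<alpha> * (-1) ^ \<alpha> = (1 :: real)" by (simp flip: power_mult_distrib)
      finally show ?thesis using full_freq_pos[of j] by simp
    qed
    have "(\<lambda>j. ?b j * full_wave 0 j x) sums r 0 x"
    proof (rule full_wave_expansion[OF rc _ _ _ x])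
      show "r 0 0 = r 0 1" using periodic \<alpha> by simp
      show "integral {0..1} (r 0) = 0" using mean[of 0] by (simp add: unit_inner_one)
      show "summable (\<lambda>j. \<bar>?b j\<bar>)"
      proof (rule summable_comparison_test'[OF summable_mult_of_squares[OF ds inverse_full_freq_summable]])
        fix j :: nat
        have "\<bar>d j\<bar> * (1 / full_freq j ^ \<alpha>) \<le> \<bar>d j\<bar> * (1 / full_freq j)"
          by (rule mult_left_mono[OF inverse_full_freq_power_le[OF \<alpha>]]) simp
        then show "norm \<bar>?b j\<bar> \<le> \<bar>d j * (1 / full_freq j)\<bar>"
          unfolding b using full_freq_pos[of j] by (simp add: abs_mult power_abs)
      qed
    qed simp
    moreover have "a (j + Suc \<alpha>) * sob_feature \<alpha> (j + Suc \<alpha>) 0 x = ?b j * full_wave 0 j x" for j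
      unfolding b by (simp add: a_def sob_feature_def)
    ultimately have "(\<lambda>j. a (j + Suc \<alpha>) * sob_feature \<alpha> (j + Suc \<alpha>) 0 x) sums r 0 x" by simp
    then have "(\<lambda>n. a n * sob_feature \<alpha> n 0 x) sums (r 0 x + (\<Sum>n<Suc \<alpha>. a n * sob_feature \<alpha> n 0 x))"
      by (rule iffD1[OF sums_iff_shift])
    also have "(\<Sum>n<Suc \<alpha>. a n * sob_feature \<alpha> n 0 x) = P 0 x"
      unfolding P_def lessThan_Suc_atMost by (intro sum.cong) (auto simp: a_def)
    finally show ?thesis by (simp add: r_def)
  qed
  ultimately show ?thesis by (rule that)
qed

text \<open>An infinite cosine series need not have a continuous \<alpha>-th derivative, so finite
  sums are estimated with a constant independent of \<open>N\<close>. Every derivative up to order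
  \<alpha> is a sum of orthonormal half waves with squared norm at most
  \<open>pi ^ (2 * \<alpha>)\<close> times that of \<open>b\<close>. This bounds the \<alpha>
  squared means and the top term, \<alpha> + 1 contributions in all.\<close>

lemma cos_sum_sob_expansion:
  assumes \<alpha>: "\<alpha> \<ge> 1"
  obtains a where "summable (\<lambda>n. (a n)\<^sup>2)"
    "(\<Sum>n. (a n)\<^sup>2) \<le> real (Suc \<alpha>) * pi ^ (2 * \<alpha>) * (\<Sum>k<N. (b k)\<^sup>2)"
    "\<And>x. x \<in> {0..1} \<Longrightarrow> (\<lambda>n. a n * sob_feature \<alpha> n 0 x) sums (\<Sum>k<N. b k * cos_feature \<alpha> k 0 x)"
proof -
  define g where "g \<tau> = (\<lambda>x. \<Sum>k<N. b k * cos_feature \<alpha> k \<tau> x)" for \<tau>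
  have gc: "unit_continuous (g \<tau>)" for \<tau> unfolding g_def by (intro continuous_intros cos_feature_continuous)
  have gd: "(g \<tau> has_real_derivative g (Suc \<tau>) x) (at x within {0..1})" for \<tau> x
    unfolding g_def by (intro DERIV_sum DERIV_cmult cos_feature_derivative)
  have le: "unit_inner (g \<tau>) (g \<tau>) \<le> pi ^ (2 * \<alpha>) * (\<Sum>k<N. (b k)\<^sup>2)" if \<tau>: "\<tau> \<le> \<alpha>" for \<tau>
  proof -
    let ?q = "\<lambda>k. (pi * real (Suc k)) ^ \<tau> / real (Suc k) ^ \<alpha>"
    have "g \<tau> = (\<lambda>x. \<Sum>k<N. b k * ?q k * half_wave (real \<tau> * pi / 2) k x)"
      by (simp only: g_def cos_feature_def mult.assoc)
    moreover have "unit_orthonormal (half_wave (real \<tau> * pi / 2)) {..<N}"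
      by (rule half_wave_orthonormal[of _ "int \<tau>"]) simp
    ultimately have "unit_inner (g \<tau>) (g \<tau>) = (\<Sum>k<N. (b k * ?q k)\<^sup>2)"
      using unit_inner_orthonormal_sum[of "half_wave (real \<tau> * pi / 2)" "{..<N}" "\<lambda>k. b k * ?q k"]
      by (simp only: finite_lessThan)
    also have "\<dots> \<le> (\<Sum>k<N. (b k)\<^sup>2 * (pi ^ \<alpha>)\<^sup>2)"
    proof (rule sum_mono)
      fix k
      have "?q k = pi ^ \<tau> * (real (Suc k) ^ \<tau> / real (Suc k) ^ \<alpha>)" by (simp add: power_mult_distrib)
      also have "\<dots> \<le> pi ^ \<alpha> * 1"
      proof (intro mult_mono power_increasing \<tau>)
        have "real (Suc k) ^ \<tau> \<le> real (Suc k) ^ \<alpha>" by (rule power_increasing[OF \<tau>]) simp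
        then show "real (Suc k) ^ \<tau> / real (Suc k) ^ \<alpha> \<le> 1" by (simp add: divide_le_eq)
      qed (use pi_ge_two in auto)
      finally have "(?q k)\<^sup>2 \<le> (pi ^ \<alpha>)\<^sup>2" by (intro power_mono) auto
      then show "(b k * ?q k)\<^sup>2 \<le> (b k)\<^sup>2 * (pi ^ \<alpha>)\<^sup>2"
        unfolding power_mult_distrib[of "b k"] by (rule mult_left_mono) simp
    qed
    also have "\<dots> = pi ^ (2 * \<alpha>) * (\<Sum>k<N. (b k)\<^sup>2)"
      by (simp add: sum_distrib_left mult.commute flip: power_mult)
    finally show ?thesis .
  qed
  obtain a where a: "summable (\<lambda>n. (a n)\<^sup>2)"
    "(\<Sum>n. (a n)\<^sup>2) \<le> (\<Sum>\<tau><\<alpha>. (integral {0..1} (g \<tau>))\<^sup>2) + unit_inner (g \<alpha>) (g \<alpha>)"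
    "\<And>x. x \<in> {0..1} \<Longrightarrow> (\<lambda>n. a n * sob_feature \<alpha> n 0 x) sums g 0 x"
    by (rule smooth_sob_expansion[of \<alpha> g, OF \<alpha> gd gc]) (rule that)
  have "(\<Sum>\<tau><\<alpha>. (integral {0..1} (g \<tau>))\<^sup>2) \<le> (\<Sum>\<tau><\<alpha>. pi ^ (2 * \<alpha>) * (\<Sum>k<N. (b k)\<^sup>2))"
    by (intro sum_mono order_trans[OF integral_square_le[OF gc] le]) auto
  then have "(\<Sum>n. (a n)\<^sup>2) \<le> real (Suc \<alpha>) * pi ^ (2 * \<alpha>) * (\<Sum>k<N. (b k)\<^sup>2)"
    using a(2) le[OF order_refl] by (simp add: algebra_simps)
  with a show ?thesis unfolding g_def by (intro that)
qed

section \<open>The Sobolev space and its boundary conditions\<close>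

context
  fixes \<alpha> :: nat
  assumes \<alpha>: "\<alpha> \<ge> 1"
begin

private abbreviation "S \<equiv> rkhs_of {0..1} (sob_kernel \<alpha>)"
private abbreviation "V \<equiv> fst (sob_odd_bdry0_space \<alpha>)"
private abbreviation "fcoeff f n \<equiv> snd S f (\<lambda>x\<in>{0..1}. sob_feature \<alpha> n 0 x)"

interpretation S: rkhs "{0..1}" S "sob_kernel \<alpha>"
  by (rule rkhs_rkhs_of[OF psd_sums[OF sob_kernel_sums[OF \<alpha>]]])

private lemma coeff_summable:
  assumes "f \<in> fst S"
  shows "summable (\<lambda>n. (fcoeff f n)\<^sup>2)" and "(\<Sum>n. (fcoeff f n)\<^sup>2) \<le> snd S f f"
    and "(\<Sum>n<N. (fcoeff f n)\<^sup>2) \<le> snd S f f"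
  using S.feature_coeff_summable[OF sob_kernel_sums[OF \<alpha>] assms]
    S.feature_coeff_sum_le[OF sob_kernel_sums[OF \<alpha>] assms] by auto

private lemma coeff_sums:
  "f \<in> fst S \<Longrightarrow> x \<in> {0..1} \<Longrightarrow> (\<lambda>n. fcoeff f n * sob_feature \<alpha> n 0 x) sums f x"
  by (rule S.feature_expansion[OF sob_kernel_sums[OF \<alpha>]])

private lemma feature_mem: "(\<lambda>x\<in>{0..1}. sob_feature \<alpha> n 0 x) \<in> fst S"
  by (rule S.feature_mem[OF sob_kernel_sums[OF \<alpha>]])

private lemma coeff_unit_deriv:
  assumes f: "f \<in> fst S" and \<tau>: "\<tau> < \<alpha>"
  shows "uniform_limit {0..1} (\<lambda>N x. \<Sum>n<N. fcoeff f n * sob_feature \<alpha> n \<tau> x) (unit_deriv \<tau> f) sequentially"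
    and "x \<in> {0..1} \<Longrightarrow> (\<lambda>n. fcoeff f n * sob_feature \<alpha> n \<tau> x) sums unit_deriv \<tau> f x"
proof -
  obtain \<beta> where \<beta>: "summable (\<lambda>n. (\<beta> n :: real)\<^sup>2)"
    and bound: "\<And>n \<tau> x. \<tau> < \<alpha> \<Longrightarrow> x \<in> {0..1} \<Longrightarrow> \<bar>sob_feature \<alpha> n \<tau> x\<bar> \<le> \<beta> n"
    by (rule sob_feature_bound[of \<alpha>]) (rule that)
  note D = unit_deriv_series[where \<phi> = "sob_feature \<alpha>" and a = "fcoeff f", OF sob_feature_derivative bound \<beta>
      coeff_summable(1)[OF f] coeff_sums[OF f] \<tau>]
  show "uniform_limit {0..1} (\<lambda>N x. \<Sum>n<N. fcoeff f n * sob_feature \<alpha> n \<tau> x) (unit_deriv \<tau> f) sequentially"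
    by (rule D(1))
  show "x \<in> {0..1} \<Longrightarrow> (\<lambda>n. fcoeff f n * sob_feature \<alpha> n \<tau> x) sums unit_deriv \<tau> f x"
    by (rule D(2))
qed

private lemma unit_deriv_axpy:
  assumes f: "f \<in> fst S" and g: "g \<in> fst S" and \<tau>: "\<tau> < \<alpha>" and x: "x \<in> {0..1}"
  shows "unit_deriv \<tau> (\<lambda>x\<in>{0..1}. f x + t * g x) x = unit_deriv \<tau> f x + t * unit_deriv \<tau> g x"
proof (rule sums_unique2)
  have h: "(\<lambda>x\<in>{0..1}. f x + t * g x) \<in> fst S" by (rule S.axpy_mem[OF f g])
  show "(\<lambda>n. fcoeff (\<lambda>x\<in>{0..1}. f x + t * g x) n * sob_feature \<alpha> n \<tau> x) sums
      unit_deriv \<tau> (\<lambda>x\<in>{0..1}. f x + t * g x) x"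
    by (rule coeff_unit_deriv(2)[OF h \<tau> x])
  have "(\<lambda>n. fcoeff f n * sob_feature \<alpha> n \<tau> x + t * (fcoeff g n * sob_feature \<alpha> n \<tau> x)) sums
      (unit_deriv \<tau> f x + t * unit_deriv \<tau> g x)"
    by (intro sums_add sums_mult coeff_unit_deriv(2) f g \<tau> x)
  then show "(\<lambda>n. fcoeff (\<lambda>x\<in>{0..1}. f x + t * g x) n * sob_feature \<alpha> n \<tau> x) sums
      (unit_deriv \<tau> f x + t * unit_deriv \<tau> g x)"
    unfolding S.inner_axpy[OF f g feature_mem] by (simp only: distrib_right mult.assoc)
qed

text \<open>Point evaluation of a derivative of order below \<alpha> is a bounded functional, by
  Cauchy-Schwarz in the differentiated feature expansion. This is what makes the boundary conditions
  cut out a closed subspace.\<close>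

private lemma unit_deriv_bound:
  obtains B where "\<And>f \<tau> x. f \<in> fst S \<Longrightarrow> \<tau> < \<alpha> \<Longrightarrow> x \<in> {0..1} \<Longrightarrow> (unit_deriv \<tau> f x)\<^sup>2 \<le> snd S f f * B"
proof -
  obtain \<beta> where \<beta>: "summable (\<lambda>n. (\<beta> n :: real)\<^sup>2)"
    and bound: "\<And>n \<tau> x. \<tau> < \<alpha> \<Longrightarrow> x \<in> {0..1} \<Longrightarrow> \<bar>sob_feature \<alpha> n \<tau> x\<bar> \<le> \<beta> n"
    by (rule sob_feature_bound[of \<alpha>]) (rule that)
  have "(unit_deriv \<tau> f x)\<^sup>2 \<le> snd S f f * (\<Sum>n. (\<beta> n)\<^sup>2)" if f: "f \<in> fst S" and \<tau>: "\<tau> < \<alpha>" and x: "x \<in> {0..1}" for f \<tau> x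
  proof -
    have le: "(sob_feature \<alpha> n \<tau> x)\<^sup>2 \<le> (\<beta> n)\<^sup>2" for n
      using power_mono[OF bound[OF \<tau> x, of n] abs_ge_zero, of 2] by simp
    have s: "summable (\<lambda>n. (sob_feature \<alpha> n \<tau> x)\<^sup>2)"
      by (rule summable_comparison_test'[OF \<beta>]) (use le in simp)
    have "(unit_deriv \<tau> f x)\<^sup>2 \<le> (\<Sum>n. (fcoeff f n)\<^sup>2) * (\<Sum>n. (sob_feature \<alpha> n \<tau> x)\<^sup>2)"
      unfolding sums_unique[OF coeff_unit_deriv(2)[OF f \<tau> x]]
      by (rule Cauchy_Schwarz_suminf[OF coeff_summable(1)[OF f] s])
    also have "\<dots> \<le> snd S f f * (\<Sum>n. (\<beta> n)\<^sup>2)"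
      by (intro mult_mono coeff_summable(2)[OF f] suminf_le le s \<beta> S.inner_self_nonneg suminf_nonneg) auto
    finally show ?thesis .
  qed
  then show ?thesis by (rule that)
qed

private lemma V_iff: "f \<in> V \<longleftrightarrow> f \<in> fst S \<and>
    (\<forall>\<tau><\<alpha>. odd \<tau> \<longrightarrow> unit_deriv \<tau> f 0 = 0 \<and> unit_deriv \<tau> f 1 = 0)"
  using \<alpha> by (auto simp: sob_odd_bdry0_space_def sub_fspace_def Let_def)

text \<open>Among the features only the constant one, of index 0, has nonzero mean, and uniform
  convergence allows integration term by term. Being orthogonal to 1 therefore means being mean
  free.\<close>

private lemma integral_eq_inner_one:
  assumes f: "f \<in> fst S"
  shows "unit_continuous f" and "snd S f (\<lambda>x\<in>{0..1}. 1) = integral {0..1} f"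
proof -
  have 0: "0 < \<alpha>" using \<alpha> by simp
  have "unit_deriv 0 f = f" by (simp add: unit_deriv_def)
  then have lim: "uniform_limit {0..1} (\<lambda>N x. \<Sum>n<N. fcoeff f n * sob_feature \<alpha> n 0 x) f sequentially"
    using coeff_unit_deriv(1)[OF f 0] by simp
  have one: "unit_continuous (\<lambda>x. 1 :: real)" by simp
  have c: "unit_continuous (\<lambda>x. \<Sum>n<N. fcoeff f n * sob_feature \<alpha> n 0 x)" for N
    by (intro continuous_intros sob_feature_continuous)
  note L = unit_inner_uniform_limit[OF lim c one]
  show "unit_continuous f" by (rule L(1))
  have "unit_inner (sob_feature \<alpha> n 0) (\<lambda>x. 1) = of_bool (n = 0)" for n
  proof (cases "n \<le> \<alpha>")
    case True
    then have "sob_feature \<alpha> n 0 = bern n" by (auto simp: sob_feature_def)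
    then show ?thesis by (simp add: unit_inner_one integral_bern)
  next
    case False
    then have "sob_feature \<alpha> n 0 = (\<lambda>x. 1 / full_freq (n - Suc \<alpha>) ^ \<alpha> * full_wave 0 (n - Suc \<alpha>) x)"
      by (auto simp: sob_feature_def)
    then show ?thesis using False by (simp only: unit_inner_scale integral_full_wave) simp
  qed
  then have A: "(\<lambda>n. fcoeff f n * of_bool (n = 0)) sums integral {0..1} f"
    using L(2) unfolding unit_inner_sum[OF sob_feature_continuous one] unit_inner_one[of f] sums_def by simp
  have B: "(\<lambda>n. fcoeff f n * of_bool (n = 0)) sums fcoeff f 0"
    using sums_single[of 0 "fcoeff f"] by (rule sums_cong[THEN iffD1, rotated]) auto
  have "fcoeff f 0 = snd S f (\<lambda>x\<in>{0..1}. 1)" by (simp add: sob_feature_def)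
  with sums_unique2[OF B A] show "snd S f (\<lambda>x\<in>{0..1}. 1) = integral {0..1} f" by (simp only:)
qed

private lemma one_mem: "(\<lambda>x\<in>{0..1}. 1) \<in> V" and one_inner: "snd S (\<lambda>x\<in>{0..1}. 1) (\<lambda>x\<in>{0..1}. 1) = 1"
proof -
  let ?one = "\<lambda>x\<in>{0..1::real}. 1 :: real"
  have mem: "?one \<in> fst S" using feature_mem[of 0] by (simp add: sob_feature_def)
  have "integral {0..1} ?one = integral {0..1} (\<lambda>x::real. 1)"
    by (rule Henstock_Kurzweil_Integration.integral_cong) simp
  then show "snd S ?one ?one = 1" using integral_eq_inner_one(2)[OF mem] by simp
  obtain \<beta> where \<beta>: "summable (\<lambda>n. (\<beta> n :: real)\<^sup>2)"
    and bound: "\<And>n \<tau> x. \<tau> < \<alpha> \<Longrightarrow> x \<in> {0..1} \<Longrightarrow> \<bar>sob_feature \<alpha> n \<tau> x\<bar> \<le> \<beta> n"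
    by (rule sob_feature_bound[of \<alpha>]) (rule that)
  have single: "(\<lambda>n. of_bool (n = 0) * h n) sums h 0" for h :: "nat \<Rightarrow> real"
    using sums_single[of 0 h] by (rule sums_cong[THEN iffD1, rotated]) auto
  have a: "summable (\<lambda>n. (of_bool (n = 0) :: real)\<^sup>2)"
    using sums_summable[OF single[of "\<lambda>n. of_bool (n = 0)"]] by (simp add: power2_eq_square)
  have "unit_deriv \<tau> ?one x = 0" if "\<tau> < \<alpha>" "odd \<tau>" "x \<in> {0..1}" for \<tau> x
  proof -
    \<comment> \<open>The constant is the feature series whose single term is feature 0; its
      derivatives are read off from that series.\<close>
    have D: "(\<lambda>n. of_bool (n = 0) * sob_feature \<alpha> n \<tau> x) sums unit_deriv \<tau> ?one x"
    proof (rule unit_deriv_series(2)[where \<phi> = "sob_feature \<alpha>" and \<alpha> = \<alpha>, OF sob_feature_derivative bound \<beta> a _ that(1) that(3)])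
      show "(\<lambda>n. of_bool (n = 0) * sob_feature \<alpha> n 0 x) sums ?one x" if "x \<in> {0..1}" for x
        using single[of "\<lambda>n. sob_feature \<alpha> n 0 x"] that by (simp add: sob_feature_def)
    qed
    have "sob_feature \<alpha> 0 \<tau> x = 0" using odd_pos[OF that(2)] by (simp add: sob_feature_def)
    then show ?thesis using sums_unique2[OF D single[of "\<lambda>n. sob_feature \<alpha> n \<tau> x"]] by simp
  qed
  then show "?one \<in> V" unfolding V_iff using mem by simp
qed

text \<open>If members \<open>s n\<close> tend to \<open>g\<close> in norm, the odd boundary
  derivatives of \<open>g\<close> are, up to sign, those of \<open>s n - g\<close>, and these tend
  to zero by \<open>unit_deriv_bound\<close>.\<close>

private lemma V_rkhs: "rkhs {0..1} (sob_odd_bdry0_space \<alpha>) (sob_odd_bdry0_kernel1 \<alpha>)"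
proof -
  have VS: "f \<in> V \<Longrightarrow> f \<in> fst S" for f by (simp add: V_iff)
  have axpy: "(\<lambda>x\<in>{0..1}. f x + t * g x) \<in> V" if "f \<in> V" "g \<in> V" for f g t
    using that unit_deriv_axpy[OF VS VS, OF that] S.axpy_mem[OF VS VS, OF that] by (simp add: V_iff)
  have zero: "(\<lambda>x\<in>{0..1}. 0) \<in> V"
    using axpy[OF one_mem one_mem, of "-1"] by (simp cong: restrict_cong)
  have closed: "g \<in> V" if s: "\<And>n. s n \<in> V" and g: "g \<in> fst S"
    and lim: "(\<lambda>n. fspace_norm S (\<lambda>x\<in>{0..1}. s n x - g x)) \<longlonglongrightarrow> 0" for s g
  proof -
    obtain B where B: "\<And>f \<tau> x. f \<in> fst S \<Longrightarrow> \<tau> < \<alpha> \<Longrightarrow> x \<in> {0..1} \<Longrightarrow> (unit_deriv \<tau> f x)\<^sup>2 \<le> snd S f f * B"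
      by (rule unit_deriv_bound) (rule that)
    have "unit_deriv \<tau> g x = 0" if \<tau>: "\<tau> < \<alpha>" "odd \<tau>" and x: "x = 0 \<or> x = 1" for \<tau> x
    proof -
      have x': "x \<in> {0..1}" using x by auto
      have "(unit_deriv \<tau> g x)\<^sup>2 \<le> (fspace_norm S (\<lambda>x\<in>{0..1}. s n x - g x))\<^sup>2 * B" for n
      proof -
        let ?h = "\<lambda>x\<in>{0..1}. s n x + (-1) * g x"
        have h: "?h \<in> fst S" by (rule S.axpy_mem[OF VS[OF s] g])
        have "unit_deriv \<tau> (s n) x = 0" using s[of n] \<tau> x by (auto simp: V_iff)
        then have "(unit_deriv \<tau> g x)\<^sup>2 = (unit_deriv \<tau> ?h x)\<^sup>2"
          using unit_deriv_axpy[OF VS[OF s] g \<tau>(1) x', of n "-1"] by simp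
        also have "\<dots> \<le> snd S ?h ?h * B" by (rule B[OF h \<tau>(1) x'])
        also have "snd S ?h ?h = (fspace_norm S (\<lambda>x\<in>{0..1}. s n x - g x))\<^sup>2"
          by (simp add: fspace_norm_def S.inner_self_nonneg)
        finally show ?thesis .
      qed
      moreover have "(\<lambda>n. (fspace_norm S (\<lambda>x\<in>{0..1}. s n x - g x))\<^sup>2 * B) \<longlonglongrightarrow> 0\<^sup>2 * B"
        by (intro tendsto_intros lim)
      ultimately have "(unit_deriv \<tau> g x)\<^sup>2 \<le> 0\<^sup>2 * B"
        by (intro LIMSEQ_le_const[where X = "\<lambda>n. (fspace_norm S (\<lambda>x\<in>{0..1}. s n x - g x))\<^sup>2 * B"]) auto
      then show ?thesis by simp
    qed
    then show ?thesis using g by (simp add: V_iff)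
  qed
  obtain L where "rkhs {0..1} (sub_fspace S V) L"
    by (rule S.rkhs_closed_subspace[of V]) (use VS zero axpy closed that in blast)+
  moreover have "sub_fspace S V = sob_odd_bdry0_space \<alpha>"
    by (simp add: sob_odd_bdry0_space_def sub_fspace_def)
  ultimately show ?thesis
    unfolding sob_odd_bdry0_kernel1_def using rkhs_reproducing_kernel by metis
qed

private lemma V_inner: "f \<in> V \<Longrightarrow> g \<in> V \<Longrightarrow> snd (sob_odd_bdry0_space \<alpha>) f g = snd S f g"
  by (simp add: sob_odd_bdry0_space_def sub_fspace_def)

text \<open>The partial sums obey one evaluation bound independent of their length, which survives
  pointwise convergence and gives membership with the norm estimate. The boundary conditions hold
  because an odd derivative of each cosine is a multiple of a sine that vanishes at both
  endpoints.\<close>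

private lemma cos_series_mem:
  assumes b: "summable (\<lambda>k. (b k)\<^sup>2)" and ext: "f \<in> extensional {0..1}"
    and f: "\<And>x. x \<in> {0..1} \<Longrightarrow> (\<lambda>k. b k * cos_feature \<alpha> k 0 x) sums f x"
  shows "f \<in> V" and "snd S f f \<le> real (Suc \<alpha>) * pi ^ (2 * \<alpha>) * (\<Sum>k. (b k)\<^sup>2)"
    and "snd S f (\<lambda>x\<in>{0..1}. 1) = 0"
proof -
  let ?C = "real (Suc \<alpha>) * pi ^ (2 * \<alpha>)" and ?K = "sob_kernel \<alpha>"
  let ?s = "\<lambda>N x. \<Sum>k<N. b k * cos_feature \<alpha> k 0 x"
  have partial: "kernel_bounded {0..1} ?K (?C * (\<Sum>k. (b k)\<^sup>2)) (?s N)" for N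
    unfolding kernel_bounded_def
  proof
    fix c :: "real \<Rightarrow> real" assume c: "c \<in> finsupp {0..1}"
    obtain a where a: "summable (\<lambda>n. (a n)\<^sup>2)" "(\<Sum>n. (a n)\<^sup>2) \<le> ?C * (\<Sum>k<N. (b k)\<^sup>2)"
      "\<And>x. x \<in> {0..1} \<Longrightarrow> (\<lambda>n. a n * sob_feature \<alpha> n 0 x) sums ?s N x"
      by (rule cos_sum_sob_expansion[OF \<alpha>]) (rule that)
    have "(lin (?s N) c)\<^sup>2 \<le> (\<Sum>n. (a n)\<^sup>2) * quad ?K c c"
      using S.feature_series_bounded[OF sob_kernel_sums[OF \<alpha>] a(1,3)] c by (simp add: kernel_bounded_def)
    also have "\<dots> \<le> ?C * (\<Sum>k. (b k)\<^sup>2) * quad ?K c c"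
    proof (rule mult_right_mono[OF order_trans[OF a(2)] psd_quad_nonneg[OF S.psd c]])
      show "?C * (\<Sum>k<N. (b k)\<^sup>2) \<le> ?C * (\<Sum>k. (b k)\<^sup>2)"
        by (intro mult_left_mono sum_le_suminf b) auto
    qed
    finally show "(lin (?s N) c)\<^sup>2 \<le> ?C * (\<Sum>k. (b k)\<^sup>2) * quad ?K c c" .
  qed
  have bounded: "kernel_bounded {0..1} ?K (?C * (\<Sum>k. (b k)\<^sup>2)) f"
    unfolding kernel_bounded_def
  proof
    fix c :: "real \<Rightarrow> real" assume c: "c \<in> finsupp {0..1}"
    have "(\<lambda>k. lin (\<lambda>x. b k * cos_feature \<alpha> k 0 x) c) sums lin f c" by (rule lin_sums[OF c f])
    then have "(\<lambda>N. (lin (?s N) c)\<^sup>2) \<longlonglongrightarrow> (lin f c)\<^sup>2"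
      unfolding sums_def lin_fun_sum by (rule tendsto_power)
    then show "(lin f c)\<^sup>2 \<le> ?C * (\<Sum>k. (b k)\<^sup>2) * quad ?K c c"
      using partial c by (intro LIMSEQ_le_const2) (auto simp: kernel_bounded_def)
  qed
  have C0: "0 \<le> ?C * (\<Sum>k. (b k)\<^sup>2)" by (intro mult_nonneg_nonneg suminf_nonneg b) auto
  have mem: "f \<in> fst S" by (rule S.mem_if_kernel_bounded(1)[OF ext bounded C0])
  show "snd S f f \<le> ?C * (\<Sum>k. (b k)\<^sup>2)" by (rule S.mem_if_kernel_bounded(2)[OF ext bounded C0])
  obtain \<beta> where \<beta>: "summable (\<lambda>n. (\<beta> n :: real)\<^sup>2)"
    and bound: "\<And>n \<tau> x. \<tau> < \<alpha> \<Longrightarrow> x \<in> {0..1} \<Longrightarrow> \<bar>cos_feature \<alpha> n \<tau> x\<bar> \<le> \<beta> n"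
    by (rule cos_feature_bound[of \<alpha>]) (rule that)
  note D = unit_deriv_series[where \<phi> = "cos_feature \<alpha>" and a = b and \<alpha> = \<alpha>, OF cos_feature_derivative bound \<beta> b f]
  have "unit_deriv \<tau> f x = 0" if \<tau>: "\<tau> < \<alpha>" "odd \<tau>" and x: "x = 0 \<or> x = 1" for \<tau> x
  proof -
    have "cos_feature \<alpha> k \<tau> x = 0" for k
    proof -
      \<comment> \<open>In quarter turns the argument is \<tau> at 0 and
        \<open>2 * (k + 1) + \<tau>\<close> at 1, both odd with \<tau>.\<close>
      have "\<exists>i. odd i \<and> pi * real (Suc k) * x + real \<tau> * pi / 2 = of_int i * (pi / 2)"
        using x
      proof
        assume "x = 0"
        then show ?thesis using \<tau>(2) by (intro exI[of _ "int \<tau>"]) simp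
      next
        assume "x = 1"
        then show ?thesis using \<tau>(2) by (intro exI[of _ "int (2 * Suc k + \<tau>)"]) (simp add: field_simps)
      qed
      then have "cos (pi * real (Suc k) * x + real \<tau> * pi / 2) = 0" unfolding cos_zero_iff_int .
      then show ?thesis by (simp add: cos_feature_def half_wave_def wave_def del: of_nat_Suc)
    qed
    moreover have "(\<lambda>n. b n * cos_feature \<alpha> n \<tau> x) sums unit_deriv \<tau> f x"
      by (rule D(2)) (use \<tau> x in auto)
    ultimately show ?thesis using sums_unique2[OF _ sums_zero] by simp
  qed
  then show "f \<in> V" using mem by (simp add: V_iff)
  have one: "unit_continuous (\<lambda>x. 1 :: real)" by simp
  have \<alpha>0: "0 < \<alpha>" using \<alpha> by simp
  have lim: "uniform_limit {0..1} (\<lambda>N x. \<Sum>n<N. b n * cos_feature \<alpha> n 0 x) f sequentially"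
  proof -
    have "uniform_limit {0..1} (\<lambda>N x. \<Sum>n<N. b n * cos_feature \<alpha> n 0 x) (unit_deriv 0 f) sequentially"
      by (rule D(1)) (use \<alpha>0 in auto)
    then show ?thesis by (simp add: unit_deriv_def)
  qed
  have "(\<lambda>N. unit_inner (?s N) (\<lambda>x. 1)) \<longlonglongrightarrow> unit_inner f (\<lambda>x. 1)"
    by (rule unit_inner_uniform_limit(2)[OF lim _ one]) (intro continuous_intros cos_feature_continuous)
  moreover have "unit_inner (cos_feature \<alpha> k 0) (\<lambda>x. 1) = 0" for k
  proof -
    have "integral {0..1} (cos_feature \<alpha> k 0)
      = (1 / real (Suc k) ^ \<alpha> * sqrt 2) * integral {0..1} (\<lambda>x. cos (pi * real (Suc k) * x + 0))"
      using Henstock_Kurzweil_Integration.integral_cmul[of "{0..1}" "1 / real (Suc k) ^ \<alpha> * sqrt 2" "\<lambda>x. cos (pi * real (Suc k) * x + 0)"]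
      by (simp add: cos_feature_def[abs_def] half_wave_def wave_def mult.assoc del: of_nat_Suc)
    also have "\<dots> = 0"
      using integral_cos[of "pi * real (Suc k)" 0] sin_npi[of "Suc k"] by (simp add: mult.commute del: of_nat_Suc)
    finally show ?thesis by (simp add: unit_inner_one)
  qed
  ultimately have "integral {0..1} f = 0"
    unfolding unit_inner_sum[OF cos_feature_continuous one] unit_inner_one by (simp add: LIMSEQ_const_iff)
  then show "snd S f (\<lambda>x\<in>{0..1}. 1) = 0" using integral_eq_inner_one(2)[OF mem] by simp
qed

text \<open>For odd \<tau> the boundary derivatives of \<open>f\<close> vanish by hypothesis. For
  even \<tau> an odd number of quarter turns makes the wave a multiple of a sine that is zero at
  both endpoints. Since partial sums need not meet the boundary conditions, only the limit is
  zero.\<close>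

private lemma wave_boundary_tendsto_0:
  assumes f: "f \<in> V" and \<tau>: "\<tau> < \<alpha>"
  shows "(\<lambda>N. wave_boundary (pi * real (Suc k)) (0 - real (Suc \<tau>) * pi / 2)
    (\<lambda>x. \<Sum>n<N. fcoeff f n * sob_feature \<alpha> n \<tau> x)) \<longlonglongrightarrow> 0"
proof -
  have fS: "f \<in> fst S" using f by (simp add: V_iff)
  let ?w = "wave (pi * real (Suc k)) (0 - real (Suc \<tau>) * pi / 2)"
  have lim: "(\<lambda>N. \<Sum>n<N. fcoeff f n * sob_feature \<alpha> n \<tau> x) \<longlonglongrightarrow> unit_deriv \<tau> f x" if "x \<in> {0..1}" for x
    using coeff_unit_deriv(2)[OF fS \<tau> that] by (simp add: sums_def)
  have "(\<lambda>N. wave_boundary (pi * real (Suc k)) (0 - real (Suc \<tau>) * pi / 2)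
      (\<lambda>x. \<Sum>n<N. fcoeff f n * sob_feature \<alpha> n \<tau> x)) \<longlonglongrightarrow> unit_deriv \<tau> f 1 * ?w 1 - unit_deriv \<tau> f 0 * ?w 0"
    unfolding wave_boundary_def by (intro tendsto_diff tendsto_mult tendsto_const lim) auto
  moreover have "unit_deriv \<tau> f 1 * ?w 1 - unit_deriv \<tau> f 0 * ?w 0 = 0"
  proof (cases "odd \<tau>")
    case True
    then show ?thesis using f \<tau> by (simp add: V_iff)
  next
    case False
    have "?w 0 = 0"
    proof -
      have "cos (pi * real (Suc k) * 0 + (0 - real (Suc \<tau>) * pi / 2)) = 0"
        unfolding cos_zero_iff_int using False by (intro exI[of _ "- int (Suc \<tau>)"]) (simp add: algebra_simps)
      then show ?thesis by (simp only: wave_def mult_zero_right)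
    qed
    moreover have "?w 1 = 0"
    proof -
      have "cos (pi * real (Suc k) * 1 + (0 - real (Suc \<tau>) * pi / 2)) = 0"
        unfolding cos_zero_iff_int using False
        by (intro exI[of _ "2 * int (Suc k) - int (Suc \<tau>)"]) (simp add: field_simps)
      then show ?thesis by (simp only: wave_def mult_zero_right)
    qed
    ultimately show ?thesis by simp
  qed
  ultimately show ?thesis by simp
qed

text \<open>After \<alpha> derivatives, feature \<alpha> is the constant 1 and the later ones are
  full waves of amplitude factor one. The features below \<alpha> have been differentiated to zero
  and are left out.\<close>

private lemma top_feature_orthonormal: "unit_orthonormal (\<lambda>n. sob_feature \<alpha> n \<alpha>) {\<alpha>..}"
proof -
  have top: "sob_feature \<alpha> n \<alpha> = (if n = \<alpha> then (\<lambda>x. 1) else full_wave (real \<alpha> * pi / 2) (n - Suc \<alpha>))" if "n \<ge> \<alpha>" for n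
    using that full_freq_pos[of "n - Suc \<alpha>"] by (auto simp: sob_feature_def fun_eq_iff)
  have w: "unit_inner (full_wave \<theta> i) (full_wave \<theta> j) = of_bool (i = j)" for \<theta> i j
    using full_wave_orthonormal[of \<theta> UNIV] by (simp add: unit_orthonormal_def)
  have one: "unit_inner (\<lambda>x. 1) (full_wave \<theta> j) = 0" for \<theta> j
    using integral_full_wave[of \<theta> j] by (simp add: unit_inner_commute)
  show ?thesis
    unfolding unit_orthonormal_def
  proof (intro conjI ballI)
    fix i j assume ij: "i \<in> {\<alpha>..}" "j \<in> {\<alpha>..}"
    show "unit_inner (sob_feature \<alpha> i \<alpha>) (sob_feature \<alpha> j \<alpha>) = of_bool (i = j)"
      using ij top[of i] top[of j] w one integral_full_wave by (auto simp: unit_inner_one)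
  qed (rule sob_feature_continuous)
qed

text \<open>The partial sums \<open>F N\<close> of the Sobolev expansion stand in for the
  \<alpha>-th derivative of \<open>f\<close>. Their top derivatives have squared norm at most that
  of \<open>f\<close>, so Bessel bounds the half-wave coefficients uniformly in \<open>N\<close>. In
  the limit these become the cosine coefficients of \<open>f\<close> weighted by the
  frequencies.\<close>

private lemma cos_expansion:
  assumes f: "f \<in> V" and mean: "snd S f (\<lambda>x\<in>{0..1}. 1) = 0"
  obtains b where "summable (\<lambda>k. (b k)\<^sup>2)" "(\<Sum>k. (b k)\<^sup>2) \<le> snd S f f"
    "\<And>x. x \<in> {0..1} \<Longrightarrow> (\<lambda>k. b k * cos_feature \<alpha> k 0 x) sums f x"
proof -
  have fS: "f \<in> fst S" using f by (simp add: V_iff)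
  have \<alpha>0: "0 < \<alpha>" using \<alpha> by simp
  have fc: "unit_continuous f" by (rule integral_eq_inner_one(1)[OF fS])
  let ?w = "\<lambda>k. pi * real (Suc k)"
  define F where "F N \<tau> = (\<lambda>x. \<Sum>n<N. fcoeff f n * sob_feature \<alpha> n \<tau> x)" for N \<tau>
  have Fc: "unit_continuous (F N \<tau>)" for N \<tau> unfolding F_def by (intro continuous_intros sob_feature_continuous)
  have Fd: "(F N \<tau> has_real_derivative F N (Suc \<tau>) x) (at x within {0..1})" for N \<tau> x
    unfolding F_def by (intro DERIV_sum DERIV_cmult sob_feature_derivative)
  define u where "u k = unit_inner f (half_wave 0 k)" for k
  have top_le: "unit_inner (F N \<alpha>) (F N \<alpha>) \<le> snd S f f" for N
  proof -
    have "F N \<alpha> = (\<lambda>x. \<Sum>n\<in>{\<alpha>..<N}. fcoeff f n * sob_feature \<alpha> n \<alpha> x)"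
      unfolding F_def by (intro ext sum.mono_neutral_right) (auto simp: sob_feature_def)
    moreover have "unit_orthonormal (\<lambda>n. sob_feature \<alpha> n \<alpha>) {\<alpha>..<N}"
      using top_feature_orthonormal by (auto simp: unit_orthonormal_def)
    ultimately have "unit_inner (F N \<alpha>) (F N \<alpha>) = (\<Sum>n\<in>{\<alpha>..<N}. (fcoeff f n)\<^sup>2)"
      using unit_inner_orthonormal_sum[of "\<lambda>n. sob_feature \<alpha> n \<alpha>" "{\<alpha>..<N}" "fcoeff f"] by simp
    also have "\<dots> \<le> (\<Sum>n<N. (fcoeff f n)\<^sup>2)" by (rule sum_mono2) auto
    also have "\<dots> \<le> snd S f f" by (rule coeff_summable(3)[OF fS])
    finally show ?thesis .
  qed
  have lim: "(\<lambda>N. unit_inner (F N \<alpha>) (half_wave (0 - real \<alpha> * pi / 2) k)) \<longlonglongrightarrow> (- ?w k) ^ \<alpha> * u k" for k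
  proof -
    have parts: "unit_inner (F N \<alpha>) (half_wave (0 - real \<alpha> * pi / 2) k) = (- ?w k) ^ \<alpha> * unit_inner (F N 0) (half_wave 0 k)
        + (\<Sum>\<tau><\<alpha>. (- ?w k) ^ (\<alpha> - Suc \<tau>) * wave_boundary (?w k) (0 - real (Suc \<tau>) * pi / 2) (F N \<tau>))" for N
      unfolding half_wave_def by (rule unit_inner_wave_iterated_derivative[where G = "F N" and n = \<alpha>, OF Fd Fc])
    have "uniform_limit {0..1} (\<lambda>N. F N 0) f sequentially"
      using coeff_unit_deriv(1)[OF fS \<alpha>0] by (simp add: unit_deriv_def F_def)
    then have "(\<lambda>N. unit_inner (F N 0) (half_wave 0 k)) \<longlonglongrightarrow> u k"
      unfolding u_def by (rule unit_inner_uniform_limit(2)) (auto simp: Fc half_wave_def wave_continuous)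
    \<comment> \<open>The partial sums tend to \<open>f\<close> uniformly and each boundary term
      tends to zero, so only the first term of the integration by parts remains.\<close>
    then have "(\<lambda>N. unit_inner (F N \<alpha>) (half_wave (0 - real \<alpha> * pi / 2) k)) \<longlonglongrightarrow>
        (- ?w k) ^ \<alpha> * u k + (\<Sum>\<tau><\<alpha>. (- ?w k) ^ (\<alpha> - Suc \<tau>) * 0)"
      unfolding parts
      by (intro tendsto_add tendsto_mult tendsto_const tendsto_sum) (use wave_boundary_tendsto_0[OF f] in \<open>auto simp: F_def\<close>)
    then show ?thesis by simp
  qed
  define b where "b k = real (Suc k) ^ \<alpha> * u k" for k
  have b_le: "(\<Sum>k<M. (b k)\<^sup>2) \<le> snd S f f" for M
  proof -
    have "(\<lambda>N. \<Sum>k<M. (unit_inner (F N \<alpha>) (half_wave (0 - real \<alpha> * pi / 2) k))\<^sup>2) \<longlonglongrightarrow> (\<Sum>k<M. ((- ?w k) ^ \<alpha> * u k)\<^sup>2)"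
      by (intro tendsto_sum tendsto_power lim)
    moreover have "(\<Sum>k<M. (unit_inner (F N \<alpha>) (half_wave (0 - real \<alpha> * pi / 2) k))\<^sup>2) \<le> snd S f f" for N
    proof -
      have "unit_orthonormal (half_wave (0 - real \<alpha> * pi / 2)) {..<M}"
        by (rule half_wave_orthonormal[of _ "- int \<alpha>"]) simp
      from unit_Bessel[OF this _ Fc] top_le show ?thesis by (meson finite_lessThan order_trans)
    qed
    ultimately have "(\<Sum>k<M. ((- ?w k) ^ \<alpha> * u k)\<^sup>2) \<le> snd S f f" by (intro LIMSEQ_le_const2) auto
    \<comment> \<open>The powers of \<open>pi\<close>, which are at least one, are dropped; hence
      the constant one in this direction.\<close>
    moreover have "(\<Sum>k<M. (b k)\<^sup>2) \<le> (\<Sum>k<M. ((- ?w k) ^ \<alpha> * u k)\<^sup>2)"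
    proof (rule sum_mono)
      fix k
      have "(real (Suc k) ^ \<alpha>)\<^sup>2 \<le> (?w k ^ \<alpha>)\<^sup>2"
        by (intro power_mono) (use pi_ge_two in auto)
      moreover have "((- ?w k) ^ \<alpha>)\<^sup>2 = (?w k ^ \<alpha>)\<^sup>2"
        by (simp only: power2_eq_square power_mult_distrib[symmetric] minus_mult_minus)
      ultimately show "(b k)\<^sup>2 \<le> ((- ?w k) ^ \<alpha> * u k)\<^sup>2" unfolding b_def power_mult_distrib[of _ "u k"] by (intro mult_right_mono) auto
    qed
    ultimately show ?thesis by linarith
  qed
  have bs: "summable (\<lambda>k. (b k)\<^sup>2)" by (rule summableI_nonneg_bounded[OF _ b_le]) simp
  have ub: "u k = b k * (1 / real (Suc k) ^ \<alpha>)" for k by (simp add: b_def)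
  have "summable (\<lambda>k. \<bar>u k\<bar>)"
  proof (rule summable_comparison_test'[OF summable_mult_of_squares[OF bs inverse_Suc_square_summable]])
    fix k :: nat
    have "real (Suc k) ^ 1 \<le> real (Suc k) ^ \<alpha>" by (rule power_increasing[OF \<alpha>]) simp
    then have "1 / real (Suc k) ^ \<alpha> \<le> 1 / real (Suc k)" by (simp add: frac_le)
    then have "\<bar>b k\<bar> * (1 / real (Suc k) ^ \<alpha>) \<le> \<bar>b k\<bar> * (1 / real (Suc k))" by (rule mult_left_mono) simp
    then show "norm \<bar>u k\<bar> \<le> \<bar>b k * (1 / real (Suc k))\<bar>" unfolding ub by (simp add: abs_mult)
  qed
  then have exp: "(\<lambda>k. u k * half_wave 0 k x) sums (f x - integral {0..1} f)" if "x \<in> {0..1}" for x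
    unfolding u_def by (rule half_wave_expansion[OF fc _ that])
  have mean0: "integral {0..1} f = 0" using integral_eq_inner_one(2)[OF fS] mean by simp
  show ?thesis
  proof (rule that[OF bs])
    show "(\<Sum>k. (b k)\<^sup>2) \<le> snd S f f" by (rule suminf_le_const[OF bs b_le])
    show "(\<lambda>k. b k * cos_feature \<alpha> k 0 x) sums f x" if "x \<in> {0..1}" for x
    proof -
      have "b k * cos_feature \<alpha> k 0 x = u k * half_wave 0 k x" for k
        unfolding ub by (simp add: cos_feature_def del: of_nat_Suc)
      then show ?thesis using exp[OF that] mean0 by simp
    qed
  qed
qed


section \<open>The complement of the constants and the univariate kernel inequalities\<close>

private abbreviation "T \<equiv> sob_odd_bdry0_space \<alpha>"
private abbreviation "K \<equiv> sob_odd_bdry0_kernel1 \<alpha>"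
private abbreviation "L \<equiv> \<lambda>x y. -1 + K x y"
private abbreviation "one \<equiv> (\<lambda>x\<in>{0..1::real}. 1 :: real)"

interpretation T: rkhs "{0..1}" T K by (rule V_rkhs)

text \<open>Since \<open>1\<close> has norm one in the space, \<open>L\<close> is the kernel of its orthogonal complement; the
  function \<open>h\<close> is the combination of the sections of \<open>L\<close> with coefficients \<open>c\<close>.\<close>

private lemma mean_free_section:
  assumes c: "c \<in> finsupp {0..1}"
  obtains h where "h \<in> V" "snd T h one = 0" "snd T h h = quad L c c"
    "\<And>f. f \<in> V \<Longrightarrow> snd T f one = 0 \<Longrightarrow> snd T f h = lin f c"
proof -
  define g where "g = (\<lambda>x\<in>{0..1}. lin (K x) c)"
  define s where "s = lin (\<lambda>x. 1) c"
  have g: "g \<in> V" unfolding g_def by (rule T.section_lincomb(1)[OF c])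
  have fg: "snd T f g = lin f c" if "f \<in> V" for f unfolding g_def by (rule T.section_lincomb(2)[OF c that])
  have oo: "snd T one one = 1" using V_inner[OF one_mem one_mem] one_inner by simp
  have go: "snd T g one = s"
    unfolding T.inner_commute[of g] fg[OF one_mem] s_def by (rule lin_restrict[OF c])
  have gg: "snd T g g = quad K c c" unfolding g_def by (rule T.inner_section_lincomb[OF c c])
  let ?h = "\<lambda>x\<in>{0..1}. g x + (- s) * one x"
  have h: "?h \<in> V" by (rule T.axpy_mem[OF g one_mem])
  have ho: "snd T ?h one = 0" unfolding T.inner_axpy[OF g one_mem one_mem] go oo by simp
  \<comment> \<open>Writing 1 as a product exhibits it as a rank one kernel, whose quadratic form is
    the square of \<open>s\<close>.\<close>
  have "quad L c c = quad (\<lambda>x y. K x y - 1 * 1) c c" by (simp add: algebra_simps)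
  then have q: "quad L c c = quad K c c - s\<^sup>2"
    unfolding quad_kernel_diff quad_rank_one s_def by (simp add: power2_eq_square)
  have "snd T ?h ?h = quad L c c"
    unfolding T.inner_axpy_self[OF g one_mem] go oo gg q by (simp add: power2_eq_square)
  moreover have "snd T f ?h = lin f c" if f: "f \<in> V" and fo: "snd T f one = 0" for f
    using T.inner_axpy[OF g one_mem f, of "- s"] fg[OF f] fo by (simp only: T.inner_commute[of _ f] mult_zero_right add_0_right)
  ultimately show ?thesis using h ho by (intro that)
qed

lemma psd_sob_odd_bdry0_kernel1: "psd {0..1} L"
  unfolding psd_def
proof (intro conjI ballI)
  show "L x y = L y x" if "x \<in> {0..1}" "y \<in> {0..1}" for x y using T.kernel_commute[OF that] by simp
  fix c :: "real \<Rightarrow> real" assume c: "c \<in> finsupp {0..1}"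
  obtain h where h: "snd T h h = quad L c c" by (rule mean_free_section[OF c]) (rule that)
  show "0 \<le> quad L c c" unfolding h[symmetric] by (rule T.inner_self_nonneg)
qed

lemma psd_cos_kernel1: "psd {0..1} (cos_kernel1 \<alpha>)"
  by (rule psd_sums[OF cos_kernel1_sums[OF \<alpha>]])

text \<open>Let \<open>f\<close> be the combination of cosine sections with coefficients
  \<open>c\<close>, and \<open>h\<close> that of the sections of \<open>L\<close>. Their inner
  product in \<open>T\<close> is \<open>?q\<close>, while their squared norms are at most
  \<open>?C * ?q\<close> and equal to \<open>quad L c c\<close>. Cauchy-Schwarz gives the inequality
  after cancelling one factor \<open>?q\<close>.\<close>

lemma cos_kernel1_le_sob:
  "psd {0..1} (\<lambda>x y. real (Suc \<alpha>) * pi ^ (2 * \<alpha>) * L x y - cos_kernel1 \<alpha> x y)"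
  unfolding psd_def
proof (intro conjI ballI)
  fix x y :: real assume "x \<in> {0..1}" "y \<in> {0..1}"
  then show "real (Suc \<alpha>) * pi ^ (2 * \<alpha>) * L x y - cos_kernel1 \<alpha> x y = real (Suc \<alpha>) * pi ^ (2 * \<alpha>) * L y x - cos_kernel1 \<alpha> y x"
    using psd_commute[OF psd_cos_kernel1, of x y] T.kernel_commute[of x y] by simp
next
  fix c :: "real \<Rightarrow> real" assume c: "c \<in> finsupp {0..1}"
  let ?C = "real (Suc \<alpha>) * pi ^ (2 * \<alpha>)" and ?q = "quad (cos_kernel1 \<alpha>) c c"
  obtain h where h: "h \<in> V" "snd T h h = quad L c c"
    "\<And>f. f \<in> V \<Longrightarrow> snd T f one = 0 \<Longrightarrow> snd T f h = lin f c"
    by (rule mean_free_section[OF c]) (rule that)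
  define b where "b k = lin (cos_feature \<alpha> k 0) c" for k
  have b: "(\<lambda>k. (b k)\<^sup>2) sums ?q" unfolding b_def by (rule quad_sums[OF c cos_kernel1_sums[OF \<alpha>]])
  define f where "f = (\<lambda>x\<in>{0..1}. lin (cos_kernel1 \<alpha> x) c)"
  have f_sums: "(\<lambda>k. b k * cos_feature \<alpha> k 0 x) sums f x" if "x \<in> {0..1}" for x
  proof -
    have "(\<lambda>k. lin (\<lambda>y. cos_feature \<alpha> k 0 x * cos_feature \<alpha> k 0 y) c) sums lin (cos_kernel1 \<alpha> x) c"
      by (rule lin_sums[OF c cos_kernel1_sums[OF \<alpha>]])
    then show ?thesis using that unfolding lin_fun_scale by (simp add: b_def f_def mult.commute)
  qed
  have ext: "f \<in> extensional {0..1}" by (simp only: f_def restrict_extensional)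
  note F = cos_series_mem[OF sums_summable[OF b] ext f_sums]
  have lf: "lin f c = ?q" unfolding f_def lin_restrict[OF c] quad_def ..
  have ff: "snd T f f \<le> ?C * ?q"
    using F(2) V_inner[OF F(1) F(1)] sums_unique[OF b] by simp
  have "snd T f h = ?q" using h(3)[OF F(1)] F(3) V_inner[OF F(1) one_mem] lf by simp
  then have "?q\<^sup>2 \<le> snd T f f * quad L c c" using T.Cauchy_Schwarz[OF F(1) h(1)] h(2) by simp
  also have "\<dots> \<le> ?C * ?q * quad L c c"
    by (rule mult_right_mono[OF ff psd_quad_nonneg[OF psd_sob_odd_bdry0_kernel1 c]])
  finally have "?q * ?q \<le> ?q * (?C * quad L c c)" by (simp add: power2_eq_square mult_ac)
  moreover have "0 \<le> ?q" by (rule psd_quad_nonneg[OF psd_cos_kernel1 c])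
  moreover have "0 \<le> ?C * quad L c c"
    by (intro mult_nonneg_nonneg psd_quad_nonneg[OF psd_sob_odd_bdry0_kernel1 c]) auto
  ultimately have "?q \<le> ?C * quad L c c" by (rule mult_self_le_cancel)
  then show "0 \<le> quad (\<lambda>x y. ?C * L x y - cos_kernel1 \<alpha> x y) c c"
    unfolding quad_kernel_diff quad_kernel_scale by simp
qed

text \<open>Here the combination \<open>h\<close> of sections of \<open>L\<close> is expanded in
  cosine features. Its squared norm \<open>?l\<close> equals \<open>lin h c\<close>, a sum of
  products of its coefficients with those of \<open>c\<close>, and the two sums of squares are at
  most \<open>?l\<close> and equal to \<open>?q\<close>.\<close>

lemma sob_le_cos_kernel1: "psd {0..1} (\<lambda>x y. cos_kernel1 \<alpha> x y - L x y)"
  unfolding psd_def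
proof (intro conjI ballI)
  fix x y :: real assume "x \<in> {0..1}" "y \<in> {0..1}"
  then show "cos_kernel1 \<alpha> x y - L x y = cos_kernel1 \<alpha> y x - L y x"
    using psd_commute[OF psd_cos_kernel1, of x y] T.kernel_commute[of x y] by simp
next
  fix c :: "real \<Rightarrow> real" assume c: "c \<in> finsupp {0..1}"
  let ?q = "quad (cos_kernel1 \<alpha>) c c" and ?l = "quad L c c"
  obtain h where h: "h \<in> V" "snd T h one = 0" "snd T h h = ?l"
    and hf: "\<And>f. f \<in> V \<Longrightarrow> snd T f one = 0 \<Longrightarrow> snd T f h = lin f c"
    by (rule mean_free_section[OF c]) (rule that)
  have mean: "snd S h one = 0" using h(2) V_inner[OF h(1) one_mem] by simp
  obtain b where b: "summable (\<lambda>k. (b k)\<^sup>2)" "(\<Sum>k. (b k)\<^sup>2) \<le> snd S h h"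
    "\<And>x. x \<in> {0..1} \<Longrightarrow> (\<lambda>k. b k * cos_feature \<alpha> k 0 x) sums h x"
    by (rule cos_expansion[OF h(1) mean]) (rule that)
  have q: "(\<lambda>k. (lin (cos_feature \<alpha> k 0) c)\<^sup>2) sums ?q" by (rule quad_sums[OF c cos_kernel1_sums[OF \<alpha>]])
  have q0: "0 \<le> ?q" by (rule psd_quad_nonneg[OF psd_cos_kernel1 c])
  have l0: "0 \<le> ?l" by (rule psd_quad_nonneg[OF psd_sob_odd_bdry0_kernel1 c])
  have "?l = lin h c" using hf[OF h(1,2)] h(3) by simp
  also have "lin h c = (\<Sum>k. b k * lin (cos_feature \<alpha> k 0) c)"
    using lin_sums[OF c b(3)] unfolding lin_fun_scale by (rule sums_unique)
  finally have "?l\<^sup>2 = (\<Sum>k. b k * lin (cos_feature \<alpha> k 0) c)\<^sup>2" by (simp only:)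
  also have "\<dots> \<le> (\<Sum>k. (b k)\<^sup>2) * ?q"
    unfolding sums_unique[OF q] by (rule Cauchy_Schwarz_suminf[OF b(1) sums_summable[OF q]])
  also have "\<dots> \<le> ?l * ?q"
    using b(2) h(3) V_inner[OF h(1) h(1)] q0 by (intro mult_right_mono) auto
  finally have "?l * ?l \<le> ?l * ?q" by (simp only: power2_eq_square)
  then have "?l \<le> ?q" using l0 q0 by (rule mult_self_le_cancel)
  then show "0 \<le> quad (\<lambda>x y. cos_kernel1 \<alpha> x y - L x y) c c" unfolding quad_kernel_diff by simp
qed

end

section \<open>Weighted products of kernels\<close>

definition weighted_product_kernel ::
    "(nat set \<Rightarrow> real) \<Rightarrow> nat \<Rightarrow> (real \<Rightarrow> real \<Rightarrow> real) \<Rightarrow> (nat \<Rightarrow> real) \<Rightarrow> (nat \<Rightarrow> real) \<Rightarrow> real" where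
  "weighted_product_kernel \<gamma> s K x y = 1 + (\<Sum>u\<in>Pow {1..s} - {{}}. \<gamma> u * (\<Prod>j\<in>u. K (x j) (y j)))"

lemma psd_coordinate:
  assumes "psd {0..1} K" "j \<in> {1..s}"
  shows "psd (unit_cube s) (\<lambda>x y. K (x j) (y j))"
  by (rule psd_pullback[OF assms(1)]) (use assms(2) in \<open>auto simp: unit_cube_def\<close>)

lemma psd_weighted_product:
  assumes "psd {0..1} K" and \<gamma>: "\<And>u. u \<subseteq> {1..s} \<Longrightarrow> \<gamma> u \<ge> 0"
  shows "psd (unit_cube s) (weighted_product_kernel \<gamma> s K)"
  unfolding weighted_product_kernel_def[abs_def]
  by (intro psd_add psd_const psd_sum psd_scale psd_prod psd_coordinate[OF assms(1)] \<gamma>) auto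

text \<open>The natural constant for the subset \<open>u\<close> is \<open>C ^ card u\<close>, but
  one constant has to serve all subsets. \<open>C ^ s\<close> does, and the excess
  \<open>C ^ s - C ^ card u\<close> multiplies a positive semidefinite product.\<close>

lemma weighted_product_le:
  assumes K: "psd {0..1} K" and L: "psd {0..1} L" and le: "psd {0..1} (\<lambda>x y. C * L x y - K x y)"
    and C: "C \<ge> 1" and \<gamma>: "\<And>u. u \<subseteq> {1..s} \<Longrightarrow> \<gamma> u \<ge> 0"
  shows "psd (unit_cube s) (\<lambda>x y. C ^ s * weighted_product_kernel \<gamma> s L x y - weighted_product_kernel \<gamma> s K x y)"
proof -
  let ?P = "\<lambda>K u x y. \<Prod>j\<in>u. K (x j) (y j)"
  have "psd (unit_cube s) (\<lambda>x y. (C ^ s - C ^ card u) * ?P L u x y + (C ^ card u * ?P L u x y - ?P K u x y))"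
    if u: "u \<in> Pow {1..s} - {{}}" for u
  proof (rule psd_add)
    have "card u \<le> s" using card_mono[of "{1..s}" u] u by simp
    then have "C ^ card u \<le> C ^ s" by (rule power_increasing[OF _ C])
    then show "psd (unit_cube s) (\<lambda>x y. (C ^ s - C ^ card u) * ?P L u x y)"
      by (intro psd_scale psd_prod psd_coordinate[OF L]) (use u in auto)
    show "psd (unit_cube s) (\<lambda>x y. C ^ card u * ?P L u x y - ?P K u x y)"
    proof (rule psd_prod_diff)
      show "finite u" using u finite_subset[of u "{1..s}"] by auto
      fix j assume "j \<in> u"
      then have j: "j \<in> {1..s}" using u by auto
      show "psd (unit_cube s) (\<lambda>x y. K (x j) (y j))" by (rule psd_coordinate[OF K j])
      show "psd (unit_cube s) (\<lambda>x y. L (x j) (y j))" by (rule psd_coordinate[OF L j])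
      show "psd (unit_cube s) (\<lambda>x y. C * L (x j) (y j) - K (x j) (y j))" by (rule psd_coordinate[OF le j])
    qed (use C in simp)
  qed
  note summand = this
  \<comment> \<open>The leading 1 of both kernels belongs to the empty subset and leaves the
    constant \<open>C ^ s - 1\<close>.\<close>
  have "psd (unit_cube s) (\<lambda>x y. (C ^ s - 1) + (\<Sum>u\<in>Pow {1..s} - {{}}.
      \<gamma> u * ((C ^ s - C ^ card u) * ?P L u x y + (C ^ card u * ?P L u x y - ?P K u x y))))"
  proof (rule psd_add[OF psd_const psd_sum])
    fix u assume u: "u \<in> Pow {1..s} - {{}}"
    show "psd (unit_cube s) (\<lambda>x y. \<gamma> u * ((C ^ s - C ^ card u) * ?P L u x y + (C ^ card u * ?P L u x y - ?P K u x y)))"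
      by (rule psd_scale[OF summand[OF u] \<gamma>]) (use u in simp)
  qed (use C in simp)
  moreover have "(C ^ s - 1) + (\<Sum>u\<in>Pow {1..s} - {{}}.
      \<gamma> u * ((C ^ s - C ^ card u) * ?P L u x y + (C ^ card u * ?P L u x y - ?P K u x y)))
    = C ^ s * weighted_product_kernel \<gamma> s L x y - weighted_product_kernel \<gamma> s K x y" for x y
    unfolding weighted_product_kernel_def
    by (simp add: sum_distrib_left sum_subtractf algebra_simps)
  ultimately show ?thesis by simp
qed

lemma weighted_product_embedded:
  assumes K: "psd {0..1} K" and L: "psd {0..1} L" and le: "psd {0..1} (\<lambda>x y. C * L x y - K x y)"
    and C: "C \<ge> 1" and \<gamma>: "\<And>u. u \<subseteq> {1..s} \<Longrightarrow> \<gamma> u \<ge> 0"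
  shows "continuously_embedded (rkhs_of (unit_cube s) (weighted_product_kernel \<gamma> s K))
    (rkhs_of (unit_cube s) (weighted_product_kernel \<gamma> s L))"
proof (rule continuously_embedded_if_kernel_le)
  show "rkhs (unit_cube s) (rkhs_of (unit_cube s) (weighted_product_kernel \<gamma> s K)) (weighted_product_kernel \<gamma> s K)"
    by (rule rkhs_rkhs_of[OF psd_weighted_product[OF K \<gamma>]])
  show "rkhs (unit_cube s) (rkhs_of (unit_cube s) (weighted_product_kernel \<gamma> s L)) (weighted_product_kernel \<gamma> s L)"
    by (rule rkhs_rkhs_of[OF psd_weighted_product[OF L \<gamma>]])
  show "psd (unit_cube s) (\<lambda>x y. C ^ s * weighted_product_kernel \<gamma> s L x y - weighted_product_kernel \<gamma> s K x y)"
    by (rule weighted_product_le[OF K L le C \<gamma>])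
qed (use C in simp)

theorem lemma1:
  fixes \<alpha> s :: nat and \<gamma> :: "nat set \<Rightarrow> real"
  assumes "\<alpha> \<ge> 1" and "s \<ge> 1"
    and "\<And>u. u \<subseteq> {1..s} \<Longrightarrow> \<gamma> u \<ge> 0"
  shows "norm_equivalent (rkhs_of (unit_cube s) (cos_kernel \<alpha> \<gamma> s))
           (rkhs_of (unit_cube s) (sob_odd_bdry0_kernel \<alpha> \<gamma> s))"
proof -
  let ?L = "\<lambda>x y. -1 + sob_odd_bdry0_kernel1 \<alpha> x y"
  have cos: "cos_kernel \<alpha> \<gamma> s = weighted_product_kernel \<gamma> s (cos_kernel1 \<alpha>)"
    by (simp add: fun_eq_iff cos_kernel_def weighted_product_kernel_def cos_kernel1_def)
  have sob: "sob_odd_bdry0_kernel \<alpha> \<gamma> s = weighted_product_kernel \<gamma> s ?L"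
    by (simp add: fun_eq_iff sob_odd_bdry0_kernel_def weighted_product_kernel_def)
  \<comment> \<open>The passage to products raises the univariate constant to different powers and
    compares them, so the constant has to be at least one.\<close>
  have "(1 :: real) * 1 \<le> real (Suc \<alpha>) * pi ^ (2 * \<alpha>)"
    using pi_ge_two by (intro mult_mono one_le_power) auto
  then have C: "1 \<le> real (Suc \<alpha>) * pi ^ (2 * \<alpha>)" by simp
  have le: "psd {0..1} (\<lambda>x y. 1 * cos_kernel1 \<alpha> x y - ?L x y)"
    using sob_le_cos_kernel1[OF assms(1)] by simp
  note psd = psd_cos_kernel1[OF assms(1)] psd_sob_odd_bdry0_kernel1[OF assms(1)]
  show ?thesis
    unfolding norm_equivalent_def cos sob
  proof (intro conjI)
    show "continuously_embedded (rkhs_of (unit_cube s) (weighted_product_kernel \<gamma> s (cos_kernel1 \<alpha>)))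
        (rkhs_of (unit_cube s) (weighted_product_kernel \<gamma> s ?L))"
      by (rule weighted_product_embedded[where C = "real (Suc \<alpha>) * pi ^ (2 * \<alpha>)"])
        (fact psd C assms(3) cos_kernel1_le_sob[OF assms(1)])+
    show "continuously_embedded (rkhs_of (unit_cube s) (weighted_product_kernel \<gamma> s ?L))
        (rkhs_of (unit_cube s) (weighted_product_kernel \<gamma> s (cos_kernel1 \<alpha>)))"
      by (rule weighted_product_embedded[where C = 1]) (fact psd le order_refl assms(3))+
  qed
qed

end
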